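(* Let $2\leq l\leq l'<n$ and $r,r'\in\mathbb{Z}_n$. Assume $t=l+l'-(n+1)\geq 0$. Then, as $H_n(1,q)$-modules, $$\begin{aligned}P(l,r)\otimes P(l',r')\cong&\Big(\bigoplus_{i=c(t)}^{t}4P(l+l'-1-2i,\,r+r'+i)\Big)\\&\oplus\Big(\bigoplus_{i=t+1}^{l-1}2P(l+l'-1-2i,\,r+r'+i)\Big)\\&\oplus\Big(\bigoplus_{i=l'}^{n-1}2P(n+l+l'-1-2i,\,r+r'+i)\Big)\\&\oplus\Big(\bigoplus_{c(l'+l-1)\leq i\leq l'-1}4P(n+l+l'-1-2i,\,r+r'+i)\Big).\end{aligned}$$
   Context: Setting: $k$ is an algebraically closed field, $n>2$ is a fixed integer, $q\in k$ is a primitive $n$-th root of unity, $\mathbb{Z}_n=\mathbb{Z}/n\mathbb{Z}$, and $(i)_q=1+q+\cdots+q^{i-1}$. $H_n(1,q)$ is the Hopf algebra over $k$ (isomorphic to the Drinfeld double of the Taft algebra $H_n(q)$) generated as an algebra by $a,b,c,d$ with relations $ba=qab$, $db=qbd$, $ca=qac$, $dc=qcd$, $bc=cb$, $a^n=0$, $b^n=1$, $c^n=1$, $d^n=0$, $da-qad=1-bc$, with comultiplication $\Delta(a)=a\otimes b+1\otimes a$, $\Delta(b)=b\otimes b$, $\Delta(c)=c\otimes c$, $\Delta(d)=d\otimes c+1\otimes d$, counit $\varepsilon(a)=\varepsilon(d)=0$, $\varepsilon(b)=\varepsilon(c)=1$, and antipode $S(a)=-ab^{-1}$, $S(b)=b^{-1}$,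 $S(c)=c^{-1}$, $S(d)=-dc^{-1}$. All modules are finite-dimensional left $H_n(1,q)$-modules, $\otimes=\otimes_k$ with action through $\Delta$, and $sM$ is the direct sum of $s$ copies of $M$ ($sM=0$ if $s=0$). Simple modules: for $1\leq l\leq n$, $r\in\mathbb{Z}_n$, $V(l,r)$ has basis $v_1,\dots,v_l$ with $av_i=v_{i+1}$ for $i<l$, $av_l=0$, $bv_i=q^{r+i-1}v_i$, $cv_i=q^{i-r-l}v_i$, $dv_1=0$, $dv_i=\alpha_{i-1}(l)v_{i-1}$ for $1<i\leq l$, where $\alpha_i(l)=(i)_q(1-q^{i-l})$. For $1\leq l<n$, $P(l,r)$ is the projective cover of $V(l,r)$, and $P(n,r)=V(n,r)$ (which is projective). Conventions: integers in the second argument of $V$ and $P$ are read modulo $n$; $c(t)=\lfloor (t+1)/2\rfloor$ for $t\in\mathbb{Z}$ (the function $c(\cdot)$ is not to be confused with the generator $c$); a direct sum over an empty range of indices is zero. *)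

theory Defs
  imports
    "HOL-Computational_Algebra.Polynomial"
    "Jordan_Normal_Form.Matrix_Kernel"
begin

definition primitive_root_of_unity :: "nat \<Rightarrow> 'k::field \<Rightarrow> bool" where
  "primitive_root_of_unity n q \<longleftrightarrow>
     n > 0 \<and> q ^ n = 1 \<and> (\<forall>m. 0 < m \<and> m < n \<longrightarrow> q ^ m \<noteq> 1)"

definition q_int :: "'k::field \<Rightarrow> nat \<Rightarrow> 'k" where
  "q_int q i = (\<Sum>j<i. q ^ j)"

section \<open>Finite-dimensional modules over $H_n(1,q)$\<close>

text \<open>
  $H_n(1,q)$ is presented by the generators $a, b, c, d$ and the relations listed in
  \<open>is_module\<close> below.  Hence a left module structure on $k^m$ is the same thing as four
  $m \times m$ matrices, acting on column vectors, which satisfy these relations, and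
  $k$-linear maps are module maps iff they intertwine the four generators.  Up to the choice
  of a basis every finite-dimensional module is of this form; in particular, quantifying over
  all values of the record type below that satisfy \<open>is_module\<close> means quantifying over all
  finite-dimensional modules.
\<close>

datatype gen = Gen_a | Gen_b | Gen_c | Gen_d

record 'k hmod =
  mdim :: nat
  action :: "gen \<Rightarrow> 'k mat"

definition is_module :: "nat \<Rightarrow> 'k::field \<Rightarrow> 'k hmod \<Rightarrow> bool" where
  "is_module n q M \<longleftrightarrow>
    (\<forall>x. action M x \<in> carrier_mat (mdim M) (mdim M)) \<and>
    (let a = action M Gen_a; b = action M Gen_b; c = action M Gen_c; d = action M Gen_d in
      b * a = q \<cdot>\<^sub>m (a * b) \<and>
      d * b = q \<cdot>\<^sub>m (b * d) \<and>
      c * a = q \<cdot>\<^sub>m (a * c) \<and>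
      d * c = q \<cdot>\<^sub>m (c * d) \<and>
      b * c = c * b \<and>
      a ^\<^sub>m n = 0\<^sub>m (mdim M) (mdim M) \<and>
      b ^\<^sub>m n = 1\<^sub>m (mdim M) \<and>
      c ^\<^sub>m n = 1\<^sub>m (mdim M) \<and>
      d ^\<^sub>m n = 0\<^sub>m (mdim M) (mdim M) \<and>
      d * a - q \<cdot>\<^sub>m (a * d) = 1\<^sub>m (mdim M) - b * c)"

definition module_hom :: "'k::field hmod \<Rightarrow> 'k hmod \<Rightarrow> 'k mat set" where
  "module_hom M N =
    {T \<in> carrier_mat (mdim N) (mdim M). \<forall>x. T * action M x = action N x * T}"

definition module_iso :: "'k::field hmod \<Rightarrow> 'k hmod \<Rightarrow> bool" (infix \<open>\<cong>\<^sub>H\<close> 50) where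
  "M \<cong>\<^sub>H N \<longleftrightarrow>
    (\<exists>T \<in> module_hom M N. \<exists>S \<in> module_hom N M. S * T = 1\<^sub>m (mdim M) \<and> T * S = 1\<^sub>m (mdim N))"

definition surjective_hom :: "'k::field hmod \<Rightarrow> 'k hmod \<Rightarrow> 'k mat \<Rightarrow> bool" where
  "surjective_hom M N T \<longleftrightarrow>
    T \<in> module_hom M N \<and> (*\<^sub>v) T ` carrier_vec (mdim M) = carrier_vec (mdim N)"

definition is_submodule :: "'k::field vec set \<Rightarrow> 'k hmod \<Rightarrow> bool" where
  "is_submodule U M \<longleftrightarrow>
    subspace class_ring U (module_vec TYPE('k) (mdim M)) \<and>
    (\<forall>x. \<forall>u \<in> U. action M x *\<^sub>v u \<in> U)"

subsection \<open>Direct sums and tensor products\<close>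

definition direct_sum :: "'k::field hmod list \<Rightarrow> 'k hmod" where
  "direct_sum Ms =
    \<lparr>mdim = sum_list (map mdim Ms),
     action = (\<lambda>x. diag_block_mat (map (\<lambda>M. action M x) Ms))\<rparr>"

definition direct_sum2 :: "'k::field hmod \<Rightarrow> 'k hmod \<Rightarrow> 'k hmod" (infixr \<open>\<oplus>\<^sub>H\<close> 65) where
  "M \<oplus>\<^sub>H N = direct_sum [M, N]"

definition copies :: "nat \<Rightarrow> 'k::field hmod \<Rightarrow> 'k hmod" where
  "copies s M = direct_sum (replicate s M)"

text \<open>The Kronecker product is the matrix of $A \otimes B$ with respect to the basis
  $e_0 \otimes f_0, e_0 \otimes f_1, \dots, e_1 \otimes f_0, \dots$\<close>

definition kronecker :: "'k::field mat \<Rightarrow> 'k mat \<Rightarrow> 'k mat" where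
  "kronecker A B =
    mat (dim_row A * dim_row B) (dim_col A * dim_col B)
      (\<lambda>(i, j). A $$ (i div dim_row B, j div dim_col B) * B $$ (i mod dim_row B, j mod dim_col B))"

text \<open>The action on a tensor product is through the comultiplication
  $\Delta(a) = a \otimes b + 1 \otimes a$, $\Delta(b) = b \otimes b$, $\Delta(c) = c \otimes c$,
  $\Delta(d) = d \otimes c + 1 \otimes d$.\<close>

definition tensor :: "'k::field hmod \<Rightarrow> 'k hmod \<Rightarrow> 'k hmod" (infixr \<open>\<otimes>\<^sub>H\<close> 70) where
  "M \<otimes>\<^sub>H N =
    \<lparr>mdim = mdim M * mdim N,
     action = (\<lambda>x. case x of
         Gen_a \<Rightarrow> kronecker (action M Gen_a) (action N Gen_b)
                  + kronecker (1\<^sub>m (mdim M)) (action N Gen_a)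
       | Gen_b \<Rightarrow> kronecker (action M Gen_b) (action N Gen_b)
       | Gen_c \<Rightarrow> kronecker (action M Gen_c) (action N Gen_c)
       | Gen_d \<Rightarrow> kronecker (action M Gen_d) (action N Gen_c)
                  + kronecker (1\<^sub>m (mdim M)) (action N Gen_d))\<rparr>"

subsection \<open>Projective covers\<close>

definition projective :: "nat \<Rightarrow> 'k::field \<Rightarrow> 'k hmod \<Rightarrow> bool" where
  "projective n q P \<longleftrightarrow> is_module n q P \<and>
    (\<forall>M N g f. is_module n q M \<and> is_module n q N \<and> surjective_hom M N g \<and> f \<in> module_hom P N
      \<longrightarrow> (\<exists>h \<in> module_hom P M. g * h = f))"

definition superfluous :: "'k::field vec set \<Rightarrow> 'k hmod \<Rightarrow> bool" where
  "superfluous K M \<longleftrightarrow>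
    (\<forall>U. is_submodule U M \<and> {u + v | u v. u \<in> U \<and> v \<in> K} = carrier_vec (mdim M)
      \<longrightarrow> U = carrier_vec (mdim M))"

definition projective_cover :: "nat \<Rightarrow> 'k::field \<Rightarrow> 'k hmod \<Rightarrow> 'k hmod \<Rightarrow> bool" where
  "projective_cover n q P M \<longleftrightarrow> projective n q P \<and>
    (\<exists>p. surjective_hom P M p \<and> superfluous (mat_kernel p) P)"

subsection \<open>The simple modules\<close>

definition alpha :: "'k::field \<Rightarrow> nat \<Rightarrow> nat \<Rightarrow> 'k" where
  "alpha q i l = q_int q i * (1 - q powi (int i - int l))"

text \<open>Matrix indices start at 0, so the basis vector $v_i$ has index $i - 1$: with
  \<open>j = i - 1\<close>, the generator $b$ multiplies $v_i$ by $q^{r+j}$ and $c$ multiplies it by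
  $q^{j+1-r-l}$, and $d$ maps $v_i$ to $\alpha_j(l) v_{i-1}$.  The second
  argument is an integer representing a residue class modulo $n$; as $q^n = 1$, the module
  depends only on that class.\<close>

definition simple_module :: "'k::field \<Rightarrow> nat \<Rightarrow> int \<Rightarrow> 'k hmod" where
  "simple_module q l r =
    \<lparr>mdim = l,
     action = (\<lambda>x. case x of
         Gen_a \<Rightarrow> mat l l (\<lambda>(i, j). if i = j + 1 then 1 else 0)
       | Gen_b \<Rightarrow> mat l l (\<lambda>(i, j). if i = j then q powi (r + int j) else 0)
       | Gen_c \<Rightarrow> mat l l (\<lambda>(i, j). if i = j then q powi (int j + 1 - r - int l) else 0)
       | Gen_d \<Rightarrow> mat l l (\<lambda>(i, j). if j = i + 1 then alpha q j l else 0))\<rparr>"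

definition ceil_half :: "int \<Rightarrow> int" where
  "ceil_half t = \<lfloor>(of_int t + 1) / (2 :: rat)\<rfloor>"

end

theory Submission
  imports Defs "Jordan_Normal_Form.DL_Rank"
begin

text \<open>A projective module \<open>Q\<close> is determined by the dimensions of \<open>Hom(Q, V(m, s))\<close>, which are the
  multiplicities of the \<open>P(m, s)\<close> in \<open>Q\<close>.  As \<open>V(2, 0)\<close> is two-dimensional with a dual, tensoring
  with it preserves projectivity and, by adjunction and the exact sequences
  \<open>0 \<rightarrow> V(l + 1, r) \<rightarrow> V(2, 0) \<otimes> V(l, r) \<rightarrow> V(l - 1, r + 1) \<rightarrow> 0\<close> for \<open>l < n\<close> (for \<open>l = n\<close> there are Verma
  modules at both ends), acts on multiplicities by an explicit operator, \<open>V2_shift\<close>.  These sequences split after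
  tensoring with \<open>Q\<close>, so the multiplicities of \<open>V(l, r) \<otimes> Q\<close> satisfy a two-term recursion in
  \<open>l\<close>; starting from \<open>P(n, r) = V(n, r)\<close> and descending, the same recursion gives
  \<open>[P(l, r) \<otimes> Q] = 2 [V(l, r) \<otimes> Q] + 2 [V(n - l, r + l) \<otimes> Q]\<close>.  For \<open>Q = P(l', r')\<close> the recursion is
  solved by the Clebsch-Gordan sum of \<open>P(l + l' - 1 - 2 i, r + r' + i)\<close> in which indices above \<open>n\<close>
  are reflected at \<open>n\<close>; the reflection identifies summands in pairs, whence the factors \<open>4\<close>.\<close>

section \<open>Linear algebra\<close>

text \<open>The covers \<open>P m s\<close> are given only by their universal property: no basis, no
  composition series and no explicit action of the generators is at hand. What can be computed is
  \<open>Hom(P(m, s), V(m', s'))\<close>, and this suffices because projective modules with the same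
  numbers of homomorphisms to all simple modules are isomorphic. A second obstacle is the
  verification of \<open>a^n = 0 = d^n\<close> on a tensor product; it is an easy q-binomial
  computation when the left factor has \<open>a^2 = 0 = d^2\<close>. Hence only modules of dimension
  one and two act explicitly from the left; tensor products with a general \<open>V(j, r)\<close> or
  \<open>P(j, r)\<close> on the left arise as direct summands of iterated ones, which inherit the
  relations and projectivity. The factors 2 come from the wall at \<open>n\<close>:
  \<open>V(2, 0) \<otimes> V(n, r)\<close> is built from two Verma modules with the same two simple
  factors, so each neighbour is counted twice. The hypothesis \<open>t \<ge> 0\<close> says that the
  top index \<open>l + l' - 1 = n + t\<close> reaches this wall.\<close>

lemma assoc_mult_mat_dim:
  fixes A B C :: "'a :: semiring_0 mat"
  assumes "dim_col A = dim_row B" "dim_col B = dim_row C"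
  shows "A * B * C = A * (B * C)"
  using assoc_mult_mat[of A "dim_row A" "dim_row B" B "dim_row C" C "dim_col C"] assms
  by (metis carrier_matI)

lemma mult_add_distrib_dim:
  fixes A B C :: "'a :: semiring_0 mat"
  assumes "dim_col A = dim_row B" "dim_row B = dim_row C" "dim_col B = dim_col C"
  shows "A * (B + C) = A * B + A * C"
  using assms by (intro mult_add_distrib_mat) auto

lemma add_mult_distrib_dim:
  fixes A B C :: "'a :: semiring_0 mat"
  assumes "dim_col A = dim_row C" "dim_row A = dim_row B" "dim_col A = dim_col B"
  shows "(A + B) * C = A * C + B * C"
  using assms by (intro add_mult_distrib_mat[of _ "dim_row A" "dim_row C"]) auto

lemma mult_minus_distrib_dim:
  fixes A B C :: "'a :: ring mat"
  assumes "dim_col A = dim_row B" "dim_row B = dim_row C" "dim_col B = dim_col C"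
  shows "A * (B - C) = A * B - A * C"
  using assms by (intro mult_minus_distrib_mat) auto

lemma minus_mult_distrib_dim:
  fixes A B C :: "'a :: ring mat"
  assumes "dim_col A = dim_row C" "dim_row A = dim_row B" "dim_col A = dim_col B"
  shows "(A - B) * C = A * C - B * C"
  using assms by (intro minus_mult_distrib_mat[of _ "dim_row A" "dim_row C"]) auto

lemma smult_mult_dim:
  fixes A B :: "'a :: comm_semiring_0 mat"
  assumes "dim_col A = dim_row B"
  shows "(k \<cdot>\<^sub>m A) * B = k \<cdot>\<^sub>m (A * B)"
  by (rule mult_smult_assoc_mat[of _ _ "dim_row B"]) (use assms in auto)

lemma mult_smult_dim:
  fixes A B :: "'a :: comm_semiring_0 mat"
  assumes "dim_col A = dim_row B"
  shows "A * (k \<cdot>\<^sub>m B) = k \<cdot>\<^sub>m (A * B)"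
  by (rule mult_smult_distrib) (use assms in auto)

text \<open>With equations between dimensions as side conditions these work as rewrite rules: every
  variable occurs on the left-hand side, and the simplifier discharges the conditions.\<close>

lemmas mat_distrib = mult_add_distrib_dim add_mult_distrib_dim
  mult_minus_distrib_dim minus_mult_distrib_dim smult_mult_dim mult_smult_dim

lemma one_mult_mat [simp]: "dim_row A = m \<Longrightarrow> 1\<^sub>m m * A = (A :: 'a :: semiring_1 mat)"
  by (metis carrier_matI left_mult_one_mat)

lemma mult_one_mat [simp]: "dim_col A = m \<Longrightarrow> A * 1\<^sub>m m = (A :: 'a :: semiring_1 mat)"
  by (metis carrier_matI right_mult_one_mat)

lemma mat_add_zero [simp]:
  fixes A :: "'a :: monoid_add mat"
  assumes "dim_row A = r" "dim_col A = c"
  shows "A + 0\<^sub>m r c = A" "0\<^sub>m r c + A = A"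
  using assms by auto

lemma mat_diff_zero [simp]:
  fixes A :: "'a :: group_add mat"
  assumes "dim_row A = r" "dim_col A = c"
  shows "A - 0\<^sub>m r c = A"
  using assms by auto

lemma mat_diff_self [simp]:
  fixes A :: "'a :: group_add mat"
  shows "A - A = 0\<^sub>m (dim_row A) (dim_col A)"
  by auto

lemma mat_cancel_left:
  fixes A :: "'k :: semiring_1 mat"
  assumes "L * i = 1\<^sub>m (dim_row A)" "dim_col i = dim_row A" "dim_row B = dim_row A"
    "dim_col L = dim_row i" "i * A = i * B"
  shows "A = B"
  by (metis assms assoc_mult_mat_dim one_mult_mat)

lemma mat_cancel_right:
  fixes A :: "'k :: semiring_1 mat"
  assumes "p * R = 1\<^sub>m (dim_col A)" "dim_row p = dim_col A" "dim_col B = dim_col A"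
    "dim_row R = dim_col p" "A * p = B * p"
  shows "A = B"
  by (metis assms assoc_mult_mat_dim mult_one_mat)

section \<open>Spaces of matrices and their dimension\<close>

definition mat_subspace :: "nat \<Rightarrow> nat \<Rightarrow> 'k::field mat set \<Rightarrow> bool" where
  "mat_subspace r c S \<longleftrightarrow> S \<subseteq> carrier_mat r c \<and> 0\<^sub>m r c \<in> S \<and>
     (\<forall>A\<in>S. \<forall>B\<in>S. A + B \<in> S) \<and> (\<forall>k. \<forall>A\<in>S. k \<cdot>\<^sub>m A \<in> S)"

abbreviation mat_vs :: "nat \<Rightarrow> nat \<Rightarrow> 'k::field mat set \<Rightarrow> ('k, 'k mat) module" where
  "mat_vs r c S \<equiv> module_mat TYPE('k) r c\<lparr>carrier := S\<rparr>"

definition mat_dim :: "nat \<Rightarrow> nat \<Rightarrow> 'k::field mat set \<Rightarrow> nat" where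
  "mat_dim r c S = vectorspace.dim class_ring (mat_vs r c S)"

lemma mat_vs_simps:
  "carrier (mat_vs r c S) = S" "add (mat_vs r c S) = (+)" "zero (mat_vs r c S) = 0\<^sub>m r c"
  "module.smult (mat_vs r c S) = (\<cdot>\<^sub>m)"
  by (auto simp: module_mat_simps)

lemma mat_subspace_vectorspace:
  assumes "mat_subspace r c (S :: 'k::field mat set)"
  shows "vectorspace class_ring (mat_vs r c S)"
proof -
  interpret V: vectorspace class_ring "module_mat TYPE('k) r c" by (rule matrix_vs)
  have "submodule class_ring S (module_mat TYPE('k) r c)"
    using assms by unfold_locales (auto simp: mat_subspace_def module_mat_simps)
  thus ?thesis
    by (intro V.subspace_is_vs) (auto simp: subspace_def matrix_vs)
qed

text \<open>Row-major flattening. It embeds a space of matrices into a coordinate space, from which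
  finite dimensionality is inherited.\<close>

definition mat_to_vec :: "'k mat \<Rightarrow> 'k vec" where
  "mat_to_vec A = vec (dim_row A * dim_col A) (\<lambda>k. A $$ (k div dim_col A, k mod dim_col A))"

lemma div_less_of_less_mult: "k < r * (c::nat) \<Longrightarrow> k div c < r"
  by (simp add: less_mult_imp_div_less)

lemma mod_less_of_less_mult: "k < r * (c::nat) \<Longrightarrow> k mod c < c"
  by (metis mod_less_divisor mult_0_right not_less_zero gr0I)

lemma mult_add_less_mult: "i < r \<Longrightarrow> j < c \<Longrightarrow> i * c + j < r * (c::nat)"
proof -
  assume "i < r" "j < c"
  hence "i * c + j < Suc i * c" "Suc i * c \<le> r * c" by (simp, intro mult_le_mono1, simp)
  thus ?thesis by linarith
qed

lemma inj_on_mat_to_vec: "inj_on (mat_to_vec :: 'k mat \<Rightarrow> 'k vec) (carrier_mat r c)"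
proof (rule inj_onI)
  fix A B :: "'k mat"
  assume A: "A \<in> carrier_mat r c" and B: "B \<in> carrier_mat r c" and eq: "mat_to_vec A = mat_to_vec B"
  show "A = B"
  proof (rule eq_matI)
    fix i j assume "i < dim_row B" "j < dim_col B"
    hence ij: "i < r" "j < c" using B by auto
    have "mat_to_vec A $ (i * c + j) = mat_to_vec B $ (i * c + j)" using eq by simp
    thus "A $$ (i,j) = B $$ (i,j)"
      using A B ij mult_add_less_mult[OF ij] by (auto simp: mat_to_vec_def)
  qed (use A B in auto)
qed

lemma (in linear_map) lin_indpt_image:
  assumes inj: "inj_on T (carrier V)" and B: "finite B" "B \<subseteq> carrier V" "V.module.lin_indpt B"
  shows "W.module.lin_indpt (T ` B)"
proof (rule W.module.finite_lin_indpt2)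
  show "finite (T ` B)" "T ` B \<subseteq> carrier W" using B by auto
  fix a assume a: "a \<in> T ` B \<rightarrow> carrier K" and lc: "W.module.lincomb a (T ` B) = \<zero>\<^bsub>W\<^esub>"
  have aT: "a \<circ> T \<in> B \<rightarrow> carrier K" using a by auto
  have "T (V.module.lincomb (a \<circ> T) B) = T \<zero>\<^bsub>V\<^esub>"
    using lincomb_linear_image[OF inj B(2) a B(1)] lc by simp
  hence "V.module.lincomb (a \<circ> T) B = \<zero>\<^bsub>V\<^esub>"
    using inj_onD[OF inj] V.module.lincomb_closed[OF B(2) aT] V.module.M.zero_closed by blast
  from V.not_lindepD[OF B(3,1) order.refl aT this] show "\<forall>v\<in>T ` B. a v = \<zero>\<^bsub>K\<^esub>" by auto
qed

text \<open>Injective maps preserve independence, so independent sets in the source have at most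
  \<open>W.dim\<close> elements; a maximal one among them is a finite basis.\<close>

lemma (in linear_map) fin_dim_of_inj:
  assumes inj: "inj_on T (carrier V)" and fd: "W.fin_dim"
  shows "V.fin_dim"
proof -
  have card_le: "card B \<le> W.dim" if B: "finite B" "B \<subseteq> carrier V" "V.module.lin_indpt B" for B
  proof -
    have "card (T ` B) \<le> W.dim"
      using W.li_le_dim(2)[OF fd _ lin_indpt_image[OF inj B]] B by auto
    thus ?thesis using inj B by (metis card_image inj_on_subset)
  qed
  have bd: "finite A \<and> card A \<le> W.dim" if A: "A \<subseteq> carrier V \<and> V.module.lin_indpt A" for A
  proof -
    have "finite A"
    proof (rule ccontr)
      assume "infinite A"
      then obtain B where B: "B \<subseteq> A" "finite B" "card B = Suc W.dim"
        using infinite_arbitrarily_large by blast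
      hence "card B \<le> W.dim" using A V.module.subset_li_is_li[of A B] by (intro card_le) auto
      thus False using B by simp
    qed
    thus ?thesis using A card_le by blast
  qed
  have "V.module.lin_indpt {}" by (auto simp: V.module.lin_dep_def)
  then obtain A where A: "finite A" "maximal A (\<lambda>S. S \<subseteq> carrier V \<and> V.module.lin_indpt S)"
    using maximal_exists[of "\<lambda>S. S \<subseteq> carrier V \<and> V.module.lin_indpt S" W.dim "{}"] bd by auto
  have "V.basis A" by (rule V.max_li_is_basis[OF A(2)])
  thus ?thesis using A(1) unfolding V.fin_dim_def V.basis_def by auto
qed

lemma mat_subspace_fin_dim:
  assumes S: "mat_subspace r c (S :: 'k::field mat set)"
  shows "vectorspace.fin_dim class_ring (mat_vs r c S)"
proof -
  let ?V = "mat_vs r c S" and ?W = "module_vec TYPE('k) (r * c)"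
  interpret V: vectorspace class_ring ?V by (rule mat_subspace_vectorspace[OF S])
  interpret W: vectorspace class_ring ?W by (rule vec_vs)
  have car: "A \<in> S \<Longrightarrow> A \<in> carrier_mat r c" for A using S by (auto simp: mat_subspace_def)
  have "mat_to_vec \<in> LinearCombinations.module_hom class_ring ?V ?W"
    unfolding LinearCombinations.module_hom_def mat_vs_simps module_vec_simps
    by (auto simp: mat_to_vec_def carrier_matD[OF car] class_ring_simps
        div_less_of_less_mult mod_less_of_less_mult intro!: eq_vecI)
  then interpret T: linear_map class_ring ?V ?W mat_to_vec
    by unfold_locales
  show ?thesis
  proof (rule T.fin_dim_of_inj)
    show "inj_on mat_to_vec (carrier ?V)"
      using inj_on_mat_to_vec[of r c] car by (auto simp: mat_vs_simps inj_on_def)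
    show "W.fin_dim" by (rule vec_space.fin_dim)
  qed
qed

text \<open>Rank-nullity twice: \<open>f\<close> has zero kernel, and the kernel of \<open>g\<close>
  is the image of \<open>f\<close>. The maps are arbitrary functions that are linear on the given
  subspaces, so composition with a homomorphism on either side and the adjunction are all
  covered.\<close>

lemma mat_dim_exact:
  fixes S1 S2 S3 :: "'k::field mat set"
  assumes S: "mat_subspace r1 c1 S1" "mat_subspace r2 c2 S2" "mat_subspace r3 c3 S3"
    and f: "f \<in> S1 \<rightarrow> S2" "\<And>A B. A \<in> S1 \<Longrightarrow> B \<in> S1 \<Longrightarrow> f (A + B) = f A + f B"
      "\<And>k A. A \<in> S1 \<Longrightarrow> f (k \<cdot>\<^sub>m A) = k \<cdot>\<^sub>m f A"
    and g: "\<And>A B. A \<in> S2 \<Longrightarrow> B \<in> S2 \<Longrightarrow> g (A + B) = g A + g B"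
      "\<And>k A. A \<in> S2 \<Longrightarrow> g (k \<cdot>\<^sub>m A) = k \<cdot>\<^sub>m g A"
    and inj: "inj_on f S1" and surj: "g ` S2 = S3"
    and exact: "\<And>A. A \<in> S2 \<Longrightarrow> g A = 0\<^sub>m r3 c3 \<longleftrightarrow> A \<in> f ` S1"
  shows "mat_dim r2 c2 S2 = mat_dim r1 c1 S1 + mat_dim r3 c3 S3"
proof -
  let ?V1 = "mat_vs r1 c1 S1" and ?V2 = "mat_vs r2 c2 S2" and ?V3 = "mat_vs r3 c3 S3"
  have "linear_map class_ring ?V1 ?V2 f"
    unfolding linear_map_def mod_hom_def mod_hom_axioms_def
    using S[THEN mat_subspace_vectorspace] f
    by (auto simp: LinearCombinations.module_hom_def mat_vs_simps vectorspace_def)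
  then interpret F: linear_map class_ring ?V1 ?V2 f .
  have "linear_map class_ring ?V2 ?V3 g"
    unfolding linear_map_def mod_hom_def mod_hom_axioms_def
    using S[THEN mat_subspace_vectorspace] g surj
    by (auto simp: LinearCombinations.module_hom_def mat_vs_simps vectorspace_def)
  then interpret G: linear_map class_ring ?V2 ?V3 g .
  have imf: "F.imT = G.kerT"
    using exact f(1) by (auto simp: F.im_def G.ker_def mat_vs_simps)
  have img: "G.imT = S3" using surj by (simp add: G.im_def mat_vs_simps)
  have "vectorspace.dim class_ring (?V2\<lparr>carrier := F.imT\<rparr>) + 0 = mat_dim r1 c1 S1"
    using F.rank_nullity[OF mat_subspace_fin_dim[OF S(1)]] F.inj_imp_dim_ker0 inj
    by (simp add: mat_vs_simps mat_dim_def)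
  moreover have "vectorspace.dim class_ring (?V3\<lparr>carrier := S3\<rparr>)
      + vectorspace.dim class_ring (?V2\<lparr>carrier := F.imT\<rparr>) = mat_dim r2 c2 S2"
    using G.rank_nullity[OF mat_subspace_fin_dim[OF S(2)]] unfolding img imf
    by (simp add: mat_dim_def)
  ultimately show ?thesis by (simp add: mat_dim_def)
qed

lemma mat_subspace_zero: "mat_subspace r c {0\<^sub>m r c}"
  by (auto simp: mat_subspace_def)

lemma mat_dim_zero [simp]: "mat_dim r c {0\<^sub>m r c :: 'k::field mat} = 0"
proof -
  interpret V: vectorspace class_ring "mat_vs r c {0\<^sub>m r c :: 'k mat}"
    by (rule mat_subspace_vectorspace[OF mat_subspace_zero])
  have "V.module.gen_set {\<zero>\<^bsub>mat_vs r c {0\<^sub>m r c :: 'k mat}\<^esub>}"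
    using V.span_zero V.span_empty V.span_mem[of "{0\<^sub>m r c}" "0\<^sub>m r c"]
      V.module.span_is_subset2[of "{0\<^sub>m r c}"] by (auto simp: mat_vs_simps)
  from V.dim0I[OF this] show ?thesis by (simp add: mat_dim_def)
qed

lemma mat_dim_iso:
  fixes S1 S2 :: "'k::field mat set"
  assumes S: "mat_subspace r1 c1 S1" "mat_subspace r2 c2 S2"
    and f: "\<And>A B. A \<in> S1 \<Longrightarrow> B \<in> S1 \<Longrightarrow> f (A + B) = f A + f B"
      "\<And>k A. A \<in> S1 \<Longrightarrow> f (k \<cdot>\<^sub>m A) = k \<cdot>\<^sub>m f A"
    and bij: "bij_betw f S1 S2"
  shows "mat_dim r1 c1 S1 = mat_dim r2 c2 S2"
proof -
  have "mat_dim r2 c2 S2 = mat_dim r1 c1 S1 + mat_dim 0 0 {0\<^sub>m 0 0 :: 'k mat}"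
    by (rule mat_dim_exact[where f = f and g = "\<lambda>_. 0\<^sub>m 0 0", OF S mat_subspace_zero])
      (use f bij S in \<open>auto simp: bij_betw_def mat_subspace_def\<close>)
  thus ?thesis by simp
qed

lemma mat_dim_span_singleton:
  assumes A: "A \<in> carrier_mat r c" "A \<noteq> 0\<^sub>m r c"
  shows "mat_dim r c (range (\<lambda>k. k \<cdot>\<^sub>m A)) = (1 :: nat)"
    and "mat_subspace r c (range (\<lambda>k :: 'k::field. k \<cdot>\<^sub>m A))"
proof -
  let ?S = "range (\<lambda>k. k \<cdot>\<^sub>m A)"
  have "0\<^sub>m r c = 0 \<cdot>\<^sub>m A" using A by auto
  moreover have "a \<cdot>\<^sub>m A + b \<cdot>\<^sub>m A = (a + b) \<cdot>\<^sub>m A" "a \<cdot>\<^sub>m (b \<cdot>\<^sub>m A) = (a * b) \<cdot>\<^sub>m A" for a b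
    using A by (auto simp: add_smult_distrib_right_mat[OF A(1)])
  ultimately show sub: "mat_subspace r c ?S"
    unfolding mat_subspace_def using A by auto
  interpret V: vectorspace class_ring "mat_vs r c ?S" by (rule mat_subspace_vectorspace[OF sub])
  have "1 \<cdot>\<^sub>m A = A" by auto
  hence AS: "A \<in> ?S" by (metis rangeI)
  have "V.module.span {A} = ?S"
    by (subst V.module.finite_span)
      (use A AS in \<open>auto simp: V.module.lincomb_def mat_vs_simps class_ring_simps\<close>)
  moreover have "V.module.lin_indpt {A}"
  proof (rule V.module.finite_lin_indpt2)
    fix a :: "'k mat \<Rightarrow> 'k" assume "V.module.lincomb a {A} = \<zero>\<^bsub>mat_vs r c ?S\<^esub>"
    hence "a A \<cdot>\<^sub>m A = 0\<^sub>m r c"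
      using A AS by (simp add: V.module.lincomb_def mat_vs_simps)
    hence "a A = 0"
      using A by (auto simp: mat_eq_iff)
    thus "\<forall>v\<in>{A}. a v = \<zero>\<^bsub>class_ring\<^esub>" by (simp add: class_ring_simps)
  qed (use AS in \<open>auto simp: mat_vs_simps\<close>)
  ultimately have "V.basis {A}" using AS by (auto simp: V.basis_def mat_vs_simps)
  from V.dim_basis[OF _ this] show "mat_dim r c ?S = 1" by (simp add: mat_dim_def)
qed

text \<open>The columns of \<open>i\<close> are a basis of the kernel of \<open>g\<close>, and
  \<open>L\<close> gives the coordinates in that basis of the projection
  \<open>1 - \<sigma> g\<close> onto the kernel along the image of \<open>\<sigma>\<close>.\<close>

lemma split_kernel:
  fixes g \<sigma> :: "'k::field mat"
  assumes g: "g \<in> carrier_mat p N" and \<sigma>: "\<sigma> \<in> carrier_mat N p" and g\<sigma>: "g * \<sigma> = 1\<^sub>m p"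
  obtains d i L where "i \<in> carrier_mat N d" "L \<in> carrier_mat d N" "g * i = 0\<^sub>m p d"
    "L * i = 1\<^sub>m d" "L * \<sigma> = 0\<^sub>m d p" "\<sigma> * g + i * L = 1\<^sub>m N"
proof -
  interpret K: kernel p N g by unfold_locales (rule g)
  obtain B where B: "finite B" "K.basis B" using kernel_basis_exists[OF g] by auto
  have BK: "B \<subseteq> mat_kernel g" and span: "K.NC.span B = mat_kernel g" and ind: "K.NC.lin_indpt B"
    using B K.span_same[of B] K.lindep_same[of B] unfolding K.Ker.basis_def by auto
  obtain bs where bs: "set bs = B" "distinct bs" using finite_distinct_list[OF B(1)] by auto
  define d where "d = length bs"
  define i where "i = mat_of_cols N bs"
  have bsc: "set bs \<subseteq> carrier_vec N" using BK bs mat_kernel_carrier[OF g] by auto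
  have i: "i \<in> carrier_mat N d" by (simp add: i_def d_def)
  have cols: "cols i = bs" using bsc by (simp add: i_def)
  have inj: "v = 0\<^sub>v d" if "v \<in> carrier_vec d" "i *\<^sub>v v = 0\<^sub>v N" for v
    using K.NC.lin_depI[OF i that(1) _ that(2)] ind bs cols by auto
  have ker: "\<exists>v\<in>carrier_vec d. i *\<^sub>v v = w" if "w \<in> mat_kernel g" for w
  proof -
    have "w \<in> K.NC.span B" using that span by simp
    hence "\<exists>a. w = K.NC.lincomb a B"
      using K.NC.finite_span[OF B(1)] bs(1) bsc by auto
    then obtain a where "w = K.NC.lincomb a B" ..
    also have "\<dots> = i *\<^sub>v vec d (\<lambda>j. a (bs ! j))"
      unfolding bs(1)[symmetric] i_def d_def
      using bsc K.NC.lincomb_as_lincomb_list_distinct[OF bsc bs(2)]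
      by (subst K.NC.lincomb_list_as_mat_mult[symmetric]) auto
    finally show ?thesis by (intro bexI[of _ "vec d (\<lambda>j. a (bs ! j))"]) auto
  qed
  have gi: "g * i = 0\<^sub>m p d"
  proof (rule eq_matI)
    fix r c assume rc: "r < dim_row (0\<^sub>m p d :: 'k mat)" "c < dim_col (0\<^sub>m p d :: 'k mat)"
    have "col i c \<in> mat_kernel g" using BK bs cols rc i by (metis carrier_matD(2) cols_length cols_nth index_zero_mat(3) nth_mem subsetD)
    hence "g *\<^sub>v col i c = 0\<^sub>v p" by (rule mat_kernelD(2)[OF g])
    moreover have "col (g * i) c = g *\<^sub>v col i c" using rc by (intro col_mult2[OF g i]) simp
    ultimately have "col (g * i) c = 0\<^sub>v p" by simp
    thus "(g * i) $$ (r, c) = 0\<^sub>m p d $$ (r, c)" using rc g i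
      by (metis carrier_matD(1,2) index_col index_mult_mat(2,3) index_zero_mat(1,2,3) index_zero_vec(1))
  qed (use g i in auto)
  define E where "E = 1\<^sub>m N - \<sigma> * g"
  have E: "E \<in> carrier_mat N N" using g \<sigma> by (auto simp: E_def)
  have gE: "g * E = 0\<^sub>m p N"
    unfolding E_def using g \<sigma> g\<sigma>
    by (simp add: mat_distrib assoc_mult_mat_dim[symmetric])
  have "\<forall>c<N. \<exists>v\<in>carrier_vec d. i *\<^sub>v v = col E c"
  proof (intro allI impI ker mat_kernelI[OF g])
    fix c assume c: "c < N"
    show "col E c \<in> carrier_vec N" using E by (auto simp: col_def)
    have "g *\<^sub>v col E c = col (g * E) c" using c by (rule col_mult2[OF g E, symmetric])
    thus "g *\<^sub>v col E c = 0\<^sub>v p" using gE c by simp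
  qed
  then obtain v where v: "\<And>c. c < N \<Longrightarrow> v c \<in> carrier_vec d" "\<And>c. c < N \<Longrightarrow> i *\<^sub>v v c = col E c"
    by metis
  define L where "L = mat_of_cols d (map v [0..<N])"
  have L: "L \<in> carrier_mat d N"
    using mat_of_cols_carrier(1)[of d "map v [0..<N]"] by (simp add: L_def)
  have iL: "i * L = E"
  proof (rule mat_col_eqI)
    fix c assume "c < dim_col E"
    hence c: "c < N" using E by simp
    have "col L c = v c" using c v by (simp add: L_def)
    thus "col (i * L) c = col E c" using c v by (simp add: col_mult2[OF i L])
  qed (use i L E in auto)
  \<comment> \<open>As \<open>i\<close> is injective on vectors, the identities for \<open>L\<close>
    may be checked after multiplication by \<open>i\<close>, where \<open>i L\<close> is the known
    projection \<open>E\<close>.\<close>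
  have zero: "A = 0\<^sub>m d m" if A: "A \<in> carrier_mat d m" "i * A = 0\<^sub>m N m" for A m
  proof (rule mat_col_eqI)
    fix c assume "c < dim_col (0\<^sub>m d m :: 'k mat)"
    hence c: "c < m" by simp
    have "i *\<^sub>v col A c = col (i * A) c" using c by (rule col_mult2[OF i A(1), symmetric])
    hence "col A c = 0\<^sub>v d" using A c by (intro inj) auto
    thus "col A c = col (0\<^sub>m d m) c" using c by simp
  qed (use A in auto)
  have Li: "L * i - 1\<^sub>m d = 0\<^sub>m d d"
  proof (rule zero)
    have "i * (L * i - 1\<^sub>m d) = E * i - i"
      using i L by (simp add: mat_distrib assoc_mult_mat_dim[symmetric] iL)
    also have "E * i = i"
      unfolding E_def using g \<sigma> i gi by (simp add: mat_distrib assoc_mult_mat_dim)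
    finally show "i * (L * i - 1\<^sub>m d) = 0\<^sub>m N d" using i by auto
  qed (use i L in auto)
  have "L * i = 1\<^sub>m d"
  proof (rule eq_matI)
    fix r c assume "r < dim_row (1\<^sub>m d :: 'k mat)" "c < dim_col (1\<^sub>m d :: 'k mat)"
    thus "(L * i) $$ (r, c) = 1\<^sub>m d $$ (r, c)"
      using arg_cong[OF Li, of "\<lambda>A. A $$ (r,c)"] i L by auto
  qed (use i L in auto)
  moreover have "L * \<sigma> = 0\<^sub>m d p"
  proof (rule zero)
    have "i * (L * \<sigma>) = E * \<sigma>" using i L \<sigma> iL by (simp add: assoc_mult_mat_dim[symmetric])
    also have "\<dots> = 0\<^sub>m N p"
      unfolding E_def using g \<sigma> g\<sigma> by (simp add: mat_distrib assoc_mult_mat_dim)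
    finally show "i * (L * \<sigma>) = 0\<^sub>m N p" .
  qed (use L \<sigma> in auto)
  moreover have "\<sigma> * g + i * L = 1\<^sub>m N"
    unfolding iL E_def using g \<sigma> by (intro eq_matI) auto
  ultimately show ?thesis using that i L gi by blast
qed

section \<open>Homomorphisms, biproducts and exact sequences\<close>

text \<open>What is left of \<open>is_module\<close> when the relations are dropped. Homomorphisms,
  biproducts and tensor products are handled at this level, so that they are available before the
  relations have been verified.\<close>

definition mod_shape :: "'k::field hmod \<Rightarrow> bool" where
  "mod_shape M \<longleftrightarrow> (\<forall>x. action M x \<in> carrier_mat (mdim M) (mdim M))"

lemma mod_shape_dim [simp]:
  assumes "mod_shape M"
  shows "dim_row (action M x) = mdim M" "dim_col (action M x) = mdim M"
  using assms unfolding mod_shape_def by (meson carrier_matD)+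

lemma mod_shape_carrier [simp]: "mod_shape M \<Longrightarrow> action M x \<in> carrier_mat (mdim M) (mdim M)"
  by (simp add: mod_shape_def)

lemma is_module_shape: "is_module n q M \<Longrightarrow> mod_shape M"
  by (simp add: is_module_def mod_shape_def)

text \<open>Makes an identity \<open>A * B = C\<close> applicable inside products nested to the
  right, the normal form used throughout.\<close>

lemma mult_rewrite:
  fixes A B C Z :: "'a :: semiring_0 mat"
  assumes "A * B = C" "dim_col A = dim_row B" "dim_col B = dim_row Z"
  shows "A * (B * Z) = C * Z"
  using assms assoc_mult_mat_dim by metis

lemma homD:
  assumes "f \<in> module_hom M N"
  shows "f \<in> carrier_mat (mdim N) (mdim M)" "dim_row f = mdim N" "dim_col f = mdim M"
    "f * action M x = action N x * f"
  using assms by (auto simp: module_hom_def)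

lemma homI:
  assumes "dim_row f = mdim N" "dim_col f = mdim M" "\<And>x. f * action M x = action N x * f"
  shows "f \<in> module_hom M N"
  using assms by (auto simp: module_hom_def)

lemma hom_id: "mod_shape M \<Longrightarrow> 1\<^sub>m (mdim M) \<in> module_hom M M"
  by (rule homI) auto

lemma hom_zero:
  "mod_shape M \<Longrightarrow> mod_shape N \<Longrightarrow> 0\<^sub>m (mdim N) (mdim M) \<in> module_hom M N"
  by (rule homI) auto

lemma hom_comp:
  assumes "g \<in> module_hom N L" "f \<in> module_hom M N" "mod_shape M" "mod_shape N" "mod_shape L"
  shows "g * f \<in> module_hom M L"
proof (rule homI)
  fix x
  note d = homD(2,3)[OF assms(1)] homD(2,3)[OF assms(2)]
  have "g * f * action M x = g * (action N x * f)"
    using d assms by (simp add: assoc_mult_mat_dim homD(4)[OF assms(2)])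
  also have "\<dots> = action L x * g * f"
    using d assms by (simp add: assoc_mult_mat_dim[symmetric] homD(4)[OF assms(1)])
  finally show "g * f * action M x = action L x * (g * f)"
    using d assms by (simp add: assoc_mult_mat_dim)
qed (use assms in \<open>auto dest: homD(2,3)\<close>)

lemma hom_add:
  assumes "f \<in> module_hom M N" "g \<in> module_hom M N" "mod_shape M" "mod_shape N"
  shows "f + g \<in> module_hom M N"
  using assms homD[OF assms(1)] homD[OF assms(2)] by (intro homI) (auto simp: mat_distrib)

lemma hom_smult:
  assumes "f \<in> module_hom M N" "mod_shape M" "mod_shape N"
  shows "k \<cdot>\<^sub>m f \<in> module_hom M N"
  using assms homD[OF assms(1)] by (intro homI) (auto simp: mat_distrib)

text \<open>The left inverse \<open>L\<close> is merely linear; it cancels \<open>i\<close> from the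
  intertwining equation of \<open>i * k\<close>.\<close>

lemma hom_cancel_mono:
  assumes i: "i \<in> module_hom A X" and k: "k \<in> carrier_mat (mdim A) (mdim Q)"
    and ik: "i * k \<in> module_hom Q X" and L: "L \<in> carrier_mat (mdim A) (mdim X)" "L * i = 1\<^sub>m (mdim A)"
    and sh: "mod_shape A" "mod_shape X" "mod_shape Q"
  shows "k \<in> module_hom Q A"
proof (rule homI)
  fix x
  note d = homD(2,3)[OF i] carrier_matD[OF k]
  have "i * (k * action Q x) = action X x * i * k"
    using homD(4)[OF ik, of x] d sh by (simp add: assoc_mult_mat_dim)
  also have "\<dots> = i * (action A x * k)"
    using d sh by (simp add: homD(4)[OF i, symmetric] assoc_mult_mat_dim)
  finally show "k * action Q x = action A x * k"
    using mat_cancel_left[of L i "k * action Q x" "action A x * k"] L d sh by simp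
qed (use k in auto)

lemma hom_cancel_epi:
  assumes p: "p \<in> module_hom X C" and k: "k \<in> carrier_mat (mdim Q) (mdim C)"
    and kp: "k * p \<in> module_hom X Q" and R: "R \<in> carrier_mat (mdim X) (mdim C)" "p * R = 1\<^sub>m (mdim C)"
    and sh: "mod_shape C" "mod_shape X" "mod_shape Q"
  shows "k \<in> module_hom C Q"
proof (rule homI)
  fix x
  note d = homD(2,3)[OF p] carrier_matD[OF k]
  have "k * action C x * p = k * p * action X x"
    using d sh by (simp add: homD(4)[OF p, symmetric] assoc_mult_mat_dim)
  also have "\<dots> = action Q x * k * p"
    using homD(4)[OF kp, of x] d sh by (simp add: assoc_mult_mat_dim)
  finally show "k * action C x = action Q x * k"
    using mat_cancel_right[of p R "k * action C x" "action Q x * k"] R d sh by simp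
qed (use k in auto)

text \<open>A direct sum decomposition expressed as a property of \<open>X\<close>. Tensoring and
  counting homomorphisms then act on the four structure maps, with no detour through a
  block-diagonal model.\<close>

definition is_biprod :: "'k::field hmod \<Rightarrow> 'k hmod \<Rightarrow> 'k hmod \<Rightarrow> bool" where
  "is_biprod A B X \<longleftrightarrow> mod_shape A \<and> mod_shape B \<and> mod_shape X \<and>
     (\<exists>i\<in>module_hom A X. \<exists>j\<in>module_hom B X. \<exists>p\<in>module_hom X A. \<exists>r\<in>module_hom X B.
       p * i = 1\<^sub>m (mdim A) \<and> r * j = 1\<^sub>m (mdim B) \<and> p * j = 0\<^sub>m (mdim A) (mdim B) \<and>
       r * i = 0\<^sub>m (mdim B) (mdim A) \<and> i * p + j * r = 1\<^sub>m (mdim X))"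

lemma is_biprodE:
  assumes "is_biprod A B X"
  obtains i j p r where "i \<in> module_hom A X" "j \<in> module_hom B X"
    "p \<in> module_hom X A" "r \<in> module_hom X B" "p * i = 1\<^sub>m (mdim A)" "r * j = 1\<^sub>m (mdim B)"
    "p * j = 0\<^sub>m (mdim A) (mdim B)" "r * i = 0\<^sub>m (mdim B) (mdim A)"
    "i * p + j * r = 1\<^sub>m (mdim X)" "mod_shape A" "mod_shape B" "mod_shape X"
  using assms unfolding is_biprod_def by blast

lemma is_biprodI:
  assumes "mod_shape A" "mod_shape B" "mod_shape X" "i \<in> module_hom A X" "j \<in> module_hom B X"
    "p \<in> module_hom X A" "r \<in> module_hom X B" "p * i = 1\<^sub>m (mdim A)" "r * j = 1\<^sub>m (mdim B)"
    "p * j = 0\<^sub>m (mdim A) (mdim B)" "r * i = 0\<^sub>m (mdim B) (mdim A)"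
    "i * p + j * r = 1\<^sub>m (mdim X)"
  shows "is_biprod A B X"
  using assms unfolding is_biprod_def by blast

lemma is_biprod_comm: "is_biprod A B X \<Longrightarrow> is_biprod B A X"
  by (elim is_biprodE, rule is_biprodI)
    (assumption | subst comm_add_mat[of _ "mdim X" "mdim X"]; auto simp: homD)+

lemma module_isoE:
  assumes "M \<cong>\<^sub>H N"
  obtains f g where "f \<in> module_hom M N" "g \<in> module_hom N M"
    "g * f = 1\<^sub>m (mdim M)" "f * g = 1\<^sub>m (mdim N)"
  using assms unfolding module_iso_def by blast

lemma module_iso_refl: "mod_shape M \<Longrightarrow> M \<cong>\<^sub>H M"
  unfolding module_iso_def by (intro bexI[of _ "1\<^sub>m (mdim M)"] hom_id) auto

lemma is_biprod_unique:
  assumes "is_biprod A B X" "is_biprod A' B' Y" "A \<cong>\<^sub>H A'" "B \<cong>\<^sub>H B'"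
  shows "X \<cong>\<^sub>H Y"
proof -
  obtain i j p r where X: "i \<in> module_hom A X" "j \<in> module_hom B X"
    "p \<in> module_hom X A" "r \<in> module_hom X B" "p * i = 1\<^sub>m (mdim A)" "r * j = 1\<^sub>m (mdim B)"
    "p * j = 0\<^sub>m (mdim A) (mdim B)" "r * i = 0\<^sub>m (mdim B) (mdim A)"
    "i * p + j * r = 1\<^sub>m (mdim X)" and shX: "mod_shape A" "mod_shape B" "mod_shape X"
    using assms(1) by (rule is_biprodE)
  obtain i' j' p' r' where Y: "i' \<in> module_hom A' Y" "j' \<in> module_hom B' Y"
    "p' \<in> module_hom Y A'" "r' \<in> module_hom Y B'" "p' * i' = 1\<^sub>m (mdim A')" "r' * j' = 1\<^sub>m (mdim B')"
    "p' * j' = 0\<^sub>m (mdim A') (mdim B')" "r' * i' = 0\<^sub>m (mdim B') (mdim A')"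
    "i' * p' + j' * r' = 1\<^sub>m (mdim Y)" and shY: "mod_shape A'" "mod_shape B'" "mod_shape Y"
    using assms(2) by (rule is_biprodE)
  obtain f g where fg: "f \<in> module_hom A A'" "g \<in> module_hom A' A"
    "g * f = 1\<^sub>m (mdim A)" "f * g = 1\<^sub>m (mdim A')" using assms(3) by (rule module_isoE)
  obtain h k where hk: "h \<in> module_hom B B'" "k \<in> module_hom B' B"
    "k * h = 1\<^sub>m (mdim B)" "h * k = 1\<^sub>m (mdim B')" using assms(4) by (rule module_isoE)
  note d = X(1-4)[THEN homD(2)] X(1-4)[THEN homD(3)] Y(1-4)[THEN homD(2)] Y(1-4)[THEN homD(3)]
    fg(1,2)[THEN homD(2)] fg(1,2)[THEN homD(3)] hk(1,2)[THEN homD(2)] hk(1,2)[THEN homD(3)]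
  note e = X(5-8) Y(5-8) fg(3,4) hk(3,4)
  note rew = e[THEN mult_rewrite]
  let ?T = "i' * (f * p) + j' * (h * r)" and ?S = "i * (g * p') + j * (k * r')"
  show ?thesis unfolding module_iso_def
  proof (intro bexI conjI)
    show "?T \<in> module_hom X Y" "?S \<in> module_hom Y X"
      by (rule hom_add hom_comp X(1-4) Y(1-4) fg(1,2) hk(1,2) shX shY)+
    show "?S * ?T = 1\<^sub>m (mdim X)"
      using d e X(9) by (simp add: mat_distrib assoc_mult_mat_dim rew)
    show "?T * ?S = 1\<^sub>m (mdim Y)"
      using d e Y(9) by (simp add: mat_distrib assoc_mult_mat_dim rew)
  qed
qed

lemma hom_word2:
  assumes p: "p \<in> module_hom X A" and sh: "mod_shape X" "mod_shape A"
  shows "p * (action X x * action X y) = action A x * action A y * p"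
  using homD[OF p] sh
  by (metis assoc_mult_mat_dim mod_shape_dim)

lemma hom_pow:
  assumes p: "p \<in> module_hom X A" and sh: "mod_shape X" "mod_shape A"
  shows "p * action X x ^\<^sub>m k = action A x ^\<^sub>m k * p"
proof (induction k)
  case 0
  thus ?case using homD[OF p] sh by simp
next
  case (Suc k)
  have "p * action X x ^\<^sub>m Suc k = (p * action X x ^\<^sub>m k) * action X x"
    using homD[OF p] sh by (simp add: assoc_mult_mat_dim pow_mat_dim)
  also have "\<dots> = action A x ^\<^sub>m k * (p * action X x)"
    unfolding Suc using homD[OF p] sh by (simp add: assoc_mult_mat_dim pow_mat_dim)
  finally show ?case using homD[OF p] sh by (simp add: assoc_mult_mat_dim pow_mat_dim)
qed

text \<open>A homomorphism \<open>p\<close> into a genuine module transports words in the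
  generators, so each defining relation holds on \<open>X\<close> after composition with
  \<open>p\<close>, although \<open>X\<close> is only known to have the right shape.\<close>

lemma hom_relation:
  assumes p: "p \<in> module_hom X A" and sh: "mod_shape X" and A: "is_module n q A"
  shows "p * (action X Gen_b * action X Gen_a) = p * (q \<cdot>\<^sub>m (action X Gen_a * action X Gen_b))"
    "p * (action X Gen_d * action X Gen_b) = p * (q \<cdot>\<^sub>m (action X Gen_b * action X Gen_d))"
    "p * (action X Gen_c * action X Gen_a) = p * (q \<cdot>\<^sub>m (action X Gen_a * action X Gen_c))"
    "p * (action X Gen_d * action X Gen_c) = p * (q \<cdot>\<^sub>m (action X Gen_c * action X Gen_d))"
    "p * (action X Gen_b * action X Gen_c) = p * (action X Gen_c * action X Gen_b)"
    "p * action X Gen_a ^\<^sub>m n = p * 0\<^sub>m (mdim X) (mdim X)"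
    "p * action X Gen_b ^\<^sub>m n = p * 1\<^sub>m (mdim X)"
    "p * action X Gen_c ^\<^sub>m n = p * 1\<^sub>m (mdim X)"
    "p * action X Gen_d ^\<^sub>m n = p * 0\<^sub>m (mdim X) (mdim X)"
    "p * (action X Gen_d * action X Gen_a - q \<cdot>\<^sub>m (action X Gen_a * action X Gen_d)) =
       p * (1\<^sub>m (mdim X) - action X Gen_b * action X Gen_c)"
proof -
  note sA = is_module_shape[OF A] and d = homD(2,3)[OF p]
  note w = hom_word2[OF p sh sA] and pw = hom_pow[OF p sh sA]
  note R = A[unfolded is_module_def Let_def, THEN conjunct2]
  show "p * (action X Gen_b * action X Gen_a) = p * (q \<cdot>\<^sub>m (action X Gen_a * action X Gen_b))"
    "p * (action X Gen_d * action X Gen_b) = p * (q \<cdot>\<^sub>m (action X Gen_b * action X Gen_d))"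
    "p * (action X Gen_c * action X Gen_a) = p * (q \<cdot>\<^sub>m (action X Gen_a * action X Gen_c))"
    "p * (action X Gen_d * action X Gen_c) = p * (q \<cdot>\<^sub>m (action X Gen_c * action X Gen_d))"
    using R d sh sA by (simp_all add: w mat_distrib)
  show "p * (action X Gen_b * action X Gen_c) = p * (action X Gen_c * action X Gen_b)"
    using R by (simp add: w)
  show "p * action X Gen_a ^\<^sub>m n = p * 0\<^sub>m (mdim X) (mdim X)"
    "p * action X Gen_b ^\<^sub>m n = p * 1\<^sub>m (mdim X)"
    "p * action X Gen_c ^\<^sub>m n = p * 1\<^sub>m (mdim X)"
    "p * action X Gen_d ^\<^sub>m n = p * 0\<^sub>m (mdim X) (mdim X)"
    using R d by (simp_all add: pw)
  have "(action A Gen_d * action A Gen_a - q \<cdot>\<^sub>m (action A Gen_a * action A Gen_d)) * p =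
       (1\<^sub>m (mdim A) - action A Gen_b * action A Gen_c) * p"
    using R by simp
  thus "p * (action X Gen_d * action X Gen_a - q \<cdot>\<^sub>m (action X Gen_a * action X Gen_d)) =
       p * (1\<^sub>m (mdim X) - action X Gen_b * action X Gen_c)"
    using d sh sA by (simp add: w mat_distrib)
qed

text \<open>A matrix is recovered from its composites with \<open>p\<close> and \<open>r\<close> by
  means of \<open>i * p + j * r = 1\<close>; hence relations that hold after \<open>p\<close> and
  after \<open>r\<close> hold on \<open>X\<close>. Both submodules and direct sums of modules are
  instances.\<close>

lemma is_module_jointly_monic:
  assumes sh: "mod_shape X"
    and p: "p \<in> module_hom X A" "is_module n q A" and r: "r \<in> module_hom X B" "is_module n q B"
    and i: "dim_row i = mdim X" "dim_col i = mdim A" and j: "dim_row j = mdim X" "dim_col j = mdim B"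
    and one: "i * p + j * r = 1\<^sub>m (mdim X)"
  shows "is_module n q X"
proof -
  note d = homD(2,3)[OF p(1)] homD(2,3)[OF r(1)]
  have eq: "U = V" if "p * U = p * V" "r * U = r * V" and U: "dim_row U = mdim X" "dim_row V = mdim X"
    for U V
  proof -
    have "U = (i * p + j * r) * U" using U one by simp
    also have "\<dots> = i * (p * U) + j * (r * U)"
      using d i j U by (simp add: mat_distrib assoc_mult_mat_dim)
    also have "\<dots> = i * (p * V) + j * (r * V)" using that by simp
    also have "\<dots> = (i * p + j * r) * V"
      using d i j U by (simp add: mat_distrib assoc_mult_mat_dim)
    finally show ?thesis using U one by simp
  qed
  note rel = hom_relation[OF p(1) sh p(2)] hom_relation[OF r(1) sh r(2)]
  show ?thesis
    unfolding is_module_def Let_def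
    by (intro conjI allI mod_shape_carrier[OF sh]; rule eq; (rule rel | simp add: sh pow_mat_dim))
qed

lemma is_module_summand:
  assumes "is_biprod A B X" "is_module n q X"
  shows "is_module n q A"
  using assms(1)
proof (rule is_biprodE)
  fix i j p r
  assume h: "i \<in> module_hom A X" "j \<in> module_hom B X" "p \<in> module_hom X A" "r \<in> module_hom X B"
    "p * i = 1\<^sub>m (mdim A)" "mod_shape A" "mod_shape X"
  \<comment> \<open>The inclusion \<open>i\<close> of the summand takes both places of the jointly
    monic pair, recovered by \<open>p\<close> for the first copy and by zero for the second.\<close>
  show ?thesis
    by (rule is_module_jointly_monic[OF h(6) h(1) assms(2) h(1) assms(2), of p "0\<^sub>m (mdim A) (mdim X)"])
      (use h homD[OF h(1)] homD[OF h(3)] in auto)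
qed

lemma is_module_biprod:
  assumes "is_biprod A B X" "is_module n q A" "is_module n q B"
  shows "is_module n q X"
  using assms(1)
  by (rule is_biprodE) (rule is_module_jointly_monic; (assumption | rule assms | simp add: homD))

section \<open>Projective modules\<close>

lemma surjective_homI:
  assumes "p \<in> module_hom X C" "R \<in> carrier_mat (mdim X) (mdim C)" "p * R = 1\<^sub>m (mdim C)"
  shows "surjective_hom X C p"
proof -
  have p: "p \<in> carrier_mat (mdim C) (mdim X)" by (rule homD[OF assms(1)])
  have "\<exists>u\<in>carrier_vec (mdim X). p *\<^sub>v u = v" if "v \<in> carrier_vec (mdim C)" for v
  proof (intro bexI)
    show "p *\<^sub>v (R *\<^sub>v v) = v"
      using assoc_mult_mat_vec[OF p assms(2) that] assms(3) that by simp
  qed (use assms(2) that in auto)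
  thus ?thesis using assms(1) p unfolding surjective_hom_def by fastforce
qed

text \<open>Preimages of the unit vectors form the columns of a linear right inverse; in this matrix
  form surjectivity is used from here on.\<close>

lemma surjective_homE:
  assumes "surjective_hom X C p"
  obtains R where "p \<in> module_hom X C" "R \<in> carrier_mat (mdim X) (mdim C)" "p * R = 1\<^sub>m (mdim C)"
proof -
  have ph: "p \<in> module_hom X C" using assms by (simp add: surjective_hom_def)
  have p: "p \<in> carrier_mat (mdim C) (mdim X)" by (rule homD[OF ph])
  have "\<forall>c. \<exists>u\<in>carrier_vec (mdim X). p *\<^sub>v u = unit_vec (mdim C) c"
    using assms unfolding surjective_hom_def by (metis imageE unit_vec_carrier)
  then obtain u where u: "\<And>c. u c \<in> carrier_vec (mdim X)" "\<And>c. p *\<^sub>v u c = unit_vec (mdim C) c"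
    by metis
  define R where "R = mat_of_cols (mdim X) (map u [0..<mdim C])"
  have R: "R \<in> carrier_mat (mdim X) (mdim C)"
    using mat_of_cols_carrier(1)[of "mdim X" "map u [0..<mdim C]"] by (simp add: R_def)
  have "p * R = 1\<^sub>m (mdim C)"
  proof (rule mat_col_eqI)
    fix c assume "c < dim_col (1\<^sub>m (mdim C) :: 'a mat)"
    hence c: "c < mdim C" by simp
    have "col R c = u c" using c u by (simp add: R_def)
    thus "col (p * R) c = col (1\<^sub>m (mdim C)) c" using c u by (simp add: col_mult2[OF p R])
  qed (use p R in auto)
  thus ?thesis using that ph R by blast
qed

lemma projective_module: "projective n q P \<Longrightarrow> is_module n q P"
  by (simp add: projective_def)

lemma projective_shape: "projective n q P \<Longrightarrow> mod_shape P"
  by (rule is_module_shape[OF projective_module])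

lemma projective_lift:
  assumes "projective n q P" "is_module n q X" "is_module n q C" "p \<in> module_hom X C"
    "R \<in> carrier_mat (mdim X) (mdim C)" "p * R = 1\<^sub>m (mdim C)" "f \<in> module_hom P C"
  obtains h where "h \<in> module_hom P X" "p * h = f"
  using assms surjective_homI[OF assms(4-6)] unfolding projective_def by metis

lemma projectiveI:
  assumes "is_module n q P"
    and "\<And>X C p R f. is_module n q X \<Longrightarrow> is_module n q C \<Longrightarrow> p \<in> module_hom X C \<Longrightarrow>
      R \<in> carrier_mat (mdim X) (mdim C) \<Longrightarrow> p * R = 1\<^sub>m (mdim C) \<Longrightarrow> f \<in> module_hom P C \<Longrightarrow>
      \<exists>h\<in>module_hom P X. p * h = f"
  shows "projective n q P"
  unfolding projective_def
proof (intro conjI allI impI)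
  fix X C g f
  assume *: "is_module n q X \<and> is_module n q C \<and> surjective_hom X C g \<and> f \<in> module_hom P C"
  hence "surjective_hom X C g" by simp
  then obtain R where "g \<in> module_hom X C" "R \<in> carrier_mat (mdim X) (mdim C)" "g * R = 1\<^sub>m (mdim C)"
    by (rule surjective_homE)
  thus "\<exists>h\<in>module_hom P X. g * h = f" using assms(2) * by blast
qed (rule assms(1))

lemma projective_summand:
  assumes AX: "is_biprod A B X" and X: "projective n q X"
  shows "projective n q A"
proof (rule projectiveI)
  show "is_module n q A" by (rule is_module_summand[OF AX projective_module[OF X]])
  fix Y C g R f
  assume g: "is_module n q Y" "is_module n q C" "g \<in> module_hom Y C"
    "R \<in> carrier_mat (mdim Y) (mdim C)" "g * R = 1\<^sub>m (mdim C)" and f: "f \<in> module_hom A C"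
  from AX show "\<exists>h\<in>module_hom A Y. g * h = f"
  proof (rule is_biprodE)
    fix i j p r
    assume h: "i \<in> module_hom A X" "p \<in> module_hom X A" "p * i = 1\<^sub>m (mdim A)"
      "mod_shape A" "mod_shape X"
    note sh = h(4,5) is_module_shape[OF g(1)] is_module_shape[OF g(2)]
    have "f * p \<in> module_hom X C" using f h sh by (intro hom_comp)
    then obtain k where k: "k \<in> module_hom X Y" "g * k = f * p"
      using projective_lift[OF X g] by blast
    show ?thesis
    proof (intro bexI)
      show "g * (k * i) = f"
        using mult_rewrite[OF k(2), of i] homD(2,3)[OF g(3)] homD(2,3)[OF k(1)] homD(2,3)[OF h(1)]
          homD(2,3)[OF h(2)] homD(2,3)[OF f] h(3) by (simp add: assoc_mult_mat_dim)
    qed (use k h sh in \<open>auto intro!: hom_comp\<close>)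
  qed
qed

lemma projective_biprod:
  assumes AX: "is_biprod A B X" and A: "projective n q A" and B: "projective n q B"
  shows "projective n q X"
proof (rule projectiveI)
  show "is_module n q X" using is_module_biprod[OF AX] A B by (simp add: projective_module)
  fix Y C g R f
  assume g: "is_module n q Y" "is_module n q C" "g \<in> module_hom Y C"
    "R \<in> carrier_mat (mdim Y) (mdim C)" "g * R = 1\<^sub>m (mdim C)" and f: "f \<in> module_hom X C"
  from AX show "\<exists>h\<in>module_hom X Y. g * h = f"
  proof (rule is_biprodE)
    fix i j p r
    assume h: "i \<in> module_hom A X" "j \<in> module_hom B X" "p \<in> module_hom X A" "r \<in> module_hom X B"
      "i * p + j * r = 1\<^sub>m (mdim X)" "mod_shape A" "mod_shape B" "mod_shape X"
    note sh = h(6-8) is_module_shape[OF g(1)] is_module_shape[OF g(2)]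
    have "f * i \<in> module_hom A C" "f * j \<in> module_hom B C" using f h sh by (auto intro!: hom_comp)
    then obtain k l where k: "k \<in> module_hom A Y" "g * k = f * i"
      and l: "l \<in> module_hom B Y" "g * l = f * j"
      using projective_lift[OF A g] projective_lift[OF B g] by metis
    note d = h(1-4)[THEN homD(2)] h(1-4)[THEN homD(3)] homD(2,3)[OF g(3)] homD(2,3)[OF k(1)]
      homD(2,3)[OF l(1)] homD(2,3)[OF f]
    show ?thesis
    proof (intro bexI)
      have "g * (k * p + l * r) = f * (i * p + j * r)"
        using d by (simp add: mat_distrib mult_rewrite[OF k(2)] mult_rewrite[OF l(2)] assoc_mult_mat_dim)
      thus "g * (k * p + l * r) = f" using h(5) d by simp
    qed (use k l h sh in \<open>auto intro!: hom_comp hom_add\<close>)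
  qed
qed

definition hom_dim :: "'k::field hmod \<Rightarrow> 'k hmod \<Rightarrow> nat" where
  "hom_dim M N = mat_dim (mdim N) (mdim M) (module_hom M N)"

lemma mat_subspace_hom:
  "mod_shape M \<Longrightarrow> mod_shape N \<Longrightarrow> mat_subspace (mdim N) (mdim M) (module_hom M N)"
  unfolding mat_subspace_def by (auto intro: homD hom_zero hom_add hom_smult)

lemma hom_dim_biprod:
  assumes "is_biprod A B X" "mod_shape Y"
  shows "hom_dim X Y = hom_dim A Y + hom_dim B Y"
  using assms(1)
proof (rule is_biprodE)
  fix i j p r
  assume h: "i \<in> module_hom A X" "j \<in> module_hom B X" "p \<in> module_hom X A" "r \<in> module_hom X B"
    "p * i = 1\<^sub>m (mdim A)" "r * j = 1\<^sub>m (mdim B)"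
    "p * j = 0\<^sub>m (mdim A) (mdim B)" "r * i = 0\<^sub>m (mdim B) (mdim A)"
    "i * p + j * r = 1\<^sub>m (mdim X)" and sh: "mod_shape A" "mod_shape B" "mod_shape X"
  note d = h(1-4)[THEN homD(2)] h(1-4)[THEN homD(3)]
  have "mat_dim (mdim Y) (mdim X) (module_hom X Y) = mat_dim (mdim Y) (mdim A) (module_hom A Y)
     + mat_dim (mdim Y) (mdim B) (module_hom B Y)"
  proof (rule mat_dim_exact[where f = "\<lambda>k. k * p" and g = "\<lambda>k. k * j"])
    show "(\<lambda>k. k * p) \<in> module_hom A Y \<rightarrow> module_hom X Y"
      using h sh assms(2) by (auto intro: hom_comp)
    show "inj_on (\<lambda>k. k * p) (module_hom A Y)"
      by (rule inj_on_inverseI[of _ "\<lambda>k. k * i"])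
        (use h d homD in \<open>auto simp: assoc_mult_mat_dim dest: homD\<close>)
    show "(\<lambda>k. k * j) ` module_hom X Y = module_hom B Y"
    proof (intro equalityI image_subsetI subsetI)
      fix k assume k: "k \<in> module_hom B Y"
      have "k = k * r * j" using homD(3)[OF k] d h(6) by (simp add: assoc_mult_mat_dim)
      moreover have "k * r \<in> module_hom X Y" using k h sh assms(2) by (intro hom_comp)
      ultimately show "k \<in> (\<lambda>k. k * j) ` module_hom X Y" by blast
    qed (use h sh assms(2) in \<open>auto intro: hom_comp\<close>)
    fix k assume k: "k \<in> module_hom X Y"
    show "k * j = 0\<^sub>m (mdim Y) (mdim B) \<longleftrightarrow> k \<in> (\<lambda>k. k * p) ` module_hom A Y"
    proof
      assume *: "k * j = 0\<^sub>m (mdim Y) (mdim B)"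
      have "k = k * (i * p + j * r)" using h(9) homD(3)[OF k] by simp
      also have "\<dots> = k * i * p"
        using d homD(2,3)[OF k] by (simp add: mat_distrib mult_rewrite[OF *] assoc_mult_mat_dim)
      finally have "k = k * i * p" .
      moreover have "k * i \<in> module_hom A Y" using k h sh assms(2) by (intro hom_comp)
      ultimately show "k \<in> (\<lambda>k. k * p) ` module_hom A Y" by blast
    qed (use d h(7) in \<open>auto simp: assoc_mult_mat_dim homD\<close>)
  qed (use sh assms(2) d in \<open>auto intro!: mat_subspace_hom simp: mat_distrib homD(2,3)\<close>)
  thus ?thesis by (simp add: hom_dim_def)
qed

lemma hom_dim_iso:
  assumes "M \<cong>\<^sub>H N" "mod_shape M" "mod_shape N" "mod_shape Y"
  shows "hom_dim M Y = hom_dim N Y"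
proof -
  obtain f g where fg: "f \<in> module_hom M N" "g \<in> module_hom N M"
    "g * f = 1\<^sub>m (mdim M)" "f * g = 1\<^sub>m (mdim N)" using assms(1) by (rule module_isoE)
  note d = homD(2,3)[OF fg(1)] homD(2,3)[OF fg(2)]
  show ?thesis unfolding hom_dim_def
  proof (rule mat_dim_iso[where f = "\<lambda>k. k * g"])
    show "bij_betw (\<lambda>k. k * g) (module_hom M Y) (module_hom N Y)"
      by (rule bij_betw_byWitness[where f' = "\<lambda>k. k * f"])
        (use assms fg d in \<open>auto simp: assoc_mult_mat_dim homD(2,3) intro: hom_comp\<close>)
  qed (use assms d in \<open>auto intro!: mat_subspace_hom simp: mat_distrib homD(2,3)\<close>)
qed

section \<open>Exact sequences with a linear splitting\<close>

text \<open>\<open>i\<close> and \<open>p\<close> are module maps while \<open>L\<close> and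
  \<open>R\<close> are only linear. Recording the linear splitting turns exactness into matrix
  identities, which survive the Kronecker product with an identity matrix.\<close>

definition split_exact :: "'k::field hmod \<Rightarrow> 'k hmod \<Rightarrow> 'k hmod \<Rightarrow> bool" where
  "split_exact A X C \<longleftrightarrow> mod_shape A \<and> mod_shape X \<and> mod_shape C \<and>
    (\<exists>i\<in>module_hom A X. \<exists>p\<in>module_hom X C.
      \<exists>L\<in>carrier_mat (mdim A) (mdim X). \<exists>R\<in>carrier_mat (mdim X) (mdim C).
        p * i = 0\<^sub>m (mdim C) (mdim A) \<and> L * i = 1\<^sub>m (mdim A) \<and> p * R = 1\<^sub>m (mdim C) \<and>
        i * L + R * p = 1\<^sub>m (mdim X))"

lemma split_exactE:
  assumes "split_exact A X C"
  obtains i p L R where "i \<in> module_hom A X" "p \<in> module_hom X C" "L \<in> carrier_mat (mdim A) (mdim X)"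
    "R \<in> carrier_mat (mdim X) (mdim C)" "p * i = 0\<^sub>m (mdim C) (mdim A)" "L * i = 1\<^sub>m (mdim A)"
    "p * R = 1\<^sub>m (mdim C)" "i * L + R * p = 1\<^sub>m (mdim X)" "mod_shape A" "mod_shape X" "mod_shape C"
  using assms unfolding split_exact_def by blast

lemma split_exactI:
  assumes "mod_shape A" "mod_shape X" "mod_shape C" "i \<in> module_hom A X" "p \<in> module_hom X C"
    "L \<in> carrier_mat (mdim A) (mdim X)" "R \<in> carrier_mat (mdim X) (mdim C)"
    "p * i = 0\<^sub>m (mdim C) (mdim A)" "L * i = 1\<^sub>m (mdim A)" "p * R = 1\<^sub>m (mdim C)"
    "i * L + R * p = 1\<^sub>m (mdim X)"
  shows "split_exact A X C"
  using assms unfolding split_exact_def by blast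

text \<open>Surjectivity onto \<open>Hom(Q, C)\<close> is the projectivity of \<open>Q\<close>. If
  \<open>p * k\<close> is zero, then \<open>k = i * (L * k)\<close>, and cancelling \<open>i\<close>
  shows that the linear map \<open>L * k\<close> is a homomorphism.\<close>

lemma hom_dim_exact:
  assumes AXC: "split_exact A X C" and Q: "projective n q Q" and X: "is_module n q X" and C: "is_module n q C"
  shows "hom_dim Q X = hom_dim Q A + hom_dim Q C"
  using AXC
proof (rule split_exactE)
  fix i p L R
  assume h: "i \<in> module_hom A X" "p \<in> module_hom X C" "L \<in> carrier_mat (mdim A) (mdim X)"
    "R \<in> carrier_mat (mdim X) (mdim C)" "p * i = 0\<^sub>m (mdim C) (mdim A)" "L * i = 1\<^sub>m (mdim A)"
    "p * R = 1\<^sub>m (mdim C)" "i * L + R * p = 1\<^sub>m (mdim X)" and "mod_shape A" "mod_shape X" "mod_shape C"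
  hence sh: "mod_shape A" "mod_shape X" "mod_shape C" "mod_shape Q" using Q projective_shape by auto
  note d = h(1,2)[THEN homD(2)] h(1,2)[THEN homD(3)] h(3,4)[THEN carrier_matD(1)] h(3,4)[THEN carrier_matD(2)]
  have "mat_dim (mdim X) (mdim Q) (module_hom Q X) = mat_dim (mdim A) (mdim Q) (module_hom Q A)
     + mat_dim (mdim C) (mdim Q) (module_hom Q C)"
  proof (rule mat_dim_exact[where f = "\<lambda>k. i * k" and g = "\<lambda>k. p * k"])
    show "(*) i \<in> module_hom Q A \<rightarrow> module_hom Q X" using h sh by (auto intro: hom_comp)
    show "inj_on ((*) i) (module_hom Q A)"
      by (rule inj_on_inverseI[of _ "\<lambda>k. L * k"])
        (use d in \<open>auto simp: mult_rewrite[OF h(6)] homD(2,3)\<close>)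
    show "(*) p ` module_hom Q X = module_hom Q C"
    proof (intro equalityI image_subsetI subsetI)
      fix k assume "k \<in> module_hom Q C"
      from projective_lift[OF Q X C h(2,4,7) this]
      show "k \<in> (*) p ` module_hom Q X" by blast
    qed (use h sh in \<open>auto intro: hom_comp\<close>)
    fix k assume k: "k \<in> module_hom Q X"
    note dk = homD(2,3)[OF k]
    show "p * k = 0\<^sub>m (mdim C) (mdim Q) \<longleftrightarrow> k \<in> (*) i ` module_hom Q A"
    proof
      assume *: "p * k = 0\<^sub>m (mdim C) (mdim Q)"
      have "k = (i * L + R * p) * k" using h(8) dk by simp
      also have "\<dots> = i * (L * k)" using d dk * by (simp add: mat_distrib assoc_mult_mat_dim)
      finally have eq: "k = i * (L * k)" .
      have "L * k \<in> module_hom Q A"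
        by (rule hom_cancel_mono[OF h(1) _ _ h(3,6)]) (use sh k d dk eq in auto)
      thus "k \<in> (*) i ` module_hom Q A" using eq by blast
    qed (use d h(5) in \<open>auto simp: mult_rewrite[OF h(5)] homD\<close>)
  qed (use sh d in \<open>auto intro!: mat_subspace_hom simp: mat_distrib homD(2,3)\<close>)
  thus ?thesis by (simp add: hom_dim_def)
qed

lemma split_exact_projective:
  assumes AXC: "split_exact A X C" and C: "projective n q C" and X: "is_module n q X"
  shows "is_biprod A C X"
  using AXC
proof (rule split_exactE)
  fix i p L R
  assume h: "i \<in> module_hom A X" "p \<in> module_hom X C" "L \<in> carrier_mat (mdim A) (mdim X)"
    "R \<in> carrier_mat (mdim X) (mdim C)" "p * i = 0\<^sub>m (mdim C) (mdim A)" "L * i = 1\<^sub>m (mdim A)"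
    "p * R = 1\<^sub>m (mdim C)" "i * L + R * p = 1\<^sub>m (mdim X)" and sh: "mod_shape A" "mod_shape X" "mod_shape C"
  obtain s where s: "s \<in> module_hom C X" "p * s = 1\<^sub>m (mdim C)"
    using projective_lift[OF C X projective_module[OF C] h(2,4,7) hom_id[OF sh(3)]] .
  note d = h(1,2)[THEN homD(2)] h(1,2)[THEN homD(3)] h(3,4)[THEN carrier_matD(1)]
    h(3,4)[THEN carrier_matD(2)] homD(2,3)[OF s(1)]
  \<comment> \<open>With \<open>s\<close> a homomorphic section, \<open>1 - s * p\<close> is killed
    by \<open>p\<close> and so takes values in the image of \<open>i\<close>. Its
    \<open>L\<close>-coordinate is the retraction; it intertwines because \<open>i * P\<close> does,
    although \<open>L\<close> itself need not.\<close>
  define P where "P = L * (1\<^sub>m (mdim X) - s * p)"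
  have dP: "dim_row P = mdim A" "dim_col P = mdim X" using d by (auto simp: P_def)
  have sp: "s * p \<in> module_hom X X" using s h sh by (intro hom_comp)
  have iP: "i * P = 1\<^sub>m (mdim X) - s * p"
  proof -
    let ?E = "1\<^sub>m (mdim X) - s * p"
    have "p * ?E = 0\<^sub>m (mdim C) (mdim X)" using d by (simp add: mat_distrib mult_rewrite[OF s(2)])
    hence "(i * L + R * p) * ?E = i * P"
      using d by (simp add: mat_distrib(2) assoc_mult_mat_dim P_def)
    moreover have "(i * L + R * p) * ?E = ?E" using h(8) d by simp
    ultimately show ?thesis by simp
  qed
  have "1\<^sub>m (mdim X) - s * p \<in> module_hom X X"
    using homD(4)[OF sp] d sh by (intro homI) (auto simp: mat_distrib)
  hence P: "P \<in> module_hom X A"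
    by (intro hom_cancel_mono[OF h(1) _ _ h(3,6)]) (use iP sh dP in auto)
  show ?thesis
  proof (rule is_biprodI[OF sh(1,3,2) h(1) s(1) P h(2) _ s(2) _ h(5)])
    show "P * i = 1\<^sub>m (mdim A)"
      unfolding P_def using d h(5,6) by (simp add: mat_distrib assoc_mult_mat_dim)
    show "P * s = 0\<^sub>m (mdim A) (mdim C)"
      unfolding P_def using d s(2) by (simp add: mat_distrib assoc_mult_mat_dim)
    show "i * P + s * p = 1\<^sub>m (mdim X)" unfolding iP using d by (intro eq_matI) auto
  qed
qed

section \<open>Kronecker and tensor products\<close>

lemma kronecker_dim [simp]:
  "dim_row (kronecker A B) = dim_row A * dim_row B"
  "dim_col (kronecker A B) = dim_col A * dim_col B"
  by (simp_all add: kronecker_def)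

lemma kronecker_carrier [simp]:
  "A \<in> carrier_mat r c \<Longrightarrow> B \<in> carrier_mat r' c' \<Longrightarrow> kronecker A B \<in> carrier_mat (r * r') (c * c')"
  by (rule carrier_matI) auto

lemma index_kronecker:
  "i < dim_row A * dim_row B \<Longrightarrow> j < dim_col A * dim_col B \<Longrightarrow> kronecker A B $$ (i, j) =
     A $$ (i div dim_row B, j div dim_col B) * B $$ (i mod dim_row B, j mod dim_col B)"
  by (simp add: kronecker_def)

lemma sum_mult_div_mod:
  "(\<Sum>k<p * r. f (k div r) (k mod r)) = (\<Sum>i<p. \<Sum>j<(r::nat). f i j)"
  unfolding sum.cartesian_product
  by (rule sum.reindex_bij_witness[of _ "\<lambda>(i,j). i * r + j" "\<lambda>k. (k div r, k mod r)"])
    (auto simp: div_less_of_less_mult mod_less_of_less_mult mult_add_less_mult)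

lemma index_mult_mat_sum:
  assumes "i < dim_row A" "j < dim_col B" "dim_col A = dim_row B"
  shows "(A * B) $$ (i, j) = (\<Sum>k<dim_col A. A $$ (i, k) * B $$ (k, j))"
  using assms by (auto simp: scalar_prod_def atLeast0LessThan intro!: sum.cong)

lemma kronecker_mult:
  fixes A B C D :: "'k::field mat"
  assumes "dim_col A = dim_row C" "dim_col B = dim_row D"
  shows "kronecker A B * kronecker C D = kronecker (A * C) (B * D)"
proof (rule eq_matI)
  fix i j assume "i < dim_row (kronecker (A * C) (B * D))" "j < dim_col (kronecker (A * C) (B * D))"
  hence ij: "i < dim_row A * dim_row B" "j < dim_col C * dim_col D" by auto
  note b = div_less_of_less_mult[OF ij(1)] mod_less_of_less_mult[OF ij(1)]
    div_less_of_less_mult[OF ij(2)] mod_less_of_less_mult[OF ij(2)]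
  have "(kronecker A B * kronecker C D) $$ (i, j) =
    (\<Sum>k<dim_row C * dim_row D. (A $$ (i div dim_row B, k div dim_row D) * B $$ (i mod dim_row B, k mod dim_row D))
      * (C $$ (k div dim_row D, j div dim_col D) * D $$ (k mod dim_row D, j mod dim_col D)))"
    using ij assms by (subst index_mult_mat_sum) (auto simp: index_kronecker intro!: sum.cong)
  also have "\<dots> = (\<Sum>k<dim_row C. \<Sum>l<dim_row D. (A $$ (i div dim_row B, k) * B $$ (i mod dim_row B, l))
      * (C $$ (k, j div dim_col D) * D $$ (l, j mod dim_col D)))"
    by (rule sum_mult_div_mod)
  also have "\<dots> = (A * C) $$ (i div dim_row B, j div dim_col D) * (B * D) $$ (i mod dim_row B, j mod dim_col D)"
    using b assms by (simp add: index_mult_mat_sum sum_product mult_ac del: index_mult_mat(1))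
  finally show "(kronecker A B * kronecker C D) $$ (i, j) = kronecker (A * C) (B * D) $$ (i, j)"
    using ij by (simp add: index_kronecker)
qed auto

lemma kronecker_assoc:
  "kronecker (kronecker A B) C = kronecker A (kronecker B C)"
proof (rule eq_matI)
  fix i j assume "i < dim_row (kronecker A (kronecker B C))" "j < dim_col (kronecker A (kronecker B C))"
  hence ij: "i < dim_row A * (dim_row B * dim_row C)" "j < dim_col A * (dim_col B * dim_col C)" by auto
  hence ij': "i < dim_row A * dim_row B * dim_row C" "j < dim_col A * dim_col B * dim_col C"
    by (simp_all add: mult.assoc)
  note b = div_less_of_less_mult[OF ij'(1)] div_less_of_less_mult[OF ij'(2)]
    mod_less_of_less_mult[OF ij(1)] mod_less_of_less_mult[OF ij(2)]
  have *: "i div c div b = i div (b * c)" "i div c mod b = i mod (b * c) div c"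
    "i mod (b * c) mod c = i mod c" for i b c :: nat
    unfolding mult.commute[of b c] by (cases "c = 0"; simp add: div_mult2_eq mod_mult2_eq)+
  show "kronecker (kronecker A B) C $$ (i, j) = kronecker A (kronecker B C) $$ (i, j)"
    using ij ij' b by (simp add: index_kronecker * mult.assoc)
qed (auto simp: mult.assoc)

lemma kronecker_one [simp]: "kronecker (1\<^sub>m r) (1\<^sub>m s) = 1\<^sub>m (r * s)"
proof (rule eq_matI)
  fix i j assume ij: "i < dim_row (1\<^sub>m (r * s))" "j < dim_col (1\<^sub>m (r * s))"
  have "i = j \<longleftrightarrow> i div s = j div s \<and> i mod s = j mod s" by (metis div_mult_mod_eq)
  thus "kronecker (1\<^sub>m r) (1\<^sub>m s) $$ (i, j) = 1\<^sub>m (r * s) $$ (i, j)"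
    using ij by (auto simp: index_kronecker div_less_of_less_mult mod_less_of_less_mult)
qed auto

lemma kronecker_one_left [simp]: "kronecker (1\<^sub>m (Suc 0)) A = A"
  by (rule eq_matI) (auto simp: index_kronecker)

lemma kronecker_one_right [simp]: "kronecker A (1\<^sub>m (Suc 0)) = A"
  by (rule eq_matI) (auto simp: index_kronecker)

lemma kronecker_add:
  "dim_row A = dim_row B \<Longrightarrow> dim_col A = dim_col B \<Longrightarrow>
     kronecker (A + B) C = kronecker A C + kronecker B (C :: 'k::field mat)"
  "dim_row A = dim_row B \<Longrightarrow> dim_col A = dim_col B \<Longrightarrow>
     kronecker C (A + B) = kronecker C A + kronecker C (B :: 'k::field mat)"
  by (rule eq_matI; auto simp: index_kronecker div_less_of_less_mult mod_less_of_less_mult distrib_left distrib_right)+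

lemma kronecker_smult:
  "kronecker (k \<cdot>\<^sub>m A) B = k \<cdot>\<^sub>m kronecker A (B :: 'k::field mat)"
  "kronecker A (k \<cdot>\<^sub>m B) = k \<cdot>\<^sub>m kronecker A (B :: 'k::field mat)"
  by (rule eq_matI; auto simp: index_kronecker div_less_of_less_mult mod_less_of_less_mult)+

lemma kronecker_zero [simp]:
  "kronecker (0\<^sub>m r c) B = 0\<^sub>m (r * dim_row B) (c * dim_col (B :: 'k::field mat))"
  "kronecker B (0\<^sub>m r c) = 0\<^sub>m (dim_row B * r) (dim_col (B :: 'k::field mat) * c)"
  by (rule eq_matI; auto simp: index_kronecker div_less_of_less_mult mod_less_of_less_mult)+

lemma mdim_tensor [simp]: "mdim (M \<otimes>\<^sub>H N) = mdim M * mdim N"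
  by (simp add: tensor_def)

lemma action_tensor:
  "action (M \<otimes>\<^sub>H N) Gen_a = kronecker (action M Gen_a) (action N Gen_b) + kronecker (1\<^sub>m (mdim M)) (action N Gen_a)"
  "action (M \<otimes>\<^sub>H N) Gen_b = kronecker (action M Gen_b) (action N Gen_b)"
  "action (M \<otimes>\<^sub>H N) Gen_c = kronecker (action M Gen_c) (action N Gen_c)"
  "action (M \<otimes>\<^sub>H N) Gen_d = kronecker (action M Gen_d) (action N Gen_c) + kronecker (1\<^sub>m (mdim M)) (action N Gen_d)"
  by (simp_all add: tensor_def)

lemma hmod_eqI:
  fixes M N :: "'k hmod"
  assumes "mdim M = mdim N" "action M Gen_a = action N Gen_a" "action M Gen_b = action N Gen_b"
    "action M Gen_c = action N Gen_c" "action M Gen_d = action N Gen_d"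
  shows "M = N"
proof -
  have "action M x = action N x" for x using assms by (cases x) auto
  hence "action M = action N" by auto
  with assms(1) show ?thesis by (cases M, cases N) auto
qed

lemma all_gen: "(\<forall>x. Q x) \<longleftrightarrow> Q Gen_a \<and> Q Gen_b \<and> Q Gen_c \<and> Q Gen_d"
  by (metis gen.exhaust)

lemma mod_shape_tensor [simp]:
  "mod_shape M \<Longrightarrow> mod_shape N \<Longrightarrow> mod_shape (M \<otimes>\<^sub>H N)"
  unfolding mod_shape_def[of "M \<otimes>\<^sub>H N"] all_gen
  by (auto simp: action_tensor intro!: carrier_matI)

lemma hom_tensor:
  assumes f: "f \<in> module_hom M M'" and g: "g \<in> module_hom N N'"
    and sh: "mod_shape M" "mod_shape M'" "mod_shape N" "mod_shape N'"
  shows "kronecker f g \<in> module_hom (M \<otimes>\<^sub>H N) (M' \<otimes>\<^sub>H N')"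
proof -
  note d = homD(2,3)[OF f] homD(2,3)[OF g] and e = homD(4)[OF f] homD(4)[OF g]
  have "kronecker f g * action (M \<otimes>\<^sub>H N) x = action (M' \<otimes>\<^sub>H N') x * kronecker f g" for x
    by (cases x) (use d e sh in \<open>simp_all add: action_tensor mat_distrib kronecker_mult\<close>)
  thus ?thesis using d by (intro homI) auto
qed

text \<open>Row-major indexing makes the Kronecker product strictly associative, so no associativity
  isomorphisms appear anywhere; the remaining content is coassociativity.\<close>

lemma tensor_assoc:
  assumes "mod_shape L" "mod_shape M" "mod_shape N"
  shows "(L \<otimes>\<^sub>H M) \<otimes>\<^sub>H N = L \<otimes>\<^sub>H (M \<otimes>\<^sub>H (N :: 'k::field hmod))"
proof (rule hmod_eqI)
  have *: "A + B + C = A + (B + C)" if "dim_row A = dim_row C" "dim_col A = dim_col C"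
    "dim_row B = dim_row C" "dim_col B = dim_col C" for A B C :: "'k mat"
    using that by (intro eq_matI) auto
  show "action ((L \<otimes>\<^sub>H M) \<otimes>\<^sub>H N) Gen_a = action (L \<otimes>\<^sub>H (M \<otimes>\<^sub>H N)) Gen_a"
    "action ((L \<otimes>\<^sub>H M) \<otimes>\<^sub>H N) Gen_d = action (L \<otimes>\<^sub>H (M \<otimes>\<^sub>H N)) Gen_d"
    using assms
    by (simp_all add: action_tensor kronecker_add kronecker_assoc * del: kronecker_one
        flip: kronecker_one[of "mdim L" "mdim M"])
qed (simp_all add: action_tensor kronecker_assoc mult.assoc)

lemma is_biprod_tensor_right:
  assumes "is_biprod A B X" and Q: "mod_shape Q"
  shows "is_biprod (A \<otimes>\<^sub>H Q) (B \<otimes>\<^sub>H Q) (X \<otimes>\<^sub>H Q)"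
  using assms(1)
proof (rule is_biprodE)
  fix i j p r
  assume h: "i \<in> module_hom A X" "j \<in> module_hom B X" "p \<in> module_hom X A" "r \<in> module_hom X B"
    and e: "p * i = 1\<^sub>m (mdim A)" "r * j = 1\<^sub>m (mdim B)"
    "p * j = 0\<^sub>m (mdim A) (mdim B)" "r * i = 0\<^sub>m (mdim B) (mdim A)"
    "i * p + j * r = 1\<^sub>m (mdim X)" and sh: "mod_shape A" "mod_shape B" "mod_shape X"
  note d = h(1-4)[THEN homD(2)] h(1-4)[THEN homD(3)]
  let ?k = "\<lambda>f. kronecker f (1\<^sub>m (mdim Q))"
  show ?thesis
    by (rule is_biprodI[of _ _ _ "?k i" "?k j" "?k p" "?k r"])
      (use d e sh Q h hom_id[OF Q] in
        \<open>auto simp: kronecker_mult simp flip: kronecker_add intro!: hom_tensor\<close>)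
qed

lemma split_exact_tensor_right:
  assumes "split_exact A X C" and Q: "mod_shape Q"
  shows "split_exact (A \<otimes>\<^sub>H Q) (X \<otimes>\<^sub>H Q) (C \<otimes>\<^sub>H Q)"
  using assms(1)
proof (rule split_exactE)
  fix i p L R
  assume h: "i \<in> module_hom A X" "p \<in> module_hom X C" "L \<in> carrier_mat (mdim A) (mdim X)"
    "R \<in> carrier_mat (mdim X) (mdim C)" and e: "p * i = 0\<^sub>m (mdim C) (mdim A)" "L * i = 1\<^sub>m (mdim A)"
    "p * R = 1\<^sub>m (mdim C)" "i * L + R * p = 1\<^sub>m (mdim X)"
    and sh: "mod_shape A" "mod_shape X" "mod_shape C"
  note d = h(1,2)[THEN homD(2)] h(1,2)[THEN homD(3)] h(3,4)[THEN carrier_matD(1)] h(3,4)[THEN carrier_matD(2)]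
  let ?k = "\<lambda>f. kronecker f (1\<^sub>m (mdim Q))"
  show ?thesis unfolding split_exact_def
    by (intro conjI bexI[of _ "?k i"] bexI[of _ "?k p"] bexI[of _ "?k L"] bexI[of _ "?k R"])
      (use d e sh Q h hom_id[OF Q] in
        \<open>auto simp: kronecker_mult simp flip: kronecker_add intro!: hom_tensor\<close>)
qed

definition unit_module :: "'k::field \<Rightarrow> 'k hmod" where
  "unit_module q = simple_module q 1 0"

lemma mdim_unit_module [simp]: "mdim (unit_module q) = Suc 0"
  by (simp add: unit_module_def simple_module_def)

lemma action_unit_module:
  "action (unit_module q) Gen_a = 0\<^sub>m 1 1" "action (unit_module q) Gen_b = 1\<^sub>m 1"
  "action (unit_module q) Gen_c = 1\<^sub>m 1" "action (unit_module q) Gen_d = 0\<^sub>m 1 1"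
  by (auto simp: unit_module_def simple_module_def intro!: eq_matI)

lemma mod_shape_unit_module [simp]: "mod_shape (unit_module q)"
  unfolding mod_shape_def all_gen by (simp add: action_unit_module)

lemma unit_tensor [simp]: "mod_shape M \<Longrightarrow> unit_module q \<otimes>\<^sub>H M = M"
  by (rule hmod_eqI) (simp_all add: action_tensor action_unit_module)

section \<open>Duals and the adjunction of tensor functors\<close>

text \<open>\<open>E \<otimes> -\<close> is left adjoint to \<open>D \<otimes> -\<close>, with
  \<open>co\<close> and \<open>ev\<close> giving unit and counit; strict associativity and unitality
  let the zigzag identities be stated without coherence maps. \<open>tensor_module\<close> belongs
  to the interface because the relations on a tensor product are proved directly only for left
  factors on which \<open>a\<close> and \<open>d\<close> square to zero.\<close>

locale dual_pair =
  fixes n :: nat and q :: "'k::field" and E D :: "'k hmod" and ev co :: "'k mat"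
  assumes shape: "mod_shape E" "mod_shape D"
    and tensor_module: "\<And>M. is_module n q M \<Longrightarrow> is_module n q (E \<otimes>\<^sub>H M)"
      "\<And>M. is_module n q M \<Longrightarrow> is_module n q (D \<otimes>\<^sub>H M)"
    and ev: "ev \<in> module_hom (E \<otimes>\<^sub>H D) (unit_module q)"
    and co: "co \<in> module_hom (unit_module q) (D \<otimes>\<^sub>H E)"
    and zigzag: "kronecker ev (1\<^sub>m (mdim E)) * kronecker (1\<^sub>m (mdim E)) co = 1\<^sub>m (mdim E)"
      "kronecker (1\<^sub>m (mdim D)) ev * kronecker co (1\<^sub>m (mdim D)) = 1\<^sub>m (mdim D)"
begin

definition curry_hom :: "'k hmod \<Rightarrow> 'k mat \<Rightarrow> 'k mat" where
  "curry_hom Q f = kronecker (1\<^sub>m (mdim D)) f * kronecker co (1\<^sub>m (mdim Q))"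

definition uncurry_hom :: "'k hmod \<Rightarrow> 'k mat \<Rightarrow> 'k mat" where
  "uncurry_hom Y h = kronecker ev (1\<^sub>m (mdim Y)) * kronecker (1\<^sub>m (mdim E)) h"

lemma dims [simp]: "dim_row ev = Suc 0" "dim_col ev = mdim E * mdim D"
  "dim_row co = mdim D * mdim E" "dim_col co = Suc 0"
  using homD(2,3)[OF ev] homD(2,3)[OF co] by auto

lemma curry_hom:
  assumes f: "f \<in> module_hom (E \<otimes>\<^sub>H Q) Y" and sh: "mod_shape Q" "mod_shape Y"
  shows "curry_hom Q f \<in> module_hom Q (D \<otimes>\<^sub>H Y)"
proof -
  have "kronecker co (1\<^sub>m (mdim Q)) \<in> module_hom (unit_module q \<otimes>\<^sub>H Q) ((D \<otimes>\<^sub>H E) \<otimes>\<^sub>H Q)"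
    using co shape sh by (intro hom_tensor hom_id) auto
  moreover have "kronecker (1\<^sub>m (mdim D)) f \<in> module_hom (D \<otimes>\<^sub>H E \<otimes>\<^sub>H Q) (D \<otimes>\<^sub>H Y)"
    using f shape sh by (intro hom_tensor hom_id) auto
  ultimately show ?thesis
    unfolding curry_hom_def using shape sh by (auto simp: tensor_assoc intro!: hom_comp)
qed

lemma uncurry_hom:
  assumes h: "h \<in> module_hom Q (D \<otimes>\<^sub>H Y)" and sh: "mod_shape Q" "mod_shape Y"
  shows "uncurry_hom Y h \<in> module_hom (E \<otimes>\<^sub>H Q) Y"
proof -
  have "kronecker ev (1\<^sub>m (mdim Y)) \<in> module_hom ((E \<otimes>\<^sub>H D) \<otimes>\<^sub>H Y) (unit_module q \<otimes>\<^sub>H Y)"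
    using ev shape sh by (intro hom_tensor hom_id) auto
  moreover have "kronecker (1\<^sub>m (mdim E)) h \<in> module_hom (E \<otimes>\<^sub>H Q) (E \<otimes>\<^sub>H (D \<otimes>\<^sub>H Y))"
    using h shape sh by (intro hom_tensor hom_id) auto
  ultimately show ?thesis
    unfolding uncurry_hom_def using shape sh by (auto simp: tensor_assoc intro!: hom_comp)
qed

text \<open>The interchange law moves \<open>f\<close> past \<open>ev\<close>, after which
  \<open>ev\<close> and \<open>co\<close> meet and the first zigzag identity removes them. The other
  composite uses the second one in the same way.\<close>

lemma uncurry_curry:
  assumes f: "f \<in> module_hom (E \<otimes>\<^sub>H Q) Y"
  shows "uncurry_hom Y (curry_hom Q f) = f"
proof -
  note d = homD(2,3)[OF f, simplified]
  have "kronecker (1\<^sub>m (mdim E)) (curry_hom Q f) =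
      kronecker (1\<^sub>m (mdim E)) (kronecker (1\<^sub>m (mdim D)) f) *
      kronecker (1\<^sub>m (mdim E)) (kronecker co (1\<^sub>m (mdim Q)))"
    unfolding curry_hom_def using d by (subst kronecker_mult) (auto simp: algebra_simps)
  also have "\<dots> = kronecker (1\<^sub>m (mdim E * mdim D)) f *
      kronecker (kronecker (1\<^sub>m (mdim E)) co) (1\<^sub>m (mdim Q))"
    by (simp flip: kronecker_assoc)
  finally have "uncurry_hom Y (curry_hom Q f) =
      kronecker ev (1\<^sub>m (mdim Y)) * kronecker (1\<^sub>m (mdim E * mdim D)) f *
      kronecker (kronecker (1\<^sub>m (mdim E)) co) (1\<^sub>m (mdim Q))"
    unfolding uncurry_hom_def using d by (simp add: assoc_mult_mat_dim algebra_simps)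
  also have "kronecker ev (1\<^sub>m (mdim Y)) * kronecker (1\<^sub>m (mdim E * mdim D)) f =
     kronecker (1\<^sub>m (Suc 0)) f * kronecker ev (1\<^sub>m (mdim E * mdim Q))"
    using d by (subst (1 2) kronecker_mult) auto
  also have "\<dots> = f * kronecker (kronecker ev (1\<^sub>m (mdim E))) (1\<^sub>m (mdim Q))"
    by (simp add: kronecker_assoc)
  also have "\<dots> * kronecker (kronecker (1\<^sub>m (mdim E)) co) (1\<^sub>m (mdim Q)) =
     f * kronecker (kronecker ev (1\<^sub>m (mdim E)) * kronecker (1\<^sub>m (mdim E)) co) (1\<^sub>m (mdim Q))"
    using d by (simp add: assoc_mult_mat_dim kronecker_mult algebra_simps)
  also have "\<dots> = f" using d by (simp add: zigzag)
  finally show ?thesis .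
qed

lemma curry_uncurry:
  assumes h: "h \<in> module_hom Q (D \<otimes>\<^sub>H Y)"
  shows "curry_hom Q (uncurry_hom Y h) = h"
proof -
  note d = homD(2,3)[OF h, simplified]
  have "kronecker (1\<^sub>m (mdim D)) (uncurry_hom Y h) =
      kronecker (1\<^sub>m (mdim D)) (kronecker ev (1\<^sub>m (mdim Y))) *
      kronecker (1\<^sub>m (mdim D)) (kronecker (1\<^sub>m (mdim E)) h)"
    unfolding uncurry_hom_def using d by (subst kronecker_mult) (auto simp: algebra_simps)
  also have "\<dots> = kronecker (kronecker (1\<^sub>m (mdim D)) ev) (1\<^sub>m (mdim Y)) *
      kronecker (1\<^sub>m (mdim D * mdim E)) h"
    by (simp flip: kronecker_assoc)
  finally have "curry_hom Q (uncurry_hom Y h) =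
      kronecker (kronecker (1\<^sub>m (mdim D)) ev) (1\<^sub>m (mdim Y)) *
      (kronecker (1\<^sub>m (mdim D * mdim E)) h * kronecker co (1\<^sub>m (mdim Q)))"
    unfolding curry_hom_def using d by (simp add: assoc_mult_mat_dim algebra_simps)
  also have "kronecker (1\<^sub>m (mdim D * mdim E)) h * kronecker co (1\<^sub>m (mdim Q)) =
     kronecker co (1\<^sub>m (mdim D * mdim Y)) * kronecker (1\<^sub>m (Suc 0)) h"
    using d by (subst (1 2) kronecker_mult) auto
  also have "\<dots> = kronecker (kronecker co (1\<^sub>m (mdim D))) (1\<^sub>m (mdim Y)) * h"
    by (simp add: kronecker_assoc)
  also have "kronecker (kronecker (1\<^sub>m (mdim D)) ev) (1\<^sub>m (mdim Y)) * \<dots> =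
     kronecker (kronecker (1\<^sub>m (mdim D)) ev * kronecker co (1\<^sub>m (mdim D))) (1\<^sub>m (mdim Y)) * h"
    using d by (simp add: assoc_mult_mat_dim[symmetric] kronecker_mult algebra_simps)
  also have "\<dots> = h" using d by (simp add: zigzag)
  finally show ?thesis .
qed

lemma hom_dim_tensor:
  assumes sh: "mod_shape Q" "mod_shape Y"
  shows "hom_dim (E \<otimes>\<^sub>H Q) Y = hom_dim Q (D \<otimes>\<^sub>H Y)"
  unfolding hom_dim_def
proof (rule mat_dim_iso[where f = "curry_hom Q"])
  show "bij_betw (curry_hom Q) (module_hom (E \<otimes>\<^sub>H Q) Y) (module_hom Q (D \<otimes>\<^sub>H Y))"
    by (rule bij_betw_byWitness[where f' = "uncurry_hom Y"])
      (auto simp: uncurry_curry curry_uncurry intro: curry_hom uncurry_hom sh)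
next
  have d: "dim_row A = mdim Y" "dim_col A = mdim E * mdim Q" if "A \<in> module_hom (E \<otimes>\<^sub>H Q) Y" for A
    using homD(2,3)[OF that] by auto
  fix A B and k :: 'k
  assume A: "A \<in> module_hom (E \<otimes>\<^sub>H Q) Y"
  show "curry_hom Q (k \<cdot>\<^sub>m A) = k \<cdot>\<^sub>m curry_hom Q A"
    unfolding curry_hom_def kronecker_smult using d[OF A]
    by (intro smult_mult_dim) (auto simp: mult.assoc)
  assume B: "B \<in> module_hom (E \<otimes>\<^sub>H Q) Y"
  show "curry_hom Q (A + B) = curry_hom Q A + curry_hom Q B"
    unfolding curry_hom_def using d[OF A] d[OF B]
    by (subst kronecker_add) (auto simp: mult.assoc intro!: add_mult_distrib_dim)
qed (intro mat_subspace_hom mod_shape_tensor sh shape)+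

text \<open>A left adjoint preserves projectives when its right adjoint preserves surjections: the
  transpose of \<open>f\<close> is lifted along \<open>1 \<otimes> g\<close>, which has the linear
  right inverse \<open>1 \<otimes> R\<close>, and the lift is transposed back.\<close>

lemma projective_tensor:
  assumes Q: "projective n q Q"
  shows "projective n q (E \<otimes>\<^sub>H Q)"
proof (rule projectiveI)
  show "is_module n q (E \<otimes>\<^sub>H Q)" using Q by (intro tensor_module projective_module)
  fix X C g R f
  assume h: "is_module n q X" "is_module n q C" "g \<in> module_hom X C"
    "R \<in> carrier_mat (mdim X) (mdim C)" "g * R = 1\<^sub>m (mdim C)" and f: "f \<in> module_hom (E \<otimes>\<^sub>H Q) C"
  note sh = shape is_module_shape[OF h(1)] is_module_shape[OF h(2)] projective_shape[OF Q]
  note d = homD(2,3)[OF h(3)] carrier_matD[OF h(4)]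
  have g: "kronecker (1\<^sub>m (mdim D)) g \<in> module_hom (D \<otimes>\<^sub>H X) (D \<otimes>\<^sub>H C)"
    using h sh by (intro hom_tensor hom_id)
  have "kronecker (1\<^sub>m (mdim D)) R \<in> carrier_mat (mdim (D \<otimes>\<^sub>H X)) (mdim (D \<otimes>\<^sub>H C))"
    using h by (simp add: kronecker_carrier)
  moreover have "kronecker (1\<^sub>m (mdim D)) g * kronecker (1\<^sub>m (mdim D)) R = 1\<^sub>m (mdim (D \<otimes>\<^sub>H C))"
    using d h(5) by (simp add: kronecker_mult)
  ultimately obtain k where k: "k \<in> module_hom Q (D \<otimes>\<^sub>H X)"
    "kronecker (1\<^sub>m (mdim D)) g * k = curry_hom Q f"
    using projective_lift[OF Q tensor_module(2)[OF h(1)] tensor_module(2)[OF h(2)] g]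
      curry_hom[OF f sh(5,4)] by blast
  note dk = homD(2,3)[OF k(1), simplified]
  have "g * uncurry_hom X k = kronecker (1\<^sub>m (Suc 0)) g * kronecker ev (1\<^sub>m (mdim X)) * kronecker (1\<^sub>m (mdim E)) k"
    unfolding uncurry_hom_def using d dk by (simp add: assoc_mult_mat_dim algebra_simps)
  also have "kronecker (1\<^sub>m (Suc 0)) g * kronecker ev (1\<^sub>m (mdim X)) =
      kronecker ev (1\<^sub>m (mdim C)) * kronecker (1\<^sub>m (mdim E * mdim D)) g"
    using d by (subst (1 2) kronecker_mult) auto
  also have "\<dots> * kronecker (1\<^sub>m (mdim E)) k =
      kronecker ev (1\<^sub>m (mdim C)) * (kronecker (kronecker (1\<^sub>m (mdim E)) (1\<^sub>m (mdim D))) g * kronecker (1\<^sub>m (mdim E)) k)"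
    using d dk by (simp add: assoc_mult_mat_dim algebra_simps)
  also have "\<dots> = uncurry_hom C (curry_hom Q f)"
    unfolding uncurry_hom_def k(2)[symmetric] kronecker_assoc using d dk
    by (subst kronecker_mult) auto
  also have "\<dots> = f" by (rule uncurry_curry[OF f])
  finally show "\<exists>h\<in>module_hom (E \<otimes>\<^sub>H Q) X. g * h = f"
    using uncurry_hom[OF k(1) sh(5,3)] by blast
qed

end

section \<open>Monomial matrices\<close>

text \<open>The map \<open>e_j \<mapsto> f(j) e_(j + s)\<close>, where vectors pushed out of range
  become zero. An integer shift gives raising, lowering and diagonal operators, inclusions and
  projections one common product rule; the condition in that rule records vectors lost in the
  intermediate space.\<close>

definition mono_mat :: "nat \<Rightarrow> nat \<Rightarrow> int \<Rightarrow> (nat \<Rightarrow> 'k::field) \<Rightarrow> 'k mat" where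
  "mono_mat r c s f = mat r c (\<lambda>(i, j). if int i = int j + s then f j else 0)"

lemma mono_mat_dim [simp]: "dim_row (mono_mat r c s f) = r" "dim_col (mono_mat r c s f) = c"
  by (simp_all add: mono_mat_def)

lemma index_mono_mat:
  "i < r \<Longrightarrow> j < c \<Longrightarrow> mono_mat r c s f $$ (i, j) = (if int i = int j + s then f j else 0)"
  by (simp add: mono_mat_def)

lemma mono_mat_eqI:
  assumes "\<And>i j. i < r \<Longrightarrow> j < c \<Longrightarrow> int i = int j + s \<Longrightarrow> f j = g j" "s = t"
  shows "mono_mat r c s f = mono_mat r c t g"
  using assms by (intro eq_matI) (auto simp: index_mono_mat)

lemma mono_mat_mult:
  "mono_mat r k s f * mono_mat k c t g = mono_mat r c (s + t)
     (\<lambda>j. if 0 \<le> int j + t \<and> int j + t < int k then f (nat (int j + t)) * g j else 0)"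
proof (rule eq_matI)
  fix i j
  assume "i < dim_row (mono_mat r c (s + t) (\<lambda>j. if 0 \<le> int j + t \<and> int j + t < int k then f (nat (int j + t)) * g j else 0))"
    "j < dim_col (mono_mat r c (s + t) (\<lambda>j. if 0 \<le> int j + t \<and> int j + t < int k then f (nat (int j + t)) * g j else 0))"
  hence ij: "i < r" "j < c" by auto
  have "(mono_mat r k s f * mono_mat k c t g) $$ (i, j)
      = (\<Sum>l<k. if l = nat (int j + t) \<and> 0 \<le> int j + t then mono_mat r k s f $$ (i, l) * g j else 0)"
    using ij by (subst index_mult_mat_sum) (auto simp: index_mono_mat intro!: sum.cong)
  also have "\<dots> = (if 0 \<le> int j + t \<and> int j + t < int k \<and> int i = int j + (s + t)
      then f (nat (int j + t)) * g j else 0)"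
  proof (cases "0 \<le> int j + t")
    case True
    thus ?thesis using ij by (simp add: index_mono_mat) (auto simp: index_mono_mat algebra_simps)
  qed auto
  finally show "(mono_mat r k s f * mono_mat k c t g) $$ (i, j) = mono_mat r c (s + t)
     (\<lambda>j. if 0 \<le> int j + t \<and> int j + t < int k then f (nat (int j + t)) * g j else 0) $$ (i, j)"
    using ij by (auto simp: index_mono_mat)
qed auto

lemma mono_mat_smult: "k \<cdot>\<^sub>m mono_mat r c s f = mono_mat r c s (\<lambda>j. k * f j)"
  by (rule eq_matI) (auto simp: index_mono_mat)

lemma mono_mat_add: "mono_mat r c s f + mono_mat r c s g = mono_mat r c s (\<lambda>j. f j + g j)"
  by (rule eq_matI) (auto simp: index_mono_mat)

lemma mono_mat_diff: "mono_mat r c s f - mono_mat r c s g = mono_mat r c s (\<lambda>j. f j - g j)"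
  by (rule eq_matI) (auto simp: index_mono_mat)

lemma one_eq_mono_mat: "1\<^sub>m r = mono_mat r r 0 (\<lambda>_. 1)"
  by (rule eq_matI) (auto simp: index_mono_mat)

lemma mono_mat_zeroI:
  assumes "\<And>i j. i < r \<Longrightarrow> j < c \<Longrightarrow> int i = int j + s \<Longrightarrow> f j = 0"
  shows "mono_mat r c s f = 0\<^sub>m r c"
  using assms by (intro eq_matI) (auto simp: index_mono_mat)

text \<open>Only the shift of the power is kept: nilpotency follows once \<open>k * s\<close>
  exceeds the size in absolute value, whatever the coefficients.\<close>

lemma mono_mat_pow: "\<exists>g. mono_mat r r s f ^\<^sub>m k = mono_mat r r (int k * s) g"
proof (induction k)
  case 0
  thus ?case by (auto simp: one_eq_mono_mat)
next
  case (Suc k)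
  thus ?case by (auto simp: mono_mat_mult algebra_simps)
qed

lemma mono_mat_pow_diag: "mono_mat r r 0 f ^\<^sub>m k = mono_mat r r 0 (\<lambda>j. f j ^ k)"
proof (induction k)
  case 0
  thus ?case by (simp add: one_eq_mono_mat)
next
  case (Suc k)
  show ?case by (simp add: Suc mono_mat_mult) (rule mono_mat_eqI; simp)
qed

section \<open>Arithmetic at a root of unity\<close>

lemma q_int_0 [simp]: "q_int q 0 = 0"
  by (simp add: q_int_def)

lemma q_int_Suc: "q_int q (Suc i) = q_int q i + q ^ i"
  by (simp add: q_int_def)

lemma q_int_1 [simp]: "q_int q (Suc 0) = 1"
  by (simp add: q_int_Suc)

lemma q_int_Suc': "q_int q (Suc i) = 1 + q * q_int q i"
  unfolding q_int_def sum.lessThan_Suc_shift by (simp add: sum_distrib_left)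

lemma q_int_geometric: "(1 - q) * q_int q i = 1 - q ^ i"
proof (induction i)
  case (Suc i)
  show ?case unfolding q_int_Suc distrib_left Suc by (simp add: algebra_simps)
qed simp

lemma alpha_0 [simp]: "alpha q 0 l = 0"
  by (simp add: alpha_def)

lemma alpha_self [simp]: "alpha q l l = 0"
  by (simp add: alpha_def)

locale root_of_unity =
  fixes n :: nat and q :: "'k::field"
  assumes n_gt_2: "n > 2" and prim: "primitive_root_of_unity n q"
begin

lemma q_pow_n [simp]: "q ^ n = 1"
  using prim by (simp add: primitive_root_of_unity_def)

lemma q_nonzero [simp]: "q \<noteq> 0"
  using q_pow_n n_gt_2 by (metis power_0_left zero_neq_one not_less_zero)

lemma q_powi_add: "q powi (x + y) = q powi x * q powi y"
  by (simp add: power_int_add)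

lemma q_powi_diff: "q powi (x - y) = q powi x / q powi y"
  by (simp add: power_int_diff)

lemma q_powi_mult_n [simp]: "q powi (int n * x) = 1"
  by (simp add: power_int_mult)

lemma q_powi_eq_1_iff: "q powi x = 1 \<longleftrightarrow> int n dvd x"
proof
  assume x: "q powi x = 1"
  have "q powi x = q powi (int n * (x div int n)) * q powi (x mod int n)"
    by (simp only: q_powi_add[symmetric] mult_div_mod_eq)
  also have "q powi (x mod int n) = q ^ nat (x mod int n)"
    using n_gt_2 by (simp add: power_int_def)
  finally have "q ^ nat (x mod int n) = 1" using x by (simp only: q_powi_mult_n mult_1)
  moreover have "nat (x mod int n) < n" using n_gt_2 by (simp add: nat_less_iff)
  ultimately have "nat (x mod int n) = 0"
    using prim unfolding primitive_root_of_unity_def by (metis neq0_conv)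
  moreover have "x mod int n \<ge> 0" using n_gt_2 by simp
  ultimately show "int n dvd x" by (simp add: dvd_eq_mod_eq_0)
qed (auto elim!: dvdE)

lemma q_powi_eq_iff: "q powi x = q powi y \<longleftrightarrow> int n dvd x - y"
  by (simp add: q_powi_eq_1_iff[symmetric] q_powi_diff)

lemma q_powi_cong: "int n dvd x - y \<Longrightarrow> q powi x = q powi y"
  by (simp add: q_powi_eq_iff)

lemma q_neq_1 [simp]: "q \<noteq> 1"
  using prim n_gt_2 by (auto simp: primitive_root_of_unity_def dest: spec[of _ 1])

lemma q_int_n [simp]: "q_int q n = 0"
  using q_int_geometric[of q n] by simp

lemma q_int_inverse_n [simp]: "q_int (inverse q) n = 0"
proof -
  have "(1 - inverse q) * q_int (inverse q) n = 0"
    by (simp add: q_int_geometric power_inverse)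
  moreover have "inverse q \<noteq> 1" by (metis inverse_eq_1_iff q_neq_1)
  ultimately show ?thesis by simp
qed

lemma q_int_nonzero: "0 < i \<Longrightarrow> i < n \<Longrightarrow> q_int q i \<noteq> 0"
  using q_int_geometric[of q i] prim by (auto simp: primitive_root_of_unity_def)

lemma alpha_n [simp]: "alpha q n l = 0"
  by (simp add: alpha_def)

lemma alpha_nonzero: "0 < i \<Longrightarrow> i < l \<Longrightarrow> l \<le> n \<Longrightarrow> alpha q i l \<noteq> 0"
  using q_int_nonzero[of i] q_powi_eq_1_iff[of "int i - int l"] zdvd_not_zless[of "int l - int i" "int n"]
  by (auto simp: alpha_def dvd_diff_commute)

text \<open>This is the relation \<open>da - qad = 1 - bc\<close> evaluated on the basis vector with
  index \<open>j\<close>: \<open>da\<close> contributes \<alpha> at \<open>j + 1\<close>,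
  \<open>ad\<close> contributes \<alpha> at \<open>j\<close>, and \<open>bc\<close> acts by the
  power of \<open>q\<close> on the right.\<close>

lemma alpha_rec: "alpha q (Suc j) l - q * alpha q j l = 1 - q powi (2 * int j + 1 - int l)"
proof -
  have e: "q powi (int (Suc j) - int l) = q * q powi (int j - int l)"
  proof -
    have "int (Suc j) - int l = 1 + (int j - int l)" by simp
    thus ?thesis by (simp only: q_powi_add power_int_1_right)
  qed
  have f: "q powi (2 * int j + 1 - int l) = q ^ j * (q * q powi (int j - int l))"
  proof -
    have "2 * int j + 1 - int l = int j + (1 + (int j - int l))" by simp
    thus ?thesis by (simp only: q_powi_add power_int_of_nat power_int_1_right)
  qed
  have g: "q * q_int q j = q_int q j + q ^ j - 1"
    using q_int_Suc[of q j] q_int_Suc'[of q j] by (metis add_diff_cancel_left')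
  have "(x + y) * (1 - q * p) - q * (x * (1 - p)) = 1 - y * (q * p)" if "q * x = x + y - 1" for x y p
  proof -
    have "(x + y) * (1 - q * p) - q * (x * (1 - p)) = (x + y - q * x) - y * (q * p)"
      by (simp add: algebra_simps)
    thus ?thesis unfolding that by simp
  qed
  from this[OF g] show ?thesis unfolding alpha_def e f q_int_Suc .
qed

lemma alpha_cong: "int n dvd int l - int l' \<Longrightarrow> alpha q i l = alpha q i l'"
  unfolding alpha_def by (intro arg_cong2[of _ _ _ _ "(*)"] arg_cong2[of _ _ _ _ "(-)"] q_powi_cong refl)
    (simp add: dvd_diff_commute)

section \<open>Highest weight modules and tensor products of modules\<close>

text \<open>The quotient of dimension \<open>D\<close> of the Verma module of the highest weight of \<open>V(l, r)\<close>;
  it is a module if \<open>D = l\<close> or \<open>D = n\<close>, when it is the simple module or the Verma module.\<close>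

definition hw_module :: "nat \<Rightarrow> nat \<Rightarrow> int \<Rightarrow> 'k hmod" where
  "hw_module D l r =
    \<lparr>mdim = D,
     action = (\<lambda>x. case x of
         Gen_a \<Rightarrow> mono_mat D D 1 (\<lambda>_. 1)
       | Gen_b \<Rightarrow> mono_mat D D 0 (\<lambda>j. q powi (r + int j))
       | Gen_c \<Rightarrow> mono_mat D D 0 (\<lambda>j. q powi (int j + 1 - r - int l))
       | Gen_d \<Rightarrow> mono_mat D D (-1) (\<lambda>j. alpha q j l))\<rparr>"

lemma hw_module_simps [simp]:
  "mdim (hw_module D l r) = D"
  "action (hw_module D l r) Gen_a = mono_mat D D 1 (\<lambda>_. 1)"
  "action (hw_module D l r) Gen_b = mono_mat D D 0 (\<lambda>j. q powi (r + int j))"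
  "action (hw_module D l r) Gen_c = mono_mat D D 0 (\<lambda>j. q powi (int j + 1 - r - int l))"
  "action (hw_module D l r) Gen_d = mono_mat D D (-1) (\<lambda>j. alpha q j l)"
  by (simp_all add: hw_module_def)

lemma simple_module_eq: "simple_module q l r = hw_module l l r"
  by (rule hmod_eqI) (auto simp: simple_module_def mono_mat_def intro!: cong_mat)

lemma mod_shape_hw [simp]: "mod_shape (hw_module D l r)"
  unfolding mod_shape_def all_gen by (auto intro!: carrier_matI)

lemma mod_shape_simple [simp]: "mod_shape (simple_module q l r)"
  by (simp add: simple_module_eq)

text \<open>With the dimension \<open>D\<close> separated from the label \<open>l\<close>, the label
  matters only modulo \<open>n\<close>; in particular the Verma modules labelled
  \<open>n + 1\<close> and 1 are equal.\<close>

lemma hw_module_cong: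
  assumes "int n dvd int l - int l'" "int n dvd r - r'"
  shows "hw_module D l r = hw_module D l' r'"
proof (rule hmod_eqI)
  show "action (hw_module D l r) Gen_c = action (hw_module D l' r') Gen_c"
    unfolding hw_module_simps
  proof (rule mono_mat_eqI)
    fix j
    have "int n dvd - (r - r') - (int l - int l')" using assms by (metis dvd_diff dvd_minus_iff)
    thus "q powi (int j + 1 - r - int l) = q powi (int j + 1 - r' - int l')"
      by (intro q_powi_cong) (simp add: algebra_simps)
  qed simp
next
  show "action (hw_module D l r) Gen_b = action (hw_module D l' r') Gen_b"
    unfolding hw_module_simps using assms(2) by (intro mono_mat_eqI q_powi_cong) auto
  show "action (hw_module D l r) Gen_d = action (hw_module D l' r') Gen_d"
    unfolding hw_module_simps alpha_cong[OF assms(1)] ..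
qed simp_all

text \<open>Truncation after \<open>D\<close> vectors is felt by \<open>da - qad = 1 - bc\<close> on
  the last vector, where \<open>a\<close> gives zero while \<open>alpha_rec\<close> predicts
  \<alpha> at \<open>D\<close>; hence that coefficient must vanish. The bound
  \<open>D \<le> n\<close> yields \<open>a^n = 0 = d^n\<close>.\<close>

lemma is_module_hw:
  assumes "D \<le> n" "alpha q D l = 0"
  shows "is_module n q (hw_module D l r)"
proof -
  let ?a = "mono_mat D D 1 (\<lambda>_. 1 :: 'k)" and ?b = "mono_mat D D 0 (\<lambda>j. q powi (r + int j))"
  let ?c = "mono_mat D D 0 (\<lambda>j. q powi (int j + 1 - r - int l))" and ?d = "mono_mat D D (-1) (\<lambda>j. alpha q j l)"
  have n: "mono_mat D D s f ^\<^sub>m n = 0\<^sub>m D D" if "\<bar>s\<bar> = 1" for s and f :: "nat \<Rightarrow> 'k"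
  proof -
    obtain g where "mono_mat D D s f ^\<^sub>m n = mono_mat D D (int n * s) g" using mono_mat_pow by blast
    also have "\<dots> = 0\<^sub>m D D"
      using assms(1) that by (intro mono_mat_zeroI) (auto simp: abs_if split: if_splits)
    finally show ?thesis .
  qed
  have m: "mono_mat D D 0 (\<lambda>j. q powi g j) ^\<^sub>m n = 1\<^sub>m D" for g
    unfolding mono_mat_pow_diag one_eq_mono_mat
    by (rule mono_mat_eqI) (simp_all flip: power_int_of_nat power_int_mult add: mult.commute)
  have 1: "?b * ?a = q \<cdot>\<^sub>m (?a * ?b)" "?c * ?a = q \<cdot>\<^sub>m (?a * ?c)"
    unfolding mono_mat_mult mono_mat_smult
    by (rule mono_mat_eqI; auto simp: nat_add_distrib q_powi_add q_powi_diff power2_eq_square)+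
  have 2: "?d * ?b = q \<cdot>\<^sub>m (?b * ?d)" "?d * ?c = q \<cdot>\<^sub>m (?c * ?d)"
    unfolding mono_mat_mult mono_mat_smult
    by (rule mono_mat_eqI; auto simp: nat_diff_distrib q_powi_add q_powi_diff of_nat_diff power2_eq_square)+
  have 3: "?b * ?c = ?c * ?b"
    unfolding mono_mat_mult by (rule mono_mat_eqI; auto)
  have da: "?d * ?a = mono_mat D D 0 (\<lambda>j. alpha q (Suc j) l)"
    unfolding mono_mat_mult
  proof (rule mono_mat_eqI)
    fix i j assume "i < D" "j < D"
    show "(if 0 \<le> int j + 1 \<and> int j + 1 < int D then alpha q (nat (int j + 1)) l * 1 else 0) = alpha q (Suc j) l"
    proof (cases "Suc j = D")
      case False
      hence "int j + 1 < int D" "nat (int j + 1) = Suc j" using \<open>j < D\<close> by auto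
      thus ?thesis by simp
    qed (use assms(2) in auto)
  qed simp
  have ad: "?a * ?d = mono_mat D D 0 (\<lambda>j. alpha q j l)"
    unfolding mono_mat_mult
  proof (rule mono_mat_eqI)
    fix i j :: nat assume "j < D"
    thus "(if 0 \<le> int j + - 1 \<and> int j + - 1 < int D then 1 * alpha q j l else 0) = alpha q j l"
      by (cases j) auto
  qed simp
  have bc: "?b * ?c = mono_mat D D 0 (\<lambda>j. q powi (2 * int j + 1 - int l))"
    unfolding mono_mat_mult
  proof (rule mono_mat_eqI)
    fix i j :: nat assume "j < D"
    have "r + int j + (int j + 1 - r - int l) = 2 * int j + 1 - int l" by simp
    hence "q powi (r + int j) * q powi (int j + 1 - r - int l) = q powi (2 * int j + 1 - int l)"
      by (simp only: q_powi_add[symmetric])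
    thus "(if 0 \<le> int j + 0 \<and> int j + 0 < int D then q powi (r + int (nat (int j + 0))) *
        q powi (int j + 1 - r - int l) else 0) = q powi (2 * int j + 1 - int l)"
      using \<open>j < D\<close> by simp
  qed simp
  have 4: "?d * ?a - q \<cdot>\<^sub>m (?a * ?d) = 1\<^sub>m D - ?b * ?c"
    unfolding da ad bc mono_mat_smult one_eq_mono_mat mono_mat_diff alpha_rec ..
  show ?thesis
    unfolding is_module_def Let_def hw_module_simps
    using n m 1 2 3 4 mod_shape_hw[of D l r] by (auto simp: mod_shape_def)
qed

lemma is_module_simple: "l \<le> n \<Longrightarrow> is_module n q (simple_module q l r)"
  unfolding simple_module_eq by (rule is_module_hw) auto

text \<open>The q-binomial theorem for \<open>X Y = z Y X\<close>, cut down by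
  \<open>X^2 = 0\<close> to the terms with at most one factor \<open>X\<close>.\<close>

lemma pow_add_skew:
  fixes X Y :: "'k mat"
  assumes car: "X \<in> carrier_mat m m" "Y \<in> carrier_mat m m"
    and X2: "X * X = 0\<^sub>m m m" and XY: "X * Y = z \<cdot>\<^sub>m (Y * X)"
  shows "(X + Y) ^\<^sub>m Suc k = Y ^\<^sub>m Suc k + q_int z (Suc k) \<cdot>\<^sub>m (Y ^\<^sub>m k * X)"
proof (induction k)
  case 0
  show ?case using car by (intro eq_matI) auto
next
  case (Suc k)
  note d = carrier_matD[OF car(1)] carrier_matD[OF car(2)]
  have p [simp]: "dim_row (Y ^\<^sub>m i) = m" "dim_col (Y ^\<^sub>m i) = m" for i
    using d by (auto simp: pow_mat_dim)
  have "(X + Y) ^\<^sub>m Suc (Suc k) = (Y ^\<^sub>m Suc k + q_int z (Suc k) \<cdot>\<^sub>m (Y ^\<^sub>m k * X)) * (X + Y)"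
    using Suc by simp
  also have "\<dots> = Y ^\<^sub>m Suc k * X + Y ^\<^sub>m Suc k * Y + q_int z (Suc k) \<cdot>\<^sub>m (Y ^\<^sub>m k * (X * X) + Y ^\<^sub>m k * (X * Y))"
    using d by (simp add: mat_distrib assoc_mult_mat_dim del: pow_mat.simps)
      (intro eq_matI; simp add: algebra_simps del: index_mult_mat(1) pow_mat.simps)
  also have "Y ^\<^sub>m k * (X * X) + Y ^\<^sub>m k * (X * Y) = z \<cdot>\<^sub>m (Y ^\<^sub>m Suc k * X)"
    unfolding X2 XY using d by (simp add: mat_distrib assoc_mult_mat_dim)
  also have "Y ^\<^sub>m Suc k * X + Y ^\<^sub>m Suc k * Y + q_int z (Suc k) \<cdot>\<^sub>m (z \<cdot>\<^sub>m (Y ^\<^sub>m Suc k * X)) =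
      Y ^\<^sub>m Suc (Suc k) + q_int z (Suc (Suc k)) \<cdot>\<^sub>m (Y ^\<^sub>m Suc k * X)"
    unfolding q_int_Suc'[of z "Suc k"] using d
    by (intro eq_matI) (auto simp: algebra_simps simp del: index_mult_mat(1))
  finally show ?case .
qed

lemma kronecker_pow:
  fixes A B :: "'k mat"
  assumes "dim_row A = dim_col A" "dim_row B = dim_col B"
  shows "kronecker A B ^\<^sub>m k = kronecker (A ^\<^sub>m k) (B ^\<^sub>m k)"
  using assms by (induction k) (auto simp: kronecker_mult pow_mat_dim)

lemma one_pow_mat [simp]: "(1\<^sub>m m :: 'k mat) ^\<^sub>m k = 1\<^sub>m m"
  by (induction k) auto

text \<open>In \<open>a \<otimes> b + 1 \<otimes> a\<close> the first summand squares to zero, so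
  the only mixed term of the \<open>n\<close>-th power carries the coefficient
  \<open>(n)_q = 0\<close>. For \<open>d\<close> the commutation scalar is the inverse of
  \<open>q\<close>, again a root of unity with vanishing q-integer at \<open>n\<close>.\<close>

lemma is_module_tensor_nilpotent:
  assumes V: "is_module n q V" and M: "is_module n q M"
    and a2: "action V Gen_a * action V Gen_a = 0\<^sub>m (mdim V) (mdim V)"
    and d2: "action V Gen_d * action V Gen_d = 0\<^sub>m (mdim V) (mdim V)"
  shows "is_module n q (V \<otimes>\<^sub>H M)"
proof -
  note sV = is_module_shape[OF V] and sM = is_module_shape[OF M]
  define a b c d where "a = action V Gen_a" "b = action V Gen_b" "c = action V Gen_c" "d = action V Gen_d"
  define a' b' c' d' where "a' = action M Gen_a" "b' = action M Gen_b" "c' = action M Gen_c" "d' = action M Gen_d"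
  note defs = a_b_c_d_def a'_b'_c'_d'_def
  let ?l = "mdim V" and ?m = "mdim M"
  have dim [simp]: "dim_row a = ?l" "dim_col a = ?l" "dim_row b = ?l" "dim_col b = ?l"
    "dim_row c = ?l" "dim_col c = ?l" "dim_row d = ?l" "dim_col d = ?l"
    "dim_row a' = ?m" "dim_col a' = ?m" "dim_row b' = ?m" "dim_col b' = ?m"
    "dim_row c' = ?m" "dim_col c' = ?m" "dim_row d' = ?m" "dim_col d' = ?m"
    using sV sM by (simp_all add: defs)
  have RV: "b * a = q \<cdot>\<^sub>m (a * b)" "d * b = q \<cdot>\<^sub>m (b * d)" "c * a = q \<cdot>\<^sub>m (a * c)" "d * c = q \<cdot>\<^sub>m (c * d)"
      "b * c = c * b" "b ^\<^sub>m n = 1\<^sub>m ?l" "c ^\<^sub>m n = 1\<^sub>m ?l" "d * a - q \<cdot>\<^sub>m (a * d) = 1\<^sub>m ?l - b * c"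
    using V unfolding is_module_def Let_def defs by auto
  have RM: "b' * a' = q \<cdot>\<^sub>m (a' * b')" "d' * b' = q \<cdot>\<^sub>m (b' * d')" "c' * a' = q \<cdot>\<^sub>m (a' * c')" "d' * c' = q \<cdot>\<^sub>m (c' * d')"
      "b' * c' = c' * b'" "a' ^\<^sub>m n = 0\<^sub>m ?m ?m" "b' ^\<^sub>m n = 1\<^sub>m ?m" "c' ^\<^sub>m n = 1\<^sub>m ?m" "d' ^\<^sub>m n = 0\<^sub>m ?m ?m"
      "d' * a' - q \<cdot>\<^sub>m (a' * d') = 1\<^sub>m ?m - b' * c'"
    using M unfolding is_module_def Let_def defs by auto
  let ?a = "kronecker a b' + kronecker (1\<^sub>m ?l) a'" and ?b = "kronecker b b'" and ?c = "kronecker c c'"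
    and ?d = "kronecker d c' + kronecker (1\<^sub>m ?l) d'"
  have aa: "a * a = 0\<^sub>m ?l ?l" and dd: "d * d = 0\<^sub>m ?l ?l" using a2 d2 by (simp_all add: defs)
  let ?N = "?l * ?m"
  have nn: "n = Suc (n - 1)" using n_gt_2 by simp
  have A: "?a ^\<^sub>m n = 0\<^sub>m ?N ?N"
  proof -
    have "?a ^\<^sub>m n = kronecker (1\<^sub>m ?l) a' ^\<^sub>m n +
        q_int q n \<cdot>\<^sub>m (kronecker (1\<^sub>m ?l) a' ^\<^sub>m (n - 1) * kronecker a b')"
      by (subst (1 2 3) nn, rule pow_add_skew)
        (use aa RM in \<open>auto intro!: carrier_matI simp: kronecker_mult kronecker_smult\<close>)
    thus ?thesis using RM by (intro eq_matI) (auto simp: kronecker_pow pow_mat_dim)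
  qed
  have cd: "c' * d' = inverse q \<cdot>\<^sub>m (d' * c')" unfolding RM by (intro eq_matI) auto
  have D: "?d ^\<^sub>m n = 0\<^sub>m ?N ?N"
  proof -
    have "?d ^\<^sub>m n = kronecker (1\<^sub>m ?l) d' ^\<^sub>m n +
        q_int (inverse q) n \<cdot>\<^sub>m (kronecker (1\<^sub>m ?l) d' ^\<^sub>m (n - 1) * kronecker d c')"
      by (subst (1 2 3) nn, rule pow_add_skew)
        (use dd cd in \<open>auto intro!: carrier_matI simp: kronecker_mult kronecker_smult\<close>)
    thus ?thesis using RM by (intro eq_matI) (auto simp: kronecker_pow pow_mat_dim)
  qed
  have B: "?b ^\<^sub>m n = 1\<^sub>m ?N" "?c ^\<^sub>m n = 1\<^sub>m ?N"
    using RV RM by (auto simp: kronecker_pow)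
  have C: "?b * ?c = ?c * ?b" using RV RM by (simp add: kronecker_mult)
  have sm: "k \<cdot>\<^sub>m (S + T) = k \<cdot>\<^sub>m S + k \<cdot>\<^sub>m T" if "dim_row S = dim_row T" "dim_col S = dim_col T"
    for k and S T :: "'k mat" using that by (intro eq_matI) (auto simp: algebra_simps)
  have 1: "?b * ?a = q \<cdot>\<^sub>m (?a * ?b)" "?c * ?a = q \<cdot>\<^sub>m (?a * ?c)"
    "?d * ?b = q \<cdot>\<^sub>m (?b * ?d)" "?d * ?c = q \<cdot>\<^sub>m (?c * ?d)"
    using RV RM by (simp_all add: mat_distrib kronecker_mult kronecker_smult sm)
  have da: "d * a = q \<cdot>\<^sub>m (a * d) + (1\<^sub>m ?l - b * c)"
    using RV(8)[symmetric] by (intro eq_matI) auto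
  have da': "d' * a' = q \<cdot>\<^sub>m (a' * d') + (1\<^sub>m ?m - b' * c')"
    using RM(10)[symmetric] by (intro eq_matI) auto
  have km: "kronecker (S - T) U = kronecker S U - kronecker T U"
     "kronecker U (S - T) = kronecker U S - kronecker U T"
    if "dim_row S = dim_row T" "dim_col S = dim_col T" for S T U :: "'k mat"
    using that by (auto intro!: eq_matI simp: index_kronecker div_less_of_less_mult mod_less_of_less_mult left_diff_distrib right_diff_distrib)
  \<comment> \<open>The mixed terms cancel by \<open>ca = qac\<close> and \<open>db = qbd\<close> on
    the right factor, and the rest telescopes: \<open>(1 - bc) \<otimes> bc + 1 \<otimes> (1 - bc) =
    1 - bc \<otimes> bc\<close>.\<close>
  have 2: "?d * ?a - q \<cdot>\<^sub>m (?a * ?d) = 1\<^sub>m ?N - ?b * ?c"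
  proof -
    have "?d * ?a = kronecker (d * a) (b' * c') + kronecker d (c' * a') + kronecker a (d' * b') + kronecker (1\<^sub>m ?l) (d' * a')"
      using RM(5) by (simp add: mat_distrib kronecker_mult) (intro eq_matI; auto simp: algebra_simps)
    also have "\<dots> = q \<cdot>\<^sub>m kronecker (a * d) (b' * c') + (kronecker (1\<^sub>m ?l) (b' * c') - kronecker (b * c) (b' * c'))
      + q \<cdot>\<^sub>m kronecker d (a' * c') + q \<cdot>\<^sub>m kronecker a (b' * d')
      + (q \<cdot>\<^sub>m kronecker (1\<^sub>m ?l) (a' * d') + (1\<^sub>m ?N - kronecker (1\<^sub>m ?l) (b' * c')))"
      unfolding da da' RM(2,3) by (simp add: kronecker_add kronecker_smult km)
    moreover have "?a * ?d = kronecker (a * d) (b' * c') + kronecker a (b' * d') + kronecker d (a' * c') + kronecker (1\<^sub>m ?l) (a' * d')"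
      by (simp add: mat_distrib kronecker_mult) (intro eq_matI; auto simp: algebra_simps)
    ultimately show ?thesis
      by (intro eq_matI) (auto simp: kronecker_mult algebra_simps)
  qed
  show ?thesis
    unfolding is_module_def Let_def
    using mod_shape_tensor[OF sV sM] A B C D 1 2
    by (auto simp: mod_shape_def action_tensor simp flip: defs)
qed

end

section \<open>Maps into and out of tensor products with two-dimensional modules\<close>

lemma kronecker_col_mult:
  fixes Z :: "'k::field mat"
  assumes "dim_col e = Suc 0" "dim_col F = dim_row Z"
  shows "kronecker e F * Z = kronecker e (F * Z)"
  using kronecker_mult[of e "1\<^sub>m (Suc 0)" F Z] assms by simp

lemma kronecker_row_mult:
  fixes Z :: "'k::field mat"
  assumes "dim_row e = Suc 0" "dim_row F = dim_col Z"
  shows "Z * kronecker e F = kronecker e (Z * F)"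
  using kronecker_mult[of "1\<^sub>m (Suc 0)" e Z F] assms by simp

text \<open>The basis columns of \<open>k^2\<close> and the dual rows. A Kronecker product with
  \<open>ecol i\<close> places a matrix into block row \<open>i\<close>, one with
  \<open>erow i\<close> into block column \<open>i\<close>.\<close>

definition ecol :: "nat \<Rightarrow> 'k::field mat" where "ecol i = mono_mat 2 (Suc 0) (int i) (\<lambda>_. 1)"
definition erow :: "nat \<Rightarrow> 'k::field mat" where "erow i = mono_mat (Suc 0) 2 (- int i) (\<lambda>_. 1)"

lemma ecol_dim [simp]: "dim_row (ecol i) = 2" "dim_col (ecol i) = Suc 0"
  and erow_dim [simp]: "dim_row (erow i) = Suc 0" "dim_col (erow i) = 2"
  by (simp_all add: ecol_def erow_def)

lemma erow_ecol [simp]: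
  "erow 0 * ecol 0 = 1\<^sub>m (Suc 0)" "erow (Suc 0) * ecol (Suc 0) = 1\<^sub>m (Suc 0)"
  "erow 0 * ecol (Suc 0) = 0\<^sub>m (Suc 0) (Suc 0)" "erow (Suc 0) * ecol 0 = 0\<^sub>m (Suc 0) (Suc 0)"
  unfolding ecol_def erow_def mono_mat_mult one_eq_mono_mat
  by (rule mono_mat_eqI mono_mat_zeroI; simp)+

lemma ecol_erow_sum: "ecol 0 * erow 0 + ecol (Suc 0) * erow (Suc 0) = 1\<^sub>m 2"
  unfolding ecol_def erow_def mono_mat_mult one_eq_mono_mat
  by (simp add: mono_mat_add, rule mono_mat_eqI) auto

context root_of_unity
begin

abbreviation V2 :: "int \<Rightarrow> 'k hmod" where "V2 p \<equiv> hw_module 2 2 p"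

lemma V2_ecol:
  "action (V2 p) Gen_a * ecol 0 = ecol (Suc 0)" "action (V2 p) Gen_a * ecol (Suc 0) = 0\<^sub>m 2 (Suc 0)"
  "action (V2 p) Gen_b * ecol 0 = q powi p \<cdot>\<^sub>m ecol 0"
  "action (V2 p) Gen_b * ecol (Suc 0) = q powi (p + 1) \<cdot>\<^sub>m ecol (Suc 0)"
  "action (V2 p) Gen_c * ecol 0 = q powi (- 1 - p) \<cdot>\<^sub>m ecol 0"
  "action (V2 p) Gen_c * ecol (Suc 0) = q powi (- p) \<cdot>\<^sub>m ecol (Suc 0)"
  "action (V2 p) Gen_d * ecol 0 = 0\<^sub>m 2 (Suc 0)"
  "action (V2 p) Gen_d * ecol (Suc 0) = alpha q 1 2 \<cdot>\<^sub>m ecol 0"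
  unfolding ecol_def hw_module_simps mono_mat_mult mono_mat_smult
  by (intro eq_matI; auto simp: index_mono_mat less_2_cases_iff algebra_simps)+

lemma V2_erow:
  "erow 0 * action (V2 p) Gen_a = 0\<^sub>m (Suc 0) 2" "erow (Suc 0) * action (V2 p) Gen_a = erow 0"
  "erow 0 * action (V2 p) Gen_b = q powi p \<cdot>\<^sub>m erow 0"
  "erow (Suc 0) * action (V2 p) Gen_b = q powi (p + 1) \<cdot>\<^sub>m erow (Suc 0)"
  "erow 0 * action (V2 p) Gen_c = q powi (- 1 - p) \<cdot>\<^sub>m erow 0"
  "erow (Suc 0) * action (V2 p) Gen_c = q powi (- p) \<cdot>\<^sub>m erow (Suc 0)"
  "erow 0 * action (V2 p) Gen_d = alpha q 1 2 \<cdot>\<^sub>m erow (Suc 0)"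
  "erow (Suc 0) * action (V2 p) Gen_d = 0\<^sub>m (Suc 0) 2"
  unfolding erow_def hw_module_simps mono_mat_mult mono_mat_smult
  by (intro eq_matI; auto simp: index_mono_mat less_2_cases_iff algebra_simps)+

lemma alpha_1_2: "alpha q 1 2 = 1 - inverse q"
  by (simp add: alpha_def)

lemma smult_smult_mat: "k \<cdot>\<^sub>m (l \<cdot>\<^sub>m (A :: 'k mat)) = (k * l) \<cdot>\<^sub>m A"
  by (intro eq_matI) auto

text \<open>The intertwining equations of the block column \<open>(F, G)\<close>, read off the
  comultiplication: \<open>a\<close> moves block 0 to block 1 and acts by \<open>b\<close> on
  \<open>M\<close>, while \<open>d\<close> moves block 1 back with coefficient
  \<open>alpha q 1 2\<close> and acts by \<open>c\<close> on \<open>M\<close>.\<close>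

lemma kronecker_hom_into_V2:
  assumes sh: "mod_shape A" "mod_shape M"
    and F: "F \<in> carrier_mat (mdim M) (mdim A)" and G: "G \<in> carrier_mat (mdim M) (mdim A)"
    and a: "F * action A Gen_a = action M Gen_a * F"
      "G * action A Gen_a = action M Gen_b * F + action M Gen_a * G"
    and b: "F * action A Gen_b = q powi p \<cdot>\<^sub>m (action M Gen_b * F)"
      "G * action A Gen_b = q powi (p + 1) \<cdot>\<^sub>m (action M Gen_b * G)"
    and c: "F * action A Gen_c = q powi (- 1 - p) \<cdot>\<^sub>m (action M Gen_c * F)"
      "G * action A Gen_c = q powi (- p) \<cdot>\<^sub>m (action M Gen_c * G)"
    and d: "F * action A Gen_d = alpha q 1 2 \<cdot>\<^sub>m (action M Gen_c * G) + action M Gen_d * F"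
      "G * action A Gen_d = action M Gen_d * G"
  shows "kronecker (ecol 0) F + kronecker (ecol (Suc 0)) G \<in> module_hom A (V2 p \<otimes>\<^sub>H M)"
    (is "?f \<in> _")
proof (rule homI)
  have dim [simp]: "dim_row F = mdim M" "dim_row G = mdim M" "dim_col F = mdim A" "dim_col G = mdim A"
    using F G by auto
  have V: "dim_row (action (V2 p) x) = 2" "dim_col (action (V2 p) x) = 2" for x
    using mod_shape_dim[OF mod_shape_hw, of 2 2 p x] by auto
  fix x
  have ac: "A + B + (C + D) = A + (B + (C + D))" "A + (B + C) = A + B + C"
    if "dim_row A = dim_row D" "dim_row B = dim_row D" "dim_row C = dim_row D"
      "dim_col A = dim_col D" "dim_col B = dim_col D" "dim_col C = dim_col D" for A B C D :: "'k mat"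
    using that by (intro eq_matI; auto simp: algebra_simps)+
  show "?f * action A x = action (V2 p \<otimes>\<^sub>H M) x * ?f"
    apply (cases x)
    apply (use sh a b c d in \<open>simp_all add: action_tensor mat_distrib kronecker_mult kronecker_col_mult V
      V2_ecol kronecker_add kronecker_smult V2_ecol[simplified] del: hw_module_simps(2-5)\<close>)
    apply (intro eq_matI; auto simp: algebra_simps simp del: index_mult_mat(1))+
    done
qed (use F G in auto)

lemma kronecker_hom_from_V2:
  assumes sh: "mod_shape C" "mod_shape M"
    and F: "F \<in> carrier_mat (mdim C) (mdim M)" and G: "G \<in> carrier_mat (mdim C) (mdim M)"
    and a: "action C Gen_a * F = F * action M Gen_a + G * action M Gen_b"
      "action C Gen_a * G = G * action M Gen_a"
    and b: "action C Gen_b * F = q powi p \<cdot>\<^sub>m (F * action M Gen_b)"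
      "action C Gen_b * G = q powi (p + 1) \<cdot>\<^sub>m (G * action M Gen_b)"
    and c: "action C Gen_c * F = q powi (- 1 - p) \<cdot>\<^sub>m (F * action M Gen_c)"
      "action C Gen_c * G = q powi (- p) \<cdot>\<^sub>m (G * action M Gen_c)"
    and d: "action C Gen_d * F = F * action M Gen_d"
      "action C Gen_d * G = alpha q 1 2 \<cdot>\<^sub>m (F * action M Gen_c) + G * action M Gen_d"
  shows "kronecker (erow 0) F + kronecker (erow (Suc 0)) G \<in> module_hom (V2 p \<otimes>\<^sub>H M) C"
    (is "?f \<in> _")
proof (rule homI)
  have dim [simp]: "dim_col F = mdim M" "dim_col G = mdim M" "dim_row F = mdim C" "dim_row G = mdim C"
    using F G by auto
  have V: "dim_row (action (V2 p) x) = 2" "dim_col (action (V2 p) x) = 2" for x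
    using mod_shape_dim[OF mod_shape_hw, of 2 2 p x] by auto
  fix x
  show "?f * action (V2 p \<otimes>\<^sub>H M) x = action C x * ?f"
    apply (cases x)
    apply (use sh a b c d in \<open>simp_all add: action_tensor mat_distrib kronecker_mult kronecker_row_mult V
      V2_erow kronecker_add kronecker_smult V2_erow[simplified] del: hw_module_simps(2-5)\<close>)
    apply (intro eq_matI; auto simp: algebra_simps simp del: index_mult_mat(1))+
    done
qed (use F G in auto)

lemma q_powi_simp: "q powi x * q powi y = q powi (x + y)"
  by (simp add: q_powi_add)

text \<open>The difference between neighbouring labels is the term that \<open>d \<otimes> c\<close>
  adds to \<open>1 \<otimes> d\<close> on a tensor product with a two-dimensional module.\<close>

lemma alpha_shift: "alpha q k (Suc l) = (1 - inverse q) * (q powi (int k - int l) * q_int q k) + alpha q k l"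
proof -
  have "int k - int (Suc l) = (int k - int l) + (- 1)" by simp
  hence "q powi (int k - int (Suc l)) = q powi (int k - int l) * inverse q"
    by (simp only: q_powi_add) (simp add: power_int_minus)
  thus ?thesis by (simp add: alpha_def algebra_simps)
qed

text \<open>The submodule is generated by the tensor product of the highest weight vectors.\<close>

lemma split_exact_V2_tensor:
  assumes D: "(0 < l \<and> l < n \<and> D1 = l + 1 \<and> D2 = l - 1) \<or> (l = n \<and> D1 = n \<and> D2 = n)"
  shows "split_exact (hw_module D1 (l + 1) (r + p)) (V2 p \<otimes>\<^sub>H hw_module l l r) (hw_module D2 (l - 1) (r + p + 1))"
proof -
  let ?A = "hw_module D1 (l + 1) (r + p)" and ?M = "hw_module l l r" and ?C = "hw_module D2 (l - 1) (r + p + 1)"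
  \<comment> \<open>With \<open>v_i\<close>, \<open>w_k\<close> the bases of the two factors counted
    from 0, induction gives \<open>a^k (v_0 \<otimes> w_0) = v_0 \<otimes> w_k + (k)_q q^r v_1
    \<otimes> w_(k-1)\<close>. For \<open>l < n\<close> this reaches one step beyond
    \<open>l\<close>, since \<open>(l)_q\<close> is nonzero; for \<open>l = n\<close> it stops at
    \<open>n\<close>, since \<open>(n)_q = 0\<close>.\<close>
  define F1 F2 where "F1 = mono_mat l D1 0 (\<lambda>_. 1 :: 'k)" "F2 = mono_mat l D1 (-1) (\<lambda>k. q_int q k * q powi r)"
  \<comment> \<open>The quotient map sends \<open>v_1 \<otimes> w_k\<close> to the
    \<open>k\<close>-th basis vector; its values on \<open>v_0 \<otimes> w_k\<close> are then forced
    by the vanishing on the image of \<open>F1\<close>, \<open>F2\<close>.\<close>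
  define G1 G2 where "G1 = mono_mat D2 l (-1) (\<lambda>k. - (q_int q k * q powi r))" "G2 = mono_mat D2 l 0 (\<lambda>_. 1 :: 'k)"
  \<comment> \<open>\<open>L1\<close> reads off the \<open>v_0\<close> coordinate. For
    \<open>l < n\<close> the last vector of the submodule has none and is recovered from
    \<open>v_1 \<otimes> w_(l-1)\<close> by division; for \<open>l = n\<close> that entry falls
    outside the \<open>D1\<close> rows.\<close>
  define L1 L2 where "L1 = mono_mat D1 l 0 (\<lambda>_. 1 :: 'k)"
    "L2 = mono_mat D1 l 1 (\<lambda>k. if Suc k = l then inverse (q_int q l * q powi r) else 0)"
  define R2 where "R2 = mono_mat l D2 0 (\<lambda>_. 1 :: 'k)"
  have lp: "0 < l" "l \<le> n" using D n_gt_2 by auto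
  have ln: "q_int q l \<noteq> 0" if "D1 = Suc l" using that D q_int_nonzero[of l] by auto
  have i: "kronecker (ecol 0) F1 + kronecker (ecol (Suc 0)) F2 \<in> module_hom ?A (V2 p \<otimes>\<^sub>H ?M)"
  proof (rule kronecker_hom_into_V2)
    show "F1 * action ?A Gen_a = action ?M Gen_a * F1"
      unfolding F1_F2_def hw_module_simps mono_mat_mult using D by (intro mono_mat_eqI) auto
    show "F1 * action ?A Gen_b = q powi p \<cdot>\<^sub>m (action ?M Gen_b * F1)"
      unfolding F1_F2_def hw_module_simps mono_mat_mult mono_mat_smult
      using D by (intro mono_mat_eqI) (auto simp: q_powi_simp algebra_simps)
    show "F2 * action ?A Gen_b = q powi (p + 1) \<cdot>\<^sub>m (action ?M Gen_b * F2)"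
      unfolding F1_F2_def hw_module_simps mono_mat_mult mono_mat_smult
      using D by (intro mono_mat_eqI) (auto simp: q_powi_simp algebra_simps)
    show "F1 * action ?A Gen_c = q powi (- 1 - p) \<cdot>\<^sub>m (action ?M Gen_c * F1)"
      unfolding F1_F2_def hw_module_simps mono_mat_mult mono_mat_smult
      using D by (intro mono_mat_eqI) (auto simp: q_powi_simp algebra_simps)
    show "F2 * action ?A Gen_c = q powi (- p) \<cdot>\<^sub>m (action ?M Gen_c * F2)"
      unfolding F1_F2_def hw_module_simps mono_mat_mult mono_mat_smult
      using D by (intro mono_mat_eqI) (auto simp: q_powi_simp algebra_simps)
    have bF: "action ?M Gen_b * F1 = mono_mat l D1 0 (\<lambda>k. if k < l then q powi (r + int k) else 0)"
      unfolding F1_F2_def hw_module_simps mono_mat_mult by (rule mono_mat_eqI) auto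
    have aF: "action ?M Gen_a * F2 = mono_mat l D1 0 (\<lambda>k. q_int q k * q powi r)"
      unfolding F1_F2_def hw_module_simps mono_mat_mult
    proof (rule mono_mat_eqI)
      fix i k :: nat assume "i < l" "k < D1" "int i = int k + (1 + - 1)"
      thus "(if 0 \<le> int k + - 1 \<and> int k + - 1 < int l then 1 * (q_int q k * q powi r) else 0) = q_int q k * q powi r"
        by (cases k) auto
    qed simp
    have Fa: "F2 * action ?A Gen_a = mono_mat l D1 0 (\<lambda>k. q_int q (Suc k) * q powi r)"
      unfolding F1_F2_def hw_module_simps mono_mat_mult
    proof (rule mono_mat_eqI)
      fix i k :: nat assume ik: "i < l" "k < D1" "int i = int k + (- 1 + 1)"
      show "(if 0 \<le> int k + 1 \<and> int k + 1 < int D1 then q_int q (nat (int k + 1)) * q powi r * 1 else 0)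
          = q_int q (Suc k) * q powi r"
      \<comment> \<open>As the row index \<open>k\<close> is below \<open>l\<close>, the last column
        of the submodule is met here only when \<open>l = n\<close>, and there
        \<open>(n)_q = 0\<close> agrees with the truncation.\<close>
      proof (cases "Suc k = D1")
        case True
        hence "Suc k = n" using D ik by auto
        hence "q_int q (Suc k) = 0" by simp
        thus ?thesis using True by simp
      next
        case False
        hence "int k + 1 < int D1" "nat (int k + 1) = Suc k" using ik by auto
        thus ?thesis by simp
      qed
    qed simp
    show "F2 * action ?A Gen_a = action ?M Gen_b * F1 + action ?M Gen_a * F2"
      unfolding Fa bF aF mono_mat_add
      by (rule mono_mat_eqI) (auto simp: q_int_Suc q_powi_add distrib_right power_int_of_nat)
    have Fd: "F1 * action ?A Gen_d = mono_mat l D1 (-1) (\<lambda>k. alpha q k (l + 1))"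
      unfolding F1_F2_def hw_module_simps mono_mat_mult using D by (intro mono_mat_eqI) auto
    have cF: "action ?M Gen_c * F2 = mono_mat l D1 (-1) (\<lambda>k. q powi (int k - int l) * q_int q k)"
      unfolding F1_F2_def hw_module_simps mono_mat_mult
    proof (rule mono_mat_eqI)
      fix i k :: nat assume ik: "i < l" "int i = int k + (0 + - 1)"
      hence "int (nat (int k + - 1)) = int k - 1" by auto
      moreover have "q powi (int k - 1 + 1 - r - int l) * q powi r = q powi (int k - int l)"
        by (simp add: q_powi_simp)
      ultimately show "(if 0 \<le> int k + - 1 \<and> int k + - 1 < int l then q powi (int (nat (int k + - 1)) + 1 - r - int l) *
          (q_int q k * q powi r) else 0) = q powi (int k - int l) * q_int q k"
        using ik by (simp add: mult_ac)
    qed simp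
    have dF: "action ?M Gen_d * F1 = mono_mat l D1 (-1) (\<lambda>k. alpha q k l)"
      unfolding F1_F2_def hw_module_simps mono_mat_mult
    proof (rule mono_mat_eqI)
      fix i k :: nat assume "i < l" "int i = int k + (- 1 + 0)"
      thus "(if 0 \<le> int k + 0 \<and> int k + 0 < int l then alpha q (nat (int k + 0)) l * 1 else 0) = alpha q k l"
        by (cases "k = l") auto
    qed simp
    show "F1 * action ?A Gen_d = alpha q 1 2 \<cdot>\<^sub>m (action ?M Gen_c * F2) + action ?M Gen_d * F1"
      unfolding Fd cF dF mono_mat_add mono_mat_smult alpha_1_2
      by (rule mono_mat_eqI) (auto simp: alpha_shift)
    have dF2: "action ?M Gen_d * F2 = mono_mat l D1 (-2) (\<lambda>k. alpha q (k - 1) l * (q_int q k * q powi r))"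
      unfolding F1_F2_def hw_module_simps mono_mat_mult
      using D by (intro mono_mat_eqI) (auto simp: nat_diff_distrib)
    have F2d: "F2 * action ?A Gen_d = mono_mat l D1 (-2) (\<lambda>k. q_int q (k - 1) * q powi r * alpha q k (l + 1))"
      unfolding F1_F2_def hw_module_simps mono_mat_mult
      using D by (intro mono_mat_eqI) (auto simp: nat_diff_distrib)
    show "F2 * action ?A Gen_d = action ?M Gen_d * F2"
      unfolding F2d dF2
      by (rule mono_mat_eqI) (auto simp: alpha_def algebra_simps of_nat_diff)
  qed (auto simp: F1_F2_def)
  have p: "kronecker (erow 0) G1 + kronecker (erow (Suc 0)) G2 \<in> module_hom (V2 p \<otimes>\<^sub>H ?M) ?C"
  proof (rule kronecker_hom_from_V2)
    show "action ?C Gen_a * G2 = G2 * action ?M Gen_a"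
      unfolding G1_G2_def hw_module_simps mono_mat_mult using D by (intro mono_mat_eqI) auto
    have lC: "int (l - 1) = int l - 1" using lp by simp
    show "action ?C Gen_b * G1 = q powi p \<cdot>\<^sub>m (G1 * action ?M Gen_b)"
      unfolding G1_G2_def hw_module_simps mono_mat_mult mono_mat_smult
      using D by (intro mono_mat_eqI) (auto simp: q_powi_simp nat_diff_distrib algebra_simps)
    show "action ?C Gen_b * G2 = q powi (p + 1) \<cdot>\<^sub>m (G2 * action ?M Gen_b)"
      unfolding G1_G2_def hw_module_simps mono_mat_mult mono_mat_smult
      using D by (intro mono_mat_eqI) (auto simp: q_powi_simp algebra_simps)
    show "action ?C Gen_c * G1 = q powi (- 1 - p) \<cdot>\<^sub>m (G1 * action ?M Gen_c)"
      unfolding G1_G2_def hw_module_simps mono_mat_mult mono_mat_smult lC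
      using D by (intro mono_mat_eqI) (auto simp: q_powi_simp nat_diff_distrib algebra_simps)
    show "action ?C Gen_c * G2 = q powi (- p) \<cdot>\<^sub>m (G2 * action ?M Gen_c)"
      unfolding G1_G2_def hw_module_simps mono_mat_mult mono_mat_smult lC
      using D by (intro mono_mat_eqI) (auto simp: q_powi_simp algebra_simps)
    have aG: "action ?C Gen_a * G1 = mono_mat D2 l 0 (\<lambda>k. - (q_int q k * q powi r))"
      unfolding G1_G2_def hw_module_simps mono_mat_mult
    proof (rule mono_mat_eqI)
      fix i k :: nat assume "i < D2" "int i = int k + (1 + - 1)"
      thus "(if 0 \<le> int k + - 1 \<and> int k + - 1 < int D2 then 1 * - (q_int q k * q powi r) else 0) = - (q_int q k * q powi r)"
        by (cases k) auto
    qed simp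
    have Ga: "G1 * action ?M Gen_a = mono_mat D2 l 0 (\<lambda>k. - (q_int q (Suc k) * q powi r))"
      unfolding G1_G2_def hw_module_simps mono_mat_mult
    proof (rule mono_mat_eqI)
      fix i k :: nat assume ik: "i < D2" "k < l" "int i = int k + (- 1 + 1)"
      show "(if 0 \<le> int k + 1 \<and> int k + 1 < int l then - (q_int q (nat (int k + 1)) * q powi r) * 1 else 0)
          = - (q_int q (Suc k) * q powi r)"
      proof (cases "Suc k = l")
        case True
        hence "Suc k = n" using D ik by auto
        hence "q_int q (Suc k) = 0" by simp
        thus ?thesis using True by simp
      next
        case False
        hence "int k + 1 < int l" "nat (int k + 1) = Suc k" using ik by auto
        thus ?thesis by simp
      qed
    qed simp
    have Gb: "G2 * action ?M Gen_b = mono_mat D2 l 0 (\<lambda>k. q powi (r + int k))"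
      unfolding G1_G2_def hw_module_simps mono_mat_mult by (rule mono_mat_eqI) auto
    show "action ?C Gen_a * G1 = G1 * action ?M Gen_a + G2 * action ?M Gen_b"
      unfolding aG Ga Gb mono_mat_add
      by (rule mono_mat_eqI) (auto simp: q_int_Suc q_powi_add distrib_right power_int_of_nat)
    have Gd: "G1 * action ?M Gen_d = mono_mat D2 l (-2) (\<lambda>k. - (q_int q (k - 1) * q powi r * alpha q k l))"
      unfolding G1_G2_def hw_module_simps mono_mat_mult
      using D by (intro mono_mat_eqI) (auto simp: nat_diff_distrib)
    have dG: "action ?C Gen_d * G1 = mono_mat D2 l (-2) (\<lambda>k. - (alpha q (k - 1) (l - 1) * (q_int q k * q powi r)))"
      unfolding G1_G2_def hw_module_simps mono_mat_mult
      using D by (intro mono_mat_eqI) (auto simp: nat_diff_distrib)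
    show "action ?C Gen_d * G1 = G1 * action ?M Gen_d"
      unfolding Gd dG by (rule mono_mat_eqI) (auto simp: alpha_def algebra_simps of_nat_diff)
    have dG2: "action ?C Gen_d * G2 = mono_mat D2 l (-1) (\<lambda>k. alpha q k (l - 1))"
      unfolding G1_G2_def hw_module_simps mono_mat_mult
    proof (rule mono_mat_eqI)
      fix i k :: nat assume "k < l"
      show "(if 0 \<le> int k + 0 \<and> int k + 0 < int D2 then alpha q (nat (int k + 0)) (l - 1) * 1 else 0) = alpha q k (l - 1)"
      \<comment> \<open>The vector missing from the quotient has index \<open>l - 1\<close>, where
        the coefficient for label \<open>l - 1\<close> vanishes.\<close>
      proof (cases "k < D2")
        case False
        hence "k = l - 1" using \<open>k < l\<close> D by auto
        thus ?thesis by simp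
      qed simp
    qed simp
    have Gc: "G1 * action ?M Gen_c = mono_mat D2 l (-1) (\<lambda>k. - (q powi (int k + 1 - int l) * q_int q k))"
      unfolding G1_G2_def hw_module_simps mono_mat_mult
    proof (rule mono_mat_eqI)
      fix i k :: nat assume "k < l"
      moreover have "q powi (int k + 1 - r - int l) * q powi r = q powi (int k + 1 - int l)"
        by (simp add: q_powi_simp algebra_simps)
      ultimately show "(if 0 \<le> int k + 0 \<and> int k + 0 < int l then - (q_int q (nat (int k + 0)) * q powi r) *
         q powi (int k + 1 - r - int l) else 0) = - (q powi (int k + 1 - int l) * q_int q k)"
        by (simp add: mult_ac)
    qed simp
    have G2d: "G2 * action ?M Gen_d = mono_mat D2 l (-1) (\<lambda>k. alpha q k l)"
      unfolding G1_G2_def hw_module_simps mono_mat_mult by (rule mono_mat_eqI) auto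
    show "action ?C Gen_d * G2 = alpha q 1 2 \<cdot>\<^sub>m (G1 * action ?M Gen_c) + G2 * action ?M Gen_d"
      unfolding dG2 Gc G2d mono_mat_add mono_mat_smult alpha_1_2
      using alpha_shift[of _ "l - 1"] lp by (intro mono_mat_eqI) (auto simp: algebra_simps of_nat_diff)
  qed (auto simp: G1_G2_def)
  let ?i = "kronecker (ecol 0) F1 + kronecker (ecol (Suc 0)) F2"
    and ?p = "kronecker (erow 0) G1 + kronecker (erow (Suc 0)) G2"
    and ?L = "kronecker (erow 0) L1 + kronecker (erow (Suc 0)) L2"
    and ?R = "kronecker (ecol (Suc 0)) R2"
  have dim [simp]: "dim_row F1 = l" "dim_col F1 = D1" "dim_row F2 = l" "dim_col F2 = D1"
    "dim_row G1 = D2" "dim_col G1 = l" "dim_row G2 = D2" "dim_col G2 = l"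
    "dim_row L1 = D1" "dim_col L1 = l" "dim_row L2 = D1" "dim_col L2 = l"
    "dim_row R2 = l" "dim_col R2 = D2"
    by (auto simp: F1_F2_def G1_G2_def L1_L2_def R2_def)
  have GF: "G1 * F1 + G2 * F2 = 0\<^sub>m D2 D1"
  proof -
    have "G1 * F1 = mono_mat D2 D1 (-1) (\<lambda>k. if k < l then - (q_int q k * q powi r) else 0)"
      unfolding F1_F2_def G1_G2_def mono_mat_mult by (rule mono_mat_eqI) auto
    moreover have "G2 * F2 = mono_mat D2 D1 (-1) (\<lambda>k. if k < l then q_int q k * q powi r else 0)"
      unfolding F1_F2_def G1_G2_def mono_mat_mult using D by (intro mono_mat_eqI) auto
    ultimately show ?thesis by (simp add: mono_mat_add) (rule mono_mat_zeroI; simp)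
  qed
  have LF: "L1 * F1 + L2 * F2 = 1\<^sub>m D1"
  proof -
    have "L1 * F1 = mono_mat D1 D1 0 (\<lambda>k. if k < l then 1 else 0)"
      unfolding F1_F2_def L1_L2_def mono_mat_mult by (rule mono_mat_eqI) auto
    moreover have "L2 * F2 = mono_mat D1 D1 0 (\<lambda>k. if k < l then 0 else 1)"
      unfolding F1_F2_def L1_L2_def mono_mat_mult
    proof (rule mono_mat_eqI)
      fix i k assume k: "k < D1"
      show "(if 0 \<le> int k + - 1 \<and> int k + - 1 < int l then
          (if Suc (nat (int k + - 1)) = l then inverse (q_int q l * q powi r) else 0) * (q_int q k * q powi r) else 0)
        = (if k < l then 0 else 1)"
      proof (cases "k < l")
        case False
        hence "k = l" "D1 = Suc l" using k D by auto
        thus ?thesis using ln lp by (simp add: nat_diff_distrib field_simps)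
      qed auto
    qed simp
    ultimately show ?thesis
      unfolding one_eq_mono_mat by (simp add: mono_mat_add) (rule mono_mat_eqI; simp)
  qed
  have GR: "G2 * R2 = 1\<^sub>m D2"
    unfolding G1_G2_def R2_def mono_mat_mult one_eq_mono_mat using D by (intro mono_mat_eqI) auto
  have FL1: "F1 * L1 = 1\<^sub>m l" "F1 * L2 = 0\<^sub>m l l"
    unfolding F1_F2_def L1_L2_def mono_mat_mult one_eq_mono_mat
    using D by (intro mono_mat_eqI mono_mat_zeroI; auto)+
  have FL2: "F2 * L1 + R2 * G1 = 0\<^sub>m l l"
  proof -
    have "F2 * L1 = mono_mat l l (-1) (\<lambda>k. q_int q k * q powi r)"
      unfolding F1_F2_def L1_L2_def mono_mat_mult using D by (intro mono_mat_eqI) auto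
    moreover have "R2 * G1 = mono_mat l l (-1) (\<lambda>k. - (q_int q k * q powi r))"
      unfolding G1_G2_def R2_def mono_mat_mult using D by (intro mono_mat_eqI) auto
    ultimately show ?thesis by (simp add: mono_mat_add) (rule mono_mat_zeroI; simp)
  qed
  have FL3: "F2 * L2 + R2 * G2 = 1\<^sub>m l"
  proof -
    have "F2 * L2 = mono_mat l l 0 (\<lambda>k. if k < D2 then 0 else 1)"
      unfolding F1_F2_def L1_L2_def mono_mat_mult
      using D lp ln by (intro mono_mat_eqI) (auto simp: nat_add_distrib field_simps)
    moreover have "R2 * G2 = mono_mat l l 0 (\<lambda>k. if k < D2 then 1 else 0)"
      unfolding G1_G2_def R2_def mono_mat_mult using D by (intro mono_mat_eqI) auto
    ultimately show ?thesis
      unfolding one_eq_mono_mat by (simp add: mono_mat_add) (rule mono_mat_eqI; simp)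
  qed
  show ?thesis
  proof (rule split_exactI[OF _ _ _ i p, of ?L ?R])
    show "?p * ?i = 0\<^sub>m (mdim ?C) (mdim ?A)"
      by (simp add: mat_distrib kronecker_mult GF)
    show "?L * ?i = 1\<^sub>m (mdim ?A)"
      by (simp add: mat_distrib kronecker_mult LF)
    show "?p * ?R = 1\<^sub>m (mdim ?C)"
      by (simp add: mat_distrib kronecker_mult GR)
    have "?i * ?L + ?R * ?p = kronecker (ecol 0 * erow 0) (F1 * L1) + kronecker (ecol 0 * erow (Suc 0)) (F1 * L2)
      + (kronecker (ecol (Suc 0) * erow 0) (F2 * L1 + R2 * G1) + kronecker (ecol (Suc 0) * erow (Suc 0)) (F2 * L2 + R2 * G2))"
      by (simp add: mat_distrib kronecker_mult kronecker_add)
        (intro eq_matI; simp add: algebra_simps del: index_mult_mat(1))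
    also have "\<dots> = kronecker (1\<^sub>m 2) (1\<^sub>m l)"
      unfolding FL1 FL2 FL3 by (simp add: ecol_erow_sum flip: kronecker_add)
    finally show "?i * ?L + ?R * ?p = 1\<^sub>m (mdim (V2 p \<otimes>\<^sub>H ?M))" by simp
  qed (auto intro!: carrier_matI)
qed

text \<open>In the Verma module labelled \<open>l\<close> the vector \<open>a^l v\<close> is again
  killed by \<open>d\<close>, as \<alpha> vanishes at \<open>l\<close>. It generates a copy of
  \<open>V(n - l, r + l)\<close>, and the first \<open>l\<close> basis vectors survive as
  \<open>V(l, r)\<close>.\<close>

lemma split_exact_verma:
  assumes l: "0 < l" "l < n"
  shows "split_exact (hw_module (n - l) (n - l) (r + int l)) (hw_module n l r) (hw_module l l r)"
proof -
  let ?A = "hw_module (n - l) (n - l) (r + int l)" and ?X = "hw_module n l r" and ?C = "hw_module l l r"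
  define i where "i = mono_mat n (n - l) (int l) (\<lambda>_. 1 :: 'k)"
  define p where "p = mono_mat l n 0 (\<lambda>_. 1 :: 'k)"
  define L where "L = mono_mat (n - l) n (- int l) (\<lambda>_. 1 :: 'k)"
  define R where "R = mono_mat n l 0 (\<lambda>_. 1 :: 'k)"
  \<comment> \<open>Multiplied by \<open>1 - q\<close>, both sides are
    \<open>(1 - q^k) (1 - q^(k + l))\<close>, because \<open>q^n = 1\<close>.\<close>
  have al: "alpha q k (n - l) = alpha q (k + l) l" for k
  proof -
    have e: "q powi (int k - int (n - l)) = q ^ (k + l)"
      using l by (simp flip: power_int_of_nat) (intro q_powi_cong; simp add: of_nat_diff)
    have "(1 - q) * alpha q k (n - l) = (1 - q) * alpha q (k + l) l"
      unfolding alpha_def mult.assoc[symmetric] q_int_geometric e by simp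
    thus ?thesis by simp
  qed
  have i: "i \<in> module_hom ?A ?X"
  proof (rule homI)
    fix x show "i * action ?A x = action ?X x * i"
    proof (cases x)
      case Gen_c
      show ?thesis unfolding Gen_c hw_module_simps i_def mono_mat_mult
        using l by (intro mono_mat_eqI) (auto intro!: q_powi_cong simp: of_nat_diff nat_add_distrib)
    next
      case Gen_d
      show ?thesis unfolding Gen_d hw_module_simps i_def mono_mat_mult
      proof (rule mono_mat_eqI)
        fix j k assume "k < n - l"
        thus "(if 0 \<le> int k + - 1 \<and> int k + - 1 < int (n - l) then 1 * alpha q k (n - l) else 0)
          = (if 0 \<le> int k + int l \<and> int k + int l < int n then alpha q (nat (int k + int l)) l * 1 else 0)"
          using l al[of k] by (cases k) (auto simp: nat_add_distrib)
      qed simp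
    qed (use l in \<open>auto simp: i_def mono_mat_mult nat_add_distrib algebra_simps intro!: mono_mat_eqI\<close>)
  qed (simp_all add: i_def)
  have p: "p \<in> module_hom ?X ?C"
  proof (rule homI)
    fix x show "p * action ?X x = action ?C x * p"
    proof (cases x)
      case Gen_d
      show ?thesis unfolding Gen_d hw_module_simps p_def mono_mat_mult
      proof (rule mono_mat_eqI)
        fix j k assume "j < l" "k < n" "int j = int k + (0 + - 1)"
        thus "(if 0 \<le> int k + - 1 \<and> int k + - 1 < int n then 1 * alpha q k l else 0)
          = (if 0 \<le> int k + 0 \<and> int k + 0 < int l then alpha q (nat (int k + 0)) l * 1 else 0)"
          using l by (cases "k = l") auto
      qed simp
    qed (use l in \<open>auto simp: p_def mono_mat_mult intro!: mono_mat_eqI\<close>)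
  qed (simp_all add: p_def)
  show ?thesis
  proof (rule split_exactI[OF _ _ _ i p, of L R])
    show "p * i = 0\<^sub>m (mdim ?C) (mdim ?A)"
      unfolding p_def i_def mono_mat_mult hw_module_simps by (rule mono_mat_zeroI) auto
    show "L * i = 1\<^sub>m (mdim ?A)"
      unfolding L_def i_def mono_mat_mult hw_module_simps one_eq_mono_mat
      using l by (intro mono_mat_eqI) auto
    show "p * R = 1\<^sub>m (mdim ?C)"
      unfolding p_def R_def mono_mat_mult hw_module_simps one_eq_mono_mat
      using l by (intro mono_mat_eqI) auto
    show "i * L + R * p = 1\<^sub>m (mdim ?X)"
    proof -
      have "i * L = mono_mat n n 0 (\<lambda>k. if l \<le> k then 1 else 0)"
        unfolding L_def i_def mono_mat_mult by (rule mono_mat_eqI) auto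
      moreover have "R * p = mono_mat n n 0 (\<lambda>k. if k < l then 1 else 0)"
        unfolding R_def p_def mono_mat_mult by (rule mono_mat_eqI) auto
      ultimately show ?thesis
        unfolding one_eq_mono_mat by (simp add: mono_mat_add) (rule mono_mat_eqI; auto)
    qed
  qed (auto simp: L_def R_def intro!: carrier_matI)
qed

section \<open>One- and two-dimensional modules and their duals\<close>

text \<open>On a one-dimensional module \<open>a\<close> and \<open>d\<close> vanish, so on the
  tensor product they act through the right factor alone. With the one-dimensional factor on the
  left the result is therefore an equality of matrices, not just an isomorphism.\<close>

lemma one_dim_tensor: "hw_module (Suc 0) (Suc 0) s \<otimes>\<^sub>H hw_module l l r = hw_module l l (r + s)"
proof (rule hmod_eqI)
  let ?V = "hw_module (Suc 0) (Suc 0) s"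
  have "action ?V Gen_a = 0\<^sub>m (Suc 0) (Suc 0)" "action ?V Gen_d = 0\<^sub>m (Suc 0) (Suc 0)"
    "action ?V Gen_b = q powi s \<cdot>\<^sub>m 1\<^sub>m (Suc 0)" "action ?V Gen_c = q powi (- s) \<cdot>\<^sub>m 1\<^sub>m (Suc 0)"
    unfolding hw_module_simps one_eq_mono_mat mono_mat_smult
    by (rule mono_mat_eqI mono_mat_zeroI; auto)+
  note V = this
  show "action (?V \<otimes>\<^sub>H hw_module l l r) Gen_a = action (hw_module l l (r + s)) Gen_a"
    "action (?V \<otimes>\<^sub>H hw_module l l r) Gen_d = action (hw_module l l (r + s)) Gen_d"
    "action (?V \<otimes>\<^sub>H hw_module l l r) Gen_b = action (hw_module l l (r + s)) Gen_b"
    "action (?V \<otimes>\<^sub>H hw_module l l r) Gen_c = action (hw_module l l (r + s)) Gen_c"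
    unfolding action_tensor V
    by (simp_all add: kronecker_smult mono_mat_smult)
      (rule mono_mat_eqI; simp add: q_powi_simp algebra_simps)+
qed simp

lemma unit_module_eq: "unit_module q = hw_module (Suc 0) (Suc 0) 0"
  by (simp add: unit_module_def simple_module_eq)

lemma is_module_V2_tensor: "is_module n q M \<Longrightarrow> is_module n q (V2 p \<otimes>\<^sub>H M)"
proof (rule is_module_tensor_nilpotent)
  show "is_module n q (V2 p)" using n_gt_2 by (intro is_module_hw) auto
qed (auto simp: mono_mat_mult intro!: mono_mat_zeroI)

lemma is_module_one_dim_tensor: "is_module n q M \<Longrightarrow> is_module n q (hw_module (Suc 0) (Suc 0) p \<otimes>\<^sub>H M)"
proof (rule is_module_tensor_nilpotent)
  show "is_module n q (hw_module (Suc 0) (Suc 0) p)" using n_gt_2 by (intro is_module_hw) auto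
qed (auto simp: mono_mat_mult intro!: mono_mat_zeroI)

lemma dual_pair_one_dim:
  "dual_pair n q (hw_module (Suc 0) (Suc 0) s) (hw_module (Suc 0) (Suc 0) (- s)) (1\<^sub>m (Suc 0)) (1\<^sub>m (Suc 0))"
proof (unfold_locales)
  have *: "1\<^sub>m (Suc 0) \<in> module_hom (unit_module q) (unit_module q)"
    using hom_id[OF mod_shape_unit_module, of q] by simp
  show "1\<^sub>m (Suc 0) \<in> module_hom (hw_module (Suc 0) (Suc 0) s \<otimes>\<^sub>H hw_module (Suc 0) (Suc 0) (- s)) (unit_module q)"
    "1\<^sub>m (Suc 0) \<in> module_hom (unit_module q) (hw_module (Suc 0) (Suc 0) (- s) \<otimes>\<^sub>H hw_module (Suc 0) (Suc 0) s)"
    using * by (simp_all add: one_dim_tensor unit_module_eq)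
qed (auto intro: is_module_one_dim_tensor)

text \<open>The invariant pairing of \<open>V(2, 0)\<close> with \<open>V(2, -1)\<close>: since
  \<open>a (v_0 \<otimes> u_0) = v_0 \<otimes> u_1 + q^(-1) v_1 \<otimes> u_0\<close> must go to
  zero, the ratio of the two values is \<open>-q\<close>. The zigzag identities then fix the
  coefficients of \<open>co2\<close>.\<close>

definition ev2 :: "'k mat" where
  "ev2 = kronecker (erow 0) (erow (Suc 0)) + (- q) \<cdot>\<^sub>m kronecker (erow (Suc 0)) (erow 0)"

definition co2 :: "'k mat" where
  "co2 = (- inverse q) \<cdot>\<^sub>m kronecker (ecol 0) (ecol (Suc 0)) + kronecker (ecol (Suc 0)) (ecol 0)"

lemma dual_pair_V2: "dual_pair n q (V2 0) (V2 (-1)) ev2 co2"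
proof (unfold_locales)
  note V = mod_shape_dim[OF mod_shape_hw, of 2 2 0] mod_shape_dim[OF mod_shape_hw, of 2 2 "-1"]
  have q: "q * inverse q = 1" by simp
  show "ev2 \<in> module_hom (V2 0 \<otimes>\<^sub>H V2 (-1)) (unit_module q)"
  proof (rule homI)
    fix x show "ev2 * action (V2 0 \<otimes>\<^sub>H V2 (-1)) x = action (unit_module q) x * ev2"
      by (cases x; simp add: ev2_def action_tensor action_unit_module mat_distrib kronecker_mult V
          V2_erow kronecker_add kronecker_smult smult_smult_mat alpha_1_2 del: hw_module_simps(2-5);
          (intro eq_matI; simp add: algebra_simps del: index_mult_mat(1))?)
  qed (simp_all add: ev2_def)
  show "co2 \<in> module_hom (unit_module q) (V2 (-1) \<otimes>\<^sub>H V2 0)"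
  proof (rule homI)
    fix x show "co2 * action (unit_module q) x = action (V2 (-1) \<otimes>\<^sub>H V2 0) x * co2"
      by (cases x; simp add: co2_def action_tensor action_unit_module mat_distrib kronecker_mult V
          V2_ecol kronecker_add kronecker_smult smult_smult_mat alpha_1_2 del: hw_module_simps(2-5);
          (intro eq_matI; simp add: algebra_simps del: index_mult_mat(1))?)
  qed (simp_all add: co2_def)
  have row: "kronecker (kronecker (erow i) (erow j)) (1\<^sub>m 2) * kronecker (1\<^sub>m 2) (kronecker (ecol k) (ecol m))
      = kronecker (erow i) (kronecker (erow j * ecol k) (ecol m))" for i j k m
    unfolding kronecker_assoc by (simp add: kronecker_mult)
  have col: "kronecker (1\<^sub>m 2) (kronecker (erow i) (erow j)) * kronecker (kronecker (ecol k) (ecol m)) (1\<^sub>m 2)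
      = kronecker (ecol k) (kronecker (erow i * ecol m) (erow j))" for i j k m
    unfolding kronecker_assoc by (simp add: kronecker_mult)
  have eye: "kronecker (erow 0) (ecol 0) + kronecker (erow (Suc 0)) (ecol (Suc 0)) = 1\<^sub>m 2"
    "kronecker (ecol 0) (erow 0) + kronecker (ecol (Suc 0)) (erow (Suc 0)) = 1\<^sub>m 2"
    by (intro eq_matI; auto simp: index_kronecker ecol_def erow_def index_mono_mat less_2_cases_iff)+
  show "kronecker ev2 (1\<^sub>m (mdim (V2 0))) * kronecker (1\<^sub>m (mdim (V2 0))) co2 = 1\<^sub>m (mdim (V2 0))"
  proof -
    have "kronecker ev2 (1\<^sub>m 2) * kronecker (1\<^sub>m 2) co2 =
        kronecker (erow 0) (ecol 0) + kronecker (erow (Suc 0)) (ecol (Suc 0))"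
      unfolding ev2_def co2_def
      by (simp add: mat_distrib kronecker_add kronecker_smult row smult_smult_mat)
        (intro eq_matI; simp add: algebra_simps)?
    thus ?thesis by (simp add: eye)
  qed
  show "kronecker (1\<^sub>m (mdim (V2 (-1)))) ev2 * kronecker co2 (1\<^sub>m (mdim (V2 (-1)))) = 1\<^sub>m (mdim (V2 (-1)))"
  proof -
    have "kronecker (1\<^sub>m 2) ev2 * kronecker co2 (1\<^sub>m 2) =
        kronecker (ecol 0) (erow 0) + kronecker (ecol (Suc 0)) (erow (Suc 0))"
      unfolding ev2_def co2_def
      by (simp add: mat_distrib kronecker_add kronecker_smult col smult_smult_mat)
        (intro eq_matI; simp add: algebra_simps)?
    thus ?thesis by (simp add: eye)
  qed
qed (auto intro: is_module_V2_tensor)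

end

section \<open>Simple modules\<close>

text \<open>Vectors are kept as one-column matrices, so that associativity and
  \<open>mult_rewrite\<close> treat them like homomorphisms.\<close>

definition ucol :: "nat \<Rightarrow> nat \<Rightarrow> 'k::field mat" where
  "ucol m j = mono_mat m (Suc 0) (int j) (\<lambda>_. 1)"

lemma ucol_dim [simp]: "dim_row (ucol m j) = m" "dim_col (ucol m j) = Suc 0"
  by (simp_all add: ucol_def)

lemma index_mult_ucol:
  assumes "j < m" "dim_col F = m" "i < dim_row F"
  shows "(F * ucol m j) $$ (i, 0) = F $$ (i, j)"
proof -
  have "(F * ucol m j) $$ (i, 0) = (\<Sum>k<m. F $$ (i, k) * ucol m j $$ (k, 0))"
    using assms by (subst index_mult_mat_sum) auto
  also have "\<dots> = (\<Sum>k<m. if k = j then F $$ (i, k) else 0)"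
    by (rule sum.cong) (auto simp: ucol_def index_mono_mat)
  also have "\<dots> = F $$ (i, j)" using assms(1) by simp
  finally show ?thesis .
qed

lemma mat_eq_ucolI:
  assumes "dim_row F = dim_row G" "dim_col F = m" "dim_col G = m" "\<And>j. j < m \<Longrightarrow> F * ucol m j = G * ucol m j"
  shows "F = G"
proof (rule eq_matI)
  fix i j assume "i < dim_row G" "j < dim_col G"
  thus "F $$ (i, j) = G $$ (i, j)" using assms index_mult_ucol[of j m] by metis
qed (use assms in auto)

lemma mat_of_columns_exists:
  assumes "\<And>j. j < m \<Longrightarrow> x j \<in> carrier_mat r (Suc 0)"
  obtains F where "F \<in> carrier_mat r m" "\<And>j. j < m \<Longrightarrow> F * ucol m j = x j"
proof
  let ?F = "mat r m (\<lambda>(i, j). x j $$ (i, 0))"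
  show "?F \<in> carrier_mat r m" by simp
  fix j assume j: "j < m"
  show "?F * ucol m j = x j"
  proof (rule eq_matI)
    fix i k assume "i < dim_row (x j)" "k < dim_col (x j)"
    hence "i < r" "k = 0" using assms[OF j] by auto
    thus "(?F * ucol m j) $$ (i, k) = x j $$ (i, k)" using j by (simp add: index_mult_ucol del: index_mult_mat(1))
  qed (use assms[OF j] in auto)
qed

lemma smult_mat_eq_zero_iff:
  "k \<cdot>\<^sub>m x = 0\<^sub>m r c \<longleftrightarrow> k = 0 \<or> x = 0\<^sub>m r c" if "x \<in> carrier_mat r c" for k :: "'k::field"
  using that by (auto simp: mat_eq_iff)

lemma mat_dim_eq_0:
  assumes S: "mat_subspace r c (S :: 'k::field mat set)" and 0: "mat_dim r c S = 0"
  shows "S = {0\<^sub>m r c}"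
proof -
  interpret V: vectorspace class_ring "mat_vs r c S" by (rule mat_subspace_vectorspace[OF S])
  obtain B where B: "finite B" "V.basis B"
    using V.finite_basis_exists[OF mat_subspace_fin_dim[OF S]] by blast
  have "card B = 0" using V.dim_basis[OF B] 0 by (simp add: mat_dim_def)
  hence "B = {}" using B by simp
  thus ?thesis using B(2) V.span_empty by (auto simp: V.basis_def mat_vs_simps)
qed

context root_of_unity
begin

section \<open>Weight projections\<close>

lemma q_powi_power_n [simp]: "(q powi x) ^ n = 1"
proof -
  have "(q powi x) ^ n = q powi (x * int n)"
    by (metis power_int_mult power_int_of_nat)
  also have "\<dots> = 1" by (simp only: q_powi_eq_1_iff dvd_triv_right)
  finally show ?thesis .
qed

text \<open>If \<open>n\<close> were zero in \<open>k\<close>, the polynomial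
  \<open>1 + x + ... + x^(n-1)\<close> would vanish at 1 as well as at the other powers of
  \<open>q\<close>: \<open>n\<close> distinct roots for degree at most \<open>n - 1\<close>.\<close>

lemma of_nat_n_nonzero: "of_nat n \<noteq> (0 :: 'k)"
proof
  assume n0: "of_nat n = (0 :: 'k)"
  define p :: "'k poly" where "p = (\<Sum>i<n. monom 1 i)"
  have co: "coeff p i = (if i < n then 1 else 0)" for i
    by (simp add: p_def coeff_sum)
  have p0: "p \<noteq> 0" using co[of 0] n_gt_2 by auto
  have "degree p \<le> n - 1" by (rule degree_le) (use co in auto)
  have "(\<lambda>j. q ^ j) ` {..<n} \<subseteq> {x. poly p x = 0}"
  proof safe
    fix j assume "j < n"
    have pj: "poly p (q ^ j) = q_int (q ^ j) n" by (simp add: p_def poly_sum poly_monom q_int_def)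
    show "poly p (q ^ j) = 0"
    proof (cases "j = 0")
      case True
      thus ?thesis using pj n0 by (simp add: q_int_def)
    next
      case False
      have "(1 - q ^ j) * q_int (q ^ j) n = 0"
        using q_powi_power_n[of "int j"] unfolding q_int_geometric by simp
      moreover have "q ^ j \<noteq> 1" using False \<open>j < n\<close> prim by (auto simp: primitive_root_of_unity_def)
      ultimately show ?thesis using pj by simp
    qed
  qed
  moreover have "inj_on (\<lambda>j. q ^ j) {..<n}"
  proof (rule inj_onI)
    fix i j assume ij: "i \<in> {..<n}" "j \<in> {..<n}" "q ^ i = q ^ j"
    hence "q powi int i = q powi int j" by simp
    hence "int n dvd int i - int j" by (simp only: q_powi_eq_iff)
    thus "i = j" using ij dvd_imp_le_int[of "int i - int j" "int n"] by (cases "i = j") auto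
  qed
  ultimately have "n \<le> card {x. poly p x = 0}"
    using poly_roots_finite[OF p0] by (metis card_image card_lessThan card_mono)
  thus False using card_poly_roots_bound[OF p0] \<open>degree p \<le> n - 1\<close> n_gt_2 by linarith
qed

text \<open>The sum of \<open>z^i B^i\<close> over \<open>i < n\<close>. If \<open>B^n = 1\<close>
  and \<open>z^n = 1\<close>, it is \<open>n\<close> times the projection onto the eigenspace of
  \<open>B\<close> for the inverse of \<open>z\<close>; the factor \<open>n\<close> is carried along
  and divided out at the end.\<close>

definition avg :: "'k \<Rightarrow> 'k mat \<Rightarrow> 'k mat" where
  "avg z B = mat (dim_row B) (dim_row B) (\<lambda>(j, k). \<Sum>i<n. z ^ i * (B ^\<^sub>m i) $$ (j, k))"

lemma avg_dim [simp]: "dim_row (avg z B) = dim_row B" "dim_col (avg z B) = dim_row B"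
  by (simp_all add: avg_def)

lemma mult_avg:
  assumes "dim_row B = dim_col B" "dim_col A = dim_row B"
  shows "A * avg z B = mat (dim_row A) (dim_row B) (\<lambda>(j, k). \<Sum>i<n. z ^ i * (A * B ^\<^sub>m i) $$ (j, k))"
proof (rule eq_matI)
  fix j k assume "j < dim_row (mat (dim_row A) (dim_row B) (\<lambda>(j, k). \<Sum>i<n. z ^ i * (A * B ^\<^sub>m i) $$ (j, k)))"
    "k < dim_col (mat (dim_row A) (dim_row B) (\<lambda>(j, k). \<Sum>i<n. z ^ i * (A * B ^\<^sub>m i) $$ (j, k)))"
  hence jk: "j < dim_row A" "k < dim_row B" by auto
  have "(A * avg z B) $$ (j, k) = (\<Sum>l<dim_row B. \<Sum>i<n. A $$ (j, l) * (z ^ i * (B ^\<^sub>m i) $$ (l, k)))"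
    using jk assms by (subst index_mult_mat_sum) (auto simp: avg_def sum_distrib_left intro!: sum.cong)
  also have "\<dots> = (\<Sum>i<n. \<Sum>l<dim_row B. A $$ (j, l) * (z ^ i * (B ^\<^sub>m i) $$ (l, k)))"
    by (rule sum.swap)
  also have "\<dots> = (\<Sum>i<n. z ^ i * (A * B ^\<^sub>m i) $$ (j, k))"
    using jk assms
    by (intro sum.cong refl) (subst index_mult_mat_sum; simp add: pow_mat_dim sum_distrib_left mult_ac)
  finally show "(A * avg z B) $$ (j, k) = mat (dim_row A) (dim_row B) (\<lambda>(j, k). \<Sum>i<n. z ^ i * (A * B ^\<^sub>m i) $$ (j, k)) $$ (j, k)"
    using jk by simp
qed (use assms in auto)

lemma avg_mult:
  assumes "dim_row B = dim_col B" "dim_row A = dim_row B"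
  shows "avg z B * A = mat (dim_row B) (dim_col A) (\<lambda>(j, k). \<Sum>i<n. z ^ i * (B ^\<^sub>m i * A) $$ (j, k))"
proof (rule eq_matI)
  fix j k assume "j < dim_row (mat (dim_row B) (dim_col A) (\<lambda>(j, k). \<Sum>i<n. z ^ i * (B ^\<^sub>m i * A) $$ (j, k)))"
    "k < dim_col (mat (dim_row B) (dim_col A) (\<lambda>(j, k). \<Sum>i<n. z ^ i * (B ^\<^sub>m i * A) $$ (j, k)))"
  hence jk: "j < dim_row B" "k < dim_col A" by auto
  have "(avg z B * A) $$ (j, k) = (\<Sum>l<dim_row B. \<Sum>i<n. z ^ i * (B ^\<^sub>m i) $$ (j, l) * A $$ (l, k))"
    using jk assms by (subst index_mult_mat_sum) (auto simp: avg_def sum_distrib_right intro!: sum.cong)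
  also have "\<dots> = (\<Sum>i<n. \<Sum>l<dim_row B. z ^ i * (B ^\<^sub>m i) $$ (j, l) * A $$ (l, k))"
    by (rule sum.swap)
  also have "\<dots> = (\<Sum>i<n. z ^ i * (B ^\<^sub>m i * A) $$ (j, k))"
    using jk assms
    by (intro sum.cong refl) (subst index_mult_mat_sum; simp add: pow_mat_dim sum_distrib_left mult_ac)
  finally show "(avg z B * A) $$ (j, k) = mat (dim_row B) (dim_col A) (\<lambda>(j, k). \<Sum>i<n. z ^ i * (B ^\<^sub>m i * A) $$ (j, k)) $$ (j, k)"
    using jk by simp
qed (use assms in auto)

lemma pow_skew:
  assumes "dim_row B = dim_col B" "dim_row C = dim_col C" "dim_col A = dim_row B" "dim_row A = dim_row C"
    "A * B = w \<cdot>\<^sub>m (C * A)"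
  shows "A * B ^\<^sub>m i = (w ^ i :: 'k) \<cdot>\<^sub>m (C ^\<^sub>m i * A)"
proof (induction i)
  case 0
  thus ?case using assms by (intro eq_matI) auto
next
  case (Suc i)
  have "A * B ^\<^sub>m Suc i = (A * B ^\<^sub>m i) * B" using assms by (simp add: assoc_mult_mat_dim pow_mat_dim)
  also have "\<dots> = w ^ i \<cdot>\<^sub>m (C ^\<^sub>m i * (A * B))" unfolding Suc using assms
    by (simp add: mat_distrib assoc_mult_mat_dim pow_mat_dim)
  also have "\<dots> = w ^ Suc i \<cdot>\<^sub>m (C ^\<^sub>m Suc i * A)" unfolding assms(5) using assms(1-4)
    by (simp add: mat_distrib assoc_mult_mat_dim pow_mat_dim smult_smult_mat mult.commute)
  finally show ?case .
qed

text \<open>An operator that commutes with \<open>B\<close> up to the scalar \<open>w\<close> shifts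
  the weight parameter by \<open>w\<close>. With \<open>w = 1\<close> this covers module maps and
  the pair \<open>b\<close>, \<open>c\<close>; with \<open>w = q\<close> it moves \<open>d\<close>
  past the projections.\<close>

lemma avg_skew:
  assumes "dim_row B = dim_col B" "dim_row C = dim_col C" "dim_col A = dim_row B" "dim_row A = dim_row C"
    "A * B = w \<cdot>\<^sub>m (C * A)"
  shows "A * avg z B = avg (z * w) C * A"
proof -
  have "A * avg z B = mat (dim_row A) (dim_row B) (\<lambda>(j, k). \<Sum>i<n. z ^ i * (A * B ^\<^sub>m i) $$ (j, k))"
    using assms by (intro mult_avg) auto
  also have "\<dots> = mat (dim_row C) (dim_col A) (\<lambda>(j, k). \<Sum>i<n. (z * w) ^ i * (C ^\<^sub>m i * A) $$ (j, k))"
    unfolding pow_skew[OF assms] using assms(1-4)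
    by (intro cong_mat) (auto simp: pow_mat_dim power_mult_distrib mult_ac simp del: index_mult_mat(1) intro!: sum.cong)
  also have "\<dots> = avg (z * w) C * A" using assms by (intro avg_mult[symmetric]) auto
  finally show ?thesis .
qed

text \<open>Multiplication by \<open>B\<close> shifts the summation index, and the shift is cyclic
  because \<open>B^n = 1\<close> and the scalar is an \<open>n\<close>-th root of unity.\<close>

lemma avg_eigen:
  assumes B: "B \<in> carrier_mat m m" "B ^\<^sub>m n = 1\<^sub>m m"
  shows "B * avg (q powi (- x)) B = q powi x \<cdot>\<^sub>m avg (q powi (- x)) B"
proof (rule eq_matI)
  let ?z = "q powi (- x)"
  fix j k assume "j < dim_row (q powi x \<cdot>\<^sub>m avg ?z B)" "k < dim_col (q powi x \<cdot>\<^sub>m avg ?z B)"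
  hence jk: "j < m" "k < m" using B by auto
  define f where "f i = ?z ^ i * (B ^\<^sub>m i) $$ (j, k)" for i
  have fn: "f n = f 0"
    unfolding f_def using B by simp
  have BB: "B * B ^\<^sub>m i = B ^\<^sub>m Suc i" for i
    using B by (induction i) (simp_all add: assoc_mult_mat_dim[symmetric] pow_mat_dim)
  have zx: "q powi x * ?z = 1" by (simp add: q_powi_simp)
  have "B * avg ?z B = mat m m (\<lambda>(j, k). \<Sum>i<n. ?z ^ i * (B ^\<^sub>m Suc i) $$ (j, k))"
    unfolding BB[symmetric] using B mult_avg[of B B ?z] by simp
  hence "(B * avg ?z B) $$ (j, k) = (\<Sum>i<n. ?z ^ i * (B ^\<^sub>m Suc i) $$ (j, k))"
    using jk by (simp del: pow_mat.simps index_mult_mat(1))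
  also have "\<dots> = q powi x * (\<Sum>i<n. f (Suc i))"
    unfolding f_def sum_distrib_left power_Suc mult.assoc[symmetric] zx by simp
  also have "(\<Sum>i<n. f (Suc i)) = (\<Sum>i<n. f i)"
    using sum.lessThan_Suc_shift[of f n] fn by (simp add: sum.lessThan_Suc)
  finally show "(B * avg ?z B) $$ (j, k) = (q powi x \<cdot>\<^sub>m avg ?z B) $$ (j, k)"
    using jk B by (simp add: avg_def f_def)
qed (use B in auto)

lemma sum_q_powers: "(\<Sum>x<n. (q powi (- int x)) ^ i) = (if i mod n = 0 then of_nat n else 0)"
proof -
  define w where "w = q powi (- int i)"
  have w: "(q powi (- int s)) ^ i = w ^ s" for s
    unfolding w_def by (simp only: power_int_of_nat[symmetric] power_int_mult[symmetric]) (simp add: mult.commute)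
  have w1: "w = 1 \<longleftrightarrow> i mod n = 0"
    unfolding w_def by (simp only: q_powi_eq_1_iff dvd_minus_iff int_dvd_int_iff) (simp add: dvd_eq_mod_eq_0)
  have "(1 - w) * q_int w n = 0" unfolding q_int_geometric by (simp add: w_def)
  thus ?thesis using w1 by (auto simp: w q_int_def)
qed

text \<open>By orthogonality of the powers of \<open>q\<close>, the averages for all
  \<open>n\<close> weights add up to \<open>n x\<close>, so they cannot all kill
  \<open>x\<close>.\<close>

lemma avg_nonzero:
  assumes B: "B \<in> carrier_mat m m" "B ^\<^sub>m n = 1\<^sub>m m" and x: "x \<in> carrier_mat m (Suc 0)" "x \<noteq> 0\<^sub>m m (Suc 0)"
  obtains s :: int where "avg (q powi (- s)) B * x \<noteq> 0\<^sub>m m (Suc 0)"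
proof -
  obtain j where j: "j < m" "x $$ (j, 0) \<noteq> 0"
    using x by (auto simp: mat_eq_iff)
  have "(\<Sum>s<n. (avg (q powi (- int s)) B * x) $$ (j, 0))
      = (\<Sum>s<n. \<Sum>i<n. (q powi (- int s)) ^ i * (B ^\<^sub>m i * x) $$ (j, 0))"
    using B x j by (intro sum.cong refl) (subst avg_mult; auto)
  also have "\<dots> = (\<Sum>i<n. \<Sum>s<n. (q powi (- int s)) ^ i * (B ^\<^sub>m i * x) $$ (j, 0))"
    by (rule sum.swap)
  also have "\<dots> = (\<Sum>i<n. if i = 0 then of_nat n * x $$ (j, 0) else 0)"
    unfolding sum_distrib_right[symmetric] sum_q_powers using B x j
    by (intro sum.cong refl) (auto simp del: index_mult_mat(1))
  also have "\<dots> = of_nat n * x $$ (j, 0)" using n_gt_2 by simp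
  also have "\<dots> \<noteq> 0" using of_nat_n_nonzero j by simp
  finally obtain s where "s < n" "(avg (q powi (- int s)) B * x) $$ (j, 0) \<noteq> 0"
    by (meson sum.not_neutral_contains_not_neutral lessThan_iff)
  hence "avg (q powi (- int s)) B * x \<noteq> 0\<^sub>m m (Suc 0)" using j by auto
  thus ?thesis by (rule that)
qed

section \<open>Highest weight vectors\<close>

text \<open>Highest weight means killed by \<open>d\<close>; the two eigenvalues are those of the
  first basis vector of \<open>V(l, s)\<close>.\<close>

definition hw_vector :: "'k hmod \<Rightarrow> nat \<Rightarrow> int \<Rightarrow> 'k mat \<Rightarrow> bool" where
  "hw_vector M l s x \<longleftrightarrow> x \<in> carrier_mat (mdim M) (Suc 0) \<and>
     action M Gen_d * x = 0\<^sub>m (mdim M) (Suc 0) \<and> action M Gen_b * x = q powi s \<cdot>\<^sub>m x \<and>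
     action M Gen_c * x = q powi (1 - s - int l) \<cdot>\<^sub>m x"

lemma module_rel:
  assumes M: "is_module n q M" and x: "x \<in> carrier_mat (mdim M) (Suc 0)"
  shows "action M Gen_b * (action M Gen_a * x) = q \<cdot>\<^sub>m (action M Gen_a * (action M Gen_b * x))"
    "action M Gen_d * (action M Gen_b * x) = q \<cdot>\<^sub>m (action M Gen_b * (action M Gen_d * x))"
    "action M Gen_c * (action M Gen_a * x) = q \<cdot>\<^sub>m (action M Gen_a * (action M Gen_c * x))"
    "action M Gen_d * (action M Gen_c * x) = q \<cdot>\<^sub>m (action M Gen_c * (action M Gen_d * x))"
    "action M Gen_b * (action M Gen_c * x) = action M Gen_c * (action M Gen_b * x)"
    "action M Gen_d * (action M Gen_a * x) =
       q \<cdot>\<^sub>m (action M Gen_a * (action M Gen_d * x)) + (x - action M Gen_b * (action M Gen_c * x))"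
proof -
  note sh = is_module_shape[OF M]
  note R = M[unfolded is_module_def Let_def, THEN conjunct2]
  have d: "dim_row x = mdim M" using x by auto
  show "action M Gen_b * (action M Gen_a * x) = q \<cdot>\<^sub>m (action M Gen_a * (action M Gen_b * x))"
    "action M Gen_d * (action M Gen_b * x) = q \<cdot>\<^sub>m (action M Gen_b * (action M Gen_d * x))"
    "action M Gen_c * (action M Gen_a * x) = q \<cdot>\<^sub>m (action M Gen_a * (action M Gen_c * x))"
    "action M Gen_d * (action M Gen_c * x) = q \<cdot>\<^sub>m (action M Gen_c * (action M Gen_d * x))"
    "action M Gen_b * (action M Gen_c * x) = action M Gen_c * (action M Gen_b * x)"
    using R sh d by (simp_all add: assoc_mult_mat_dim[symmetric] mat_distrib)
  have "action M Gen_d * action M Gen_a = q \<cdot>\<^sub>m (action M Gen_a * action M Gen_d) + (1\<^sub>m (mdim M) - action M Gen_b * action M Gen_c)"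
  proof -
    have "action M Gen_d * action M Gen_a - q \<cdot>\<^sub>m (action M Gen_a * action M Gen_d) = 1\<^sub>m (mdim M) - action M Gen_b * action M Gen_c"
      using R by blast
    from this[symmetric] show ?thesis
      using sh by (intro eq_matI) (auto simp del: index_mult_mat(1))
  qed
  hence "action M Gen_d * action M Gen_a * x = (q \<cdot>\<^sub>m (action M Gen_a * action M Gen_d) + (1\<^sub>m (mdim M) - action M Gen_b * action M Gen_c)) * x"
    by simp
  thus "action M Gen_d * (action M Gen_a * x) =
       q \<cdot>\<^sub>m (action M Gen_a * (action M Gen_d * x)) + (x - action M Gen_b * (action M Gen_c * x))"
    using sh d by (simp add: mat_distrib assoc_mult_mat_dim)
qed

lemma module_pow:
  assumes M: "is_module n q M"
  shows "action M Gen_a ^\<^sub>m n = 0\<^sub>m (mdim M) (mdim M)" "action M Gen_b ^\<^sub>m n = 1\<^sub>m (mdim M)"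
    "action M Gen_c ^\<^sub>m n = 1\<^sub>m (mdim M)" "action M Gen_d ^\<^sub>m n = 0\<^sub>m (mdim M) (mdim M)"
  using M unfolding is_module_def Let_def by blast+

lemma pow_mat_Suc_left:
  "B \<in> carrier_mat m m \<Longrightarrow> B ^\<^sub>m Suc i = B * (B ^\<^sub>m i :: 'k mat)"
proof (induction i)
  case (Suc i)
  have "B ^\<^sub>m Suc (Suc i) = B * B ^\<^sub>m i * B" using Suc by simp
  also have "\<dots> = B * B ^\<^sub>m Suc i" using Suc.prems by (simp add: assoc_mult_mat_dim pow_mat_dim)
  finally show ?case .
qed simp

definition apow :: "'k hmod \<Rightarrow> gen \<Rightarrow> nat \<Rightarrow> 'k mat \<Rightarrow> 'k mat" where
  "apow M g i x = (((*) (action M g)) ^^ i) x"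

lemma apow_0 [simp]: "apow M g 0 x = x"
  and apow_Suc [simp]: "apow M g (Suc i) x = action M g * apow M g i x"
  by (simp_all add: apow_def)

lemma apow_carrier:
  "mod_shape M \<Longrightarrow> x \<in> carrier_mat (mdim M) (Suc 0) \<Longrightarrow> apow M g i x \<in> carrier_mat (mdim M) (Suc 0)"
  by (induction i) (auto intro!: carrier_matI dest: carrier_matD)

lemma apow_eq:
  "mod_shape M \<Longrightarrow> x \<in> carrier_mat (mdim M) (Suc 0) \<Longrightarrow> apow M g i x = action M g ^\<^sub>m i * x"
  by (induction i)
    (simp_all add: pow_mat_Suc_left[of _ "mdim M"] assoc_mult_mat_dim pow_mat_dim del: pow_mat.simps(2))

lemma apow_add: "apow M g (i + j) x = apow M g i (apow M g j x)"
  by (simp add: apow_def funpow_add)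

lemma apow_n:
  assumes "is_module n q M" "x \<in> carrier_mat (mdim M) (Suc 0)" "g = Gen_a \<or> g = Gen_d" "n \<le> i"
  shows "apow M g i x = 0\<^sub>m (mdim M) (Suc 0)"
proof -
  note sh = is_module_shape[OF assms(1)]
  have "apow M g i x = apow M g (i - n) (apow M g n x)" using assms(4) by (simp flip: apow_add)
  also have "apow M g n x = 0\<^sub>m (mdim M) (Suc 0)"
    using assms sh by (auto simp: apow_eq module_pow)
  also have "apow M g k (0\<^sub>m (mdim M) (Suc 0)) = 0\<^sub>m (mdim M) (Suc 0)" for k
    using sh by (induction k) auto
  finally show ?thesis .
qed

lemma apow_hom:
  assumes "f \<in> module_hom M N" "mod_shape M" "mod_shape N" "x \<in> carrier_mat (mdim M) (Suc 0)"
  shows "f * apow M g i x = apow N g i (f * x)"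
proof (induction i)
  case (Suc i)
  have d: "dim_row (apow M g i x) = mdim M" using apow_carrier[OF assms(2,4)] by blast
  have "f * apow M g (Suc i) x = f * action M g * apow M g i x"
    using d homD(2,3)[OF assms(1)] assms by (simp add: assoc_mult_mat_dim)
  also have "\<dots> = action N g * (f * apow M g i x)"
    unfolding homD(4)[OF assms(1)] using d homD(2,3)[OF assms(1)] assms by (simp add: assoc_mult_mat_dim)
  finally show ?case using Suc by simp
qed simp

text \<open>The commutation relations alone force the formulas of a Verma module on the vectors
  \<open>a^i x\<close>; for \<open>d\<close> the induction step is \<open>alpha_rec\<close>. At
  \<open>i = 0\<close> the truncated index \<open>i - 1\<close> is harmless, the coefficient being
  zero.\<close>

lemma hw_vector_apow:
  assumes M: "is_module n q M" and x: "hw_vector M l s x"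
  shows "action M Gen_b * apow M Gen_a i x = q powi (s + int i) \<cdot>\<^sub>m apow M Gen_a i x"
    "action M Gen_c * apow M Gen_a i x = q powi (int i + 1 - s - int l) \<cdot>\<^sub>m apow M Gen_a i x"
    "action M Gen_d * apow M Gen_a i x = alpha q i l \<cdot>\<^sub>m apow M Gen_a (i - 1) x"
proof -
  note sh = is_module_shape[OF M]
  have xc: "x \<in> carrier_mat (mdim M) (Suc 0)" using x by (simp add: hw_vector_def)
  have c: "apow M Gen_a i x \<in> carrier_mat (mdim M) (Suc 0)" for i using apow_carrier[OF sh xc] .
  note d = carrier_matD[OF c]
  have b: "action M Gen_b * apow M Gen_a i x = q powi (s + int i) \<cdot>\<^sub>m apow M Gen_a i x" for i
  proof (induction i)
    case 0 thus ?case using x by (simp add: hw_vector_def)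
  next
    case (Suc i)
    have "s + int (Suc i) = 1 + (s + int i)" by simp
    hence "q powi (s + int (Suc i)) = q * q powi (s + int i)" by (simp only: q_powi_add power_int_1_right)
    thus ?case using Suc d sh by (simp add: module_rel[OF M c] mat_distrib smult_smult_mat)
  qed
  have cc: "action M Gen_c * apow M Gen_a i x = q powi (int i + 1 - s - int l) \<cdot>\<^sub>m apow M Gen_a i x" for i
  proof (induction i)
    case 0 thus ?case using x by (simp add: hw_vector_def)
  next
    case (Suc i)
    have "int (Suc i) + 1 - s - int l = 1 + (int i + 1 - s - int l)" by simp
    hence "q powi (int (Suc i) + 1 - s - int l) = q * q powi (int i + 1 - s - int l)"
      by (simp only: q_powi_add power_int_1_right)
    thus ?case using Suc d sh by (simp add: module_rel[OF M c] mat_distrib smult_smult_mat)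
  qed
  show "action M Gen_b * apow M Gen_a i x = q powi (s + int i) \<cdot>\<^sub>m apow M Gen_a i x"
    "action M Gen_c * apow M Gen_a i x = q powi (int i + 1 - s - int l) \<cdot>\<^sub>m apow M Gen_a i x"
    by (rule b cc)+
  show "action M Gen_d * apow M Gen_a i x = alpha q i l \<cdot>\<^sub>m apow M Gen_a (i - 1) x"
  proof (induction i)
    case 0 thus ?case using x by (auto simp: hw_vector_def intro!: eq_matI)
  next
    case (Suc i)
    have w: "action M Gen_b * (action M Gen_c * apow M Gen_a i x) = q powi (2 * int i + 1 - int l) \<cdot>\<^sub>m apow M Gen_a i x"
    proof -
      have "int i + 1 - s - int l + (s + int i) = 2 * int i + 1 - int l" by simp
      hence "q powi (int i + 1 - s - int l) * q powi (s + int i) = q powi (2 * int i + 1 - int l)"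
        by (simp only: q_powi_add[symmetric])
      thus ?thesis using d sh by (simp add: b cc mat_distrib smult_smult_mat)
    qed
    have p: "alpha q i l \<cdot>\<^sub>m (action M Gen_a * apow M Gen_a (i - Suc 0) x) = alpha q i l \<cdot>\<^sub>m apow M Gen_a i x"
      using d d[of 0] sh by (cases i) (auto intro!: eq_matI)
    have "action M Gen_d * apow M Gen_a (Suc i) x = q \<cdot>\<^sub>m (alpha q i l \<cdot>\<^sub>m apow M Gen_a i x) +
        (apow M Gen_a i x - q powi (2 * int i + 1 - int l) \<cdot>\<^sub>m apow M Gen_a i x)"
      using d sh by (simp add: module_rel(6)[OF M c] Suc w mat_distrib p)
    also have "\<dots> = (q * alpha q i l + (1 - q powi (2 * int i + 1 - int l))) \<cdot>\<^sub>m apow M Gen_a i x"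
      by (intro eq_matI) (auto simp: algebra_simps)
    also have "q * alpha q i l + (1 - q powi (2 * int i + 1 - int l)) = alpha q (Suc i) l"
      using alpha_rec[of i l] by (simp add: algebra_simps)
    finally show ?case by simp
  qed
qed

lemma simple_ucol:
  assumes "j < m"
  shows "action (simple_module q m s) Gen_a * ucol m j = (if Suc j < m then ucol m (Suc j) else 0\<^sub>m m (Suc 0))"
    "action (simple_module q m s) Gen_b * ucol m j = q powi (s + int j) \<cdot>\<^sub>m ucol m j"
    "action (simple_module q m s) Gen_c * ucol m j = q powi (int j + 1 - s - int m) \<cdot>\<^sub>m ucol m j"
    "action (simple_module q m s) Gen_d * ucol m j = alpha q j m \<cdot>\<^sub>m ucol m (j - 1)"
proof -
  show "action (simple_module q m s) Gen_a * ucol m j = (if Suc j < m then ucol m (Suc j) else 0\<^sub>m m (Suc 0))"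
    "action (simple_module q m s) Gen_b * ucol m j = q powi (s + int j) \<cdot>\<^sub>m ucol m j"
    "action (simple_module q m s) Gen_c * ucol m j = q powi (int j + 1 - s - int m) \<cdot>\<^sub>m ucol m j"
    unfolding simple_module_eq hw_module_simps ucol_def mono_mat_mult mono_mat_smult using assms
    by (intro eq_matI; auto simp: index_mono_mat nat_add_distrib)+
  show "action (simple_module q m s) Gen_d * ucol m j = alpha q j m \<cdot>\<^sub>m ucol m (j - 1)"
    unfolding simple_module_eq hw_module_simps ucol_def mono_mat_mult mono_mat_smult using assms
    by (cases j; intro eq_matI; auto simp: index_mono_mat nat_add_distrib)
qed

text \<open>A highest weight vector generates a quotient of a Verma module, and
  \<open>a^m x = 0\<close> is the one further relation that defines \<open>V(m, s)\<close>.\<close>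

lemma hom_from_simple:
  assumes M: "is_module n q M" and x: "hw_vector M m s x" and am: "apow M Gen_a m x = 0\<^sub>m (mdim M) (Suc 0)"
  obtains f where "f \<in> module_hom (simple_module q m s) M" "\<And>j. j < m \<Longrightarrow> f * ucol m j = apow M Gen_a j x"
proof -
  note sh = is_module_shape[OF M]
  have xc: "x \<in> carrier_mat (mdim M) (Suc 0)" using x by (simp add: hw_vector_def)
  have c: "apow M Gen_a i x \<in> carrier_mat (mdim M) (Suc 0)" for i using apow_carrier[OF sh xc] .
  obtain f where f: "f \<in> carrier_mat (mdim M) m" "\<And>j. j < m \<Longrightarrow> f * ucol m j = apow M Gen_a j x"
    using mat_of_columns_exists[of m "\<lambda>j. apow M Gen_a j x" "mdim M"] c by blast
  note d = carrier_matD[OF f(1)] carrier_matD[OF c]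
  let ?S = "simple_module q m s"
  have dS: "mdim ?S = m" "dim_row (action ?S y) = m" "dim_col (action ?S y) = m" for y
    using mod_shape_dim[OF mod_shape_simple, of m s y] by (auto simp: simple_module_eq)
  have "f \<in> module_hom ?S M"
  proof (rule homI)
    fix y
    show "f * action ?S y = action M y * f"
    proof (rule mat_eq_ucolI)
      fix j assume j: "j < m"
      have "f * (action ?S y * ucol m j) = action M y * (f * ucol m j)"
      proof (cases y)
        case Gen_a
        have "apow M Gen_a (Suc j) x = 0\<^sub>m (mdim M) (Suc 0)" if "\<not> Suc j < m"
          using that j am by (metis Suc_lessI)
        thus ?thesis using j d f unfolding Gen_a simple_ucol[OF j] by auto
      next
        case Gen_b
        thus ?thesis using j d sh hw_vector_apow(1)[OF M x] by (simp add: f simple_ucol mat_distrib)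
      next
        case Gen_c
        thus ?thesis using j d sh hw_vector_apow(2)[OF M x] by (simp add: f simple_ucol mat_distrib)
      next
        case Gen_d
        thus ?thesis using j d sh hw_vector_apow(3)[OF M x] by (simp add: f simple_ucol mat_distrib)
      qed
      thus "f * action ?S y * ucol m j = action M y * f * ucol m j"
        using d dS sh by (simp add: assoc_mult_mat_dim)
    qed (use d dS sh in auto)
  qed (use d dS in auto)
  with f(2) that show ?thesis by blast
qed

lemma mdim_simple [simp]: "mdim (simple_module q m s) = m"
  by (simp add: simple_module_eq)

lemma apow_ucol: "j < m \<Longrightarrow> apow (simple_module q m s) Gen_a j (ucol m 0) = ucol m j"
  by (induction j) (auto simp: simple_ucol)

lemma hom_from_simple_eqI:
  assumes f: "f \<in> module_hom (simple_module q m s) M" and g: "g \<in> module_hom (simple_module q m s) M"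
    and M: "mod_shape M" and eq: "f * ucol m 0 = g * ucol m 0"
  shows "f = g"
proof (rule mat_eq_ucolI)
  fix j assume j: "j < m"
  have u: "ucol m 0 \<in> carrier_mat (mdim (simple_module q m s)) (Suc 0)" by (auto intro: carrier_matI)
  show "f * ucol m j = g * ucol m j"
    unfolding apow_ucol[OF j, of s, symmetric] apow_hom[OF f mod_shape_simple M u]
      apow_hom[OF g mod_shape_simple M u] eq ..
qed (use homD[OF f] homD[OF g] in auto)

end

lemma one_smult_mat [simp]: "1 \<cdot>\<^sub>m (A :: 'a :: monoid_mult mat) = A"
  by (intro eq_matI) auto

context root_of_unity
begin

lemma avg_weight:
  assumes M: "is_module n q M" and x: "x \<in> carrier_mat (mdim M) (Suc 0)"
  shows "action M Gen_b * (avg (q powi (- s)) (action M Gen_b) * x) = q powi s \<cdot>\<^sub>m (avg (q powi (- s)) (action M Gen_b) * x)"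
    "action M Gen_c * (avg (q powi (- s)) (action M Gen_c) * x) = q powi s \<cdot>\<^sub>m (avg (q powi (- s)) (action M Gen_c) * x)"
proof -
  note sh = is_module_shape[OF M]
  note d = carrier_matD[OF x]
  show "action M Gen_b * (avg (q powi (- s)) (action M Gen_b) * x) = q powi s \<cdot>\<^sub>m (avg (q powi (- s)) (action M Gen_b) * x)"
    using mult_rewrite[OF avg_eigen[OF mod_shape_carrier[OF sh] module_pow(2)[OF M]]] d sh
    by (simp add: mat_distrib)
  show "action M Gen_c * (avg (q powi (- s)) (action M Gen_c) * x) = q powi s \<cdot>\<^sub>m (avg (q powi (- s)) (action M Gen_c) * x)"
    using mult_rewrite[OF avg_eigen[OF mod_shape_carrier[OF sh] module_pow(3)[OF M]]] d sh
    by (simp add: mat_distrib)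
qed

lemma avg_comm_weight:
  assumes M: "is_module n q M" and x: "x \<in> carrier_mat (mdim M) (Suc 0)" and b: "action M Gen_b * x = k \<cdot>\<^sub>m x"
  shows "action M Gen_b * (avg z (action M Gen_c) * x) = k \<cdot>\<^sub>m (avg z (action M Gen_c) * x)"
proof -
  note sh = is_module_shape[OF M]
  have "action M Gen_b * avg z (action M Gen_c) = avg (z * 1) (action M Gen_c) * action M Gen_b"
    by (rule avg_skew) (use M sh in \<open>auto simp: is_module_def Let_def intro!: eq_matI\<close>)
  from mult_rewrite[OF this] show ?thesis
    using carrier_matD[OF x] sh b by (simp add: assoc_mult_mat_dim mat_distrib)
qed

lemma avg_d_kernel:
  assumes M: "is_module n q M" and x: "x \<in> carrier_mat (mdim M) (Suc 0)"
    and dx: "action M Gen_d * x = 0\<^sub>m (mdim M) (Suc 0)"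
  shows "action M Gen_d * (avg z (action M Gen_b) * x) = 0\<^sub>m (mdim M) (Suc 0)"
    "action M Gen_d * (avg z (action M Gen_c) * x) = 0\<^sub>m (mdim M) (Suc 0)"
proof -
  note sh = is_module_shape[OF M]
  have "action M Gen_d * avg z (action M Gen_b) = avg (z * q) (action M Gen_b) * action M Gen_d"
    by (rule avg_skew) (use M sh in \<open>auto simp: is_module_def Let_def\<close>)
  from mult_rewrite[OF this] show "action M Gen_d * (avg z (action M Gen_b) * x) = 0\<^sub>m (mdim M) (Suc 0)"
    using carrier_matD[OF x] sh dx by (simp add: assoc_mult_mat_dim)
  have "action M Gen_d * avg z (action M Gen_c) = avg (z * q) (action M Gen_c) * action M Gen_d"
    by (rule avg_skew) (use M sh in \<open>auto simp: is_module_def Let_def\<close>)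
  from mult_rewrite[OF this] show "action M Gen_d * (avg z (action M Gen_c) * x) = 0\<^sub>m (mdim M) (Suc 0)"
    using carrier_matD[OF x] sh dx by (simp add: assoc_mult_mat_dim)
qed

lemma hom_avg:
  assumes f: "f \<in> module_hom M N" and sh: "mod_shape M" "mod_shape N"
  shows "f * avg z (action M g) = avg z (action N g) * f"
proof -
  have "f * avg z (action M g) = avg (z * 1) (action N g) * f"
    by (rule avg_skew) (use homD[OF f] sh in \<open>auto intro!: eq_matI\<close>)
  thus ?thesis by simp
qed

lemma avg_eigenvector:
  assumes B: "B \<in> carrier_mat m m" and x: "x \<in> carrier_mat m (Suc 0)" and Bx: "B * x = q powi s \<cdot>\<^sub>m x"
  shows "avg (q powi (- s)) B * x = of_nat n \<cdot>\<^sub>m x"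
proof -
  have p: "B ^\<^sub>m i * x = (q powi s) ^ i \<cdot>\<^sub>m x" for i
  proof (induction i)
    case 0 thus ?case using B x by (intro eq_matI) auto
  next
    case (Suc i)
    have "B ^\<^sub>m Suc i * x = B ^\<^sub>m i * (B * x)" using B x by (simp add: assoc_mult_mat_dim pow_mat_dim)
    thus ?case using Suc Bx B x by (simp add: mat_distrib smult_smult_mat pow_mat_dim del: pow_mat.simps)
  qed
  have z: "(q powi (- s)) ^ i * ((q powi s) ^ i * y) = y" for i y
    by (simp add: mult.assoc[symmetric] power_mult_distrib[symmetric] q_powi_simp)
  have "avg (q powi (- s)) B * x = mat m (Suc 0) (\<lambda>(j, k). \<Sum>i<n. (q powi (- s)) ^ i * ((q powi s) ^ i \<cdot>\<^sub>m x) $$ (j, k))"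
    using B x p by (subst avg_mult) auto
  also have "\<dots> = of_nat n \<cdot>\<^sub>m x"
    using x by (intro eq_matI) (auto simp: z)
  finally show ?thesis .
qed

lemma simple_dim:
  "dim_row (action (simple_module q m s) y) = m" "dim_col (action (simple_module q m s) y) = m"
  using mod_shape_dim[OF mod_shape_simple, of m s y] by auto

lemma alpha_prod_nonzero: "l \<le> n \<Longrightarrow> j < l \<Longrightarrow> (\<Prod>i=1..j. alpha q i l) \<noteq> 0"
  using alpha_nonzero[of _ l] by (auto simp: prod_zero_iff)

lemma apow_d_ucol:
  assumes "j < m" "i \<le> j"
  shows "apow (simple_module q m s) Gen_d i (ucol m j) = (\<Prod>k=j-i+1..j. alpha q k m) \<cdot>\<^sub>m ucol m (j - i)"
  using assms(2)
proof (induction i)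
  case 0
  show ?case by (auto intro!: eq_matI)
next
  case (Suc i)
  have "(\<Prod>k=j - Suc i + 1..j. alpha q k m) = alpha q (j - i) m * (\<Prod>k=j-i+1..j. alpha q k m)"
    using Suc.prems by (subst prod.atLeast_Suc_atMost) (auto simp: Suc_diff_Suc)
  thus ?case using Suc assms(1)
    by (simp add: mat_distrib simple_dim simple_ucol smult_smult_mat mult.commute)
qed

text \<open>A map out of \<open>V(n, s)\<close> is determined by the image \<open>w\<close> of the lowest weight vector, which
  can be lifted as a weight vector; applying \<open>d\<close> to the lift \<open>n - 1\<close> times yields a highest weight vector.\<close>

lemma projective_simple_n: "projective n q (simple_module q n s)"
proof (rule projectiveI)
  show "is_module n q (simple_module q n s)" by (rule is_module_simple) simp
  let ?S = "simple_module q n s"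
  fix X C g R f
  assume X: "is_module n q X" and C: "is_module n q C" and g: "g \<in> module_hom X C"
    and R: "R \<in> carrier_mat (mdim X) (mdim C)" "g * R = 1\<^sub>m (mdim C)" and f: "f \<in> module_hom ?S C"
  note sh = is_module_shape[OF X] is_module_shape[OF C]
  note d = homD(2,3)[OF g] homD(2,3)[OF f] carrier_matD[OF R(1)]
  have n1: "n - 1 < n" "0 < n" using n_gt_2 by auto
  have uc: "ucol n j \<in> carrier_mat (mdim ?S) (Suc 0)" for j by (auto intro: carrier_matI)
  \<comment> \<open>The last basis vector of \<open>V(n, s)\<close> is the useful generator: it is
    characterised by its weight, and \<open>d^(n-1)\<close> carries it to a nonzero multiple of the
    first.\<close>
  define w where "w = f * ucol n (n - 1)"
  have wc: "w \<in> carrier_mat (mdim C) (Suc 0)" using d by (auto simp: w_def intro: carrier_matI)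
  have hw: "f * (action ?S y * ucol n j) = action C y * (f * ucol n j)" for y j
    using apow_hom[OF f mod_shape_simple sh(2) uc, of y 1] by simp
  have wb: "action C Gen_b * w = q powi (s + int n - 1) \<cdot>\<^sub>m w"
    and wcc: "action C Gen_c * w = q powi (- s) \<cdot>\<^sub>m w"
    using n_gt_2 d unfolding w_def hw[symmetric] simple_ucol[OF n1(1)]
    by (simp_all add: mat_distrib of_nat_diff algebra_simps)
  define u0 where "u0 = R * w"
  have u0: "u0 \<in> carrier_mat (mdim X) (Suc 0)" "g * u0 = w"
    using d R wc mult_rewrite[OF R(2), of w] by (auto simp: u0_def intro: carrier_matI)
  \<comment> \<open>An arbitrary linear lift of \<open>w\<close> is projected to the right weight,
    first for \<open>b\<close> and then for \<open>c\<close>. The projections commute with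
    \<open>g\<close>, so each multiplies the image in \<open>C\<close> by \<open>n\<close>.\<close>
  define u1 where "u1 = avg (q powi (- (s + int n - 1))) (action X Gen_b) * u0"
  have u1: "u1 \<in> carrier_mat (mdim X) (Suc 0)" using u0 sh by (auto simp: u1_def intro: carrier_matI)
  have u1b: "action X Gen_b * u1 = q powi (s + int n - 1) \<cdot>\<^sub>m u1"
    unfolding u1_def by (rule avg_weight[OF X u0(1)])
  have gu1: "g * u1 = of_nat n \<cdot>\<^sub>m w"
  proof -
    have "g * u1 = avg (q powi (- (s + int n - 1))) (action C Gen_b) * w"
      unfolding u1_def using mult_rewrite[OF hom_avg[OF g sh]] u0 d sh by (simp add: assoc_mult_mat_dim)
    thus ?thesis using avg_eigenvector[OF mod_shape_carrier[OF sh(2)] wc wb] by simp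
  qed
  define u where "u = avg (q powi (- (- s))) (action X Gen_c) * u1"
  have u: "u \<in> carrier_mat (mdim X) (Suc 0)" using u1 sh by (auto simp: u_def intro: carrier_matI)
  have ub: "action X Gen_b * u = q powi (s + int n - 1) \<cdot>\<^sub>m u"
    unfolding u_def by (rule avg_comm_weight[OF X u1 u1b])
  have uc: "action X Gen_c * u = q powi (- s) \<cdot>\<^sub>m u"
    unfolding u_def by (rule avg_weight[OF X u1])
  have gu: "g * u = (of_nat n * of_nat n) \<cdot>\<^sub>m w"
  proof -
    have "g * u = avg (q powi (- (- s))) (action C Gen_c) * (of_nat n \<cdot>\<^sub>m w)"
      unfolding u_def using mult_rewrite[OF hom_avg[OF g sh]] u1 d sh gu1 by (simp add: assoc_mult_mat_dim)
    also have "\<dots> = of_nat n \<cdot>\<^sub>m (avg (q powi (- (- s))) (action C Gen_c) * w)"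
      using wc sh by (simp add: mat_distrib)
    finally show ?thesis unfolding avg_eigenvector[OF mod_shape_carrier[OF sh(2)] wc wcc] smult_smult_mat .
  qed
  have wt: "action X Gen_b * apow X Gen_d i u = q powi (s + int n - 1 - int i) \<cdot>\<^sub>m apow X Gen_d i u \<and>
      action X Gen_c * apow X Gen_d i u = q powi (- s - int i) \<cdot>\<^sub>m apow X Gen_d i u" for i
  proof (induction i)
    case 0
    thus ?case using ub uc by simp
  next
    case (Suc i)
    note c = apow_carrier[OF sh(1) u, of Gen_d i]
    note dc = carrier_matD[OF c]
    have inv: "Y = (inverse q * k) \<cdot>\<^sub>m Z" if "k \<cdot>\<^sub>m Z = q \<cdot>\<^sub>m Y" for k and Y Z :: "'k mat"
      using arg_cong[OF that, of "\<lambda>T. inverse q \<cdot>\<^sub>m T"] by (simp add: smult_smult_mat)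
    have "s + int n - 1 - int (Suc i) = -1 + (s + int n - 1 - int i)" "- s - int (Suc i) = -1 + (- s - int i)" by simp_all
    hence e: "q powi (s + int n - 1 - int (Suc i)) = inverse q * q powi (s + int n - 1 - int i)"
      "q powi (- s - int (Suc i)) = inverse q * q powi (- s - int i)"
      by (simp_all only: q_powi_add) (simp_all add: power_int_minus)
    show ?case unfolding e apow_Suc
      using Suc module_rel(2,4)[OF X c] dc sh
      by (intro conjI inv) (simp_all add: mat_distrib)
  qed
  \<comment> \<open>The two averages contribute \<open>n^2\<close>, the operator
    \<open>d^(n-1)\<close> the product of all \<alpha>; dividing by \<open>K\<close> makes
    \<open>g\<close> send \<open>x\<close> exactly to the image of the first basis vector.\<close>
  define K where "K = (of_nat n * of_nat n) * (\<Prod>i=1..n-1. alpha q i n)"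
  have K: "K \<noteq> 0" using of_nat_n_nonzero alpha_prod_nonzero[of n "n - 1"] n1 by (simp add: K_def)
  define x where "x = inverse K \<cdot>\<^sub>m apow X Gen_d (n - 1) u"
  note cn = apow_carrier[OF sh(1) u, of Gen_d "n - 1"]
  have dx: "action X Gen_d * apow X Gen_d (n - 1) u = 0\<^sub>m (mdim X) (Suc 0)"
    using apow_n[OF X u, of Gen_d n] n_gt_2 by (simp flip: apow_Suc)
  have "s + int n - 1 - int (n - 1) = s" "- s - int (n - 1) = 1 - s - int n" using n_gt_2 by simp_all
  note wn = wt[of "n - 1", unfolded this]
  have "hw_vector X n s x"
    unfolding hw_vector_def x_def using wn dx cn sh
    by (auto simp: mat_distrib smult_smult_mat mult.commute intro!: eq_matI)
  \<comment> \<open>For dimension \<open>n\<close> the truncation condition \<open>a^n x = 0\<close>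
    is a relation of the algebra; this is what singles out \<open>V(n, s)\<close> among the simple
    modules.\<close>
  then obtain h where h: "h \<in> module_hom ?S X" "\<And>j. j < n \<Longrightarrow> h * ucol n j = apow X Gen_a j x"
    using hom_from_simple[OF X, of n s x] apow_n[OF X, of x Gen_a n] by (auto simp: hw_vector_def)
  have "g * (h * ucol n 0) = f * ucol n 0"
  proof -
    have "g * (h * ucol n 0) = inverse K \<cdot>\<^sub>m (g * apow X Gen_d (n - 1) u)"
      using h(2)[of 0] n1 d carrier_matD[OF cn] by (simp add: x_def mat_distrib)
    also have "g * apow X Gen_d (n - 1) u = apow C Gen_d (n - 1) ((of_nat n * of_nat n) \<cdot>\<^sub>m w)"
      unfolding apow_hom[OF g sh u] gu ..
    also have "\<dots> = (of_nat n * of_nat n) \<cdot>\<^sub>m apow C Gen_d (n - 1) w"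
      using wc sh by (simp add: apow_eq mat_distrib pow_mat_dim)
    also have "apow C Gen_d (n - 1) w = f * apow ?S Gen_d (n - 1) (ucol n (n - 1))"
      unfolding w_def by (rule apow_hom[OF f mod_shape_simple sh(2), symmetric]) (auto intro: carrier_matI)
    also have "\<dots> = (\<Prod>i=1..n-1. alpha q i n) \<cdot>\<^sub>m (f * ucol n 0)"
      using apow_d_ucol[OF n1(1), of "n - 1" s] d by (simp add: mat_distrib)
    also have "inverse K \<cdot>\<^sub>m ((of_nat n * of_nat n) \<cdot>\<^sub>m ((\<Prod>i=1..n-1. alpha q i n) \<cdot>\<^sub>m (f * ucol n 0))) =
        (inverse K * K) \<cdot>\<^sub>m (f * ucol n 0)"
      by (simp only: smult_smult_mat K_def mult.assoc)
    finally show ?thesis using K by simp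
  qed
  hence "g * h = f"
    by (intro hom_from_simple_eqI[OF hom_comp[OF g h(1)] f])
      (use d sh homD(2,3)[OF h(1)] in \<open>auto simp: assoc_mult_mat_dim\<close>)
  thus "\<exists>h\<in>module_hom ?S X. g * h = f" using h by blast
qed

text \<open>Nilpotency of \<open>d\<close> gives a nonzero vector killed by it; projecting to a
  weight of \<open>b\<close> and then to one of \<open>c\<close> keeps it in the kernel of
  \<open>d\<close>, and some choice of weights keeps it nonzero.\<close>

lemma hw_vector_exists:
  assumes M: "is_module n q M" and "mdim M > 0"
  obtains l s x where "1 \<le> l" "l \<le> n" "hw_vector M l s x" "x \<noteq> 0\<^sub>m (mdim M) (Suc 0)"
proof -
  note sh = is_module_shape[OF M]
  let ?O = "0\<^sub>m (mdim M) (Suc 0) :: 'k mat"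
  have x0: "ucol (mdim M) 0 \<in> carrier_mat (mdim M) (Suc 0)" "ucol (mdim M) 0 \<noteq> ?O"
    using assms(2) by (auto intro: carrier_matI simp: ucol_def mat_eq_iff index_mono_mat)
  define k where "k = (LEAST k. apow M Gen_d k (ucol (mdim M) 0) = ?O)"
  have kn: "apow M Gen_d n (ucol (mdim M) 0) = ?O" by (rule apow_n[OF M x0(1)]) auto
  have k: "apow M Gen_d k (ucol (mdim M) 0) = ?O" unfolding k_def by (rule LeastI, rule kn)
  have k0: "k \<noteq> 0" using k x0 by (cases k) auto
  define x1 where "x1 = apow M Gen_d (k - 1) (ucol (mdim M) 0)"
  have x1c: "x1 \<in> carrier_mat (mdim M) (Suc 0)" unfolding x1_def by (rule apow_carrier[OF sh x0(1)])
  have x1: "x1 \<noteq> ?O" unfolding x1_def k_def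
    by (rule not_less_Least) (use k0 in \<open>simp add: k_def\<close>)
  have dx1: "action M Gen_d * x1 = ?O" using k k0 by (cases k) (auto simp: x1_def)
  obtain s :: int where s: "avg (q powi (- s)) (action M Gen_b) * x1 \<noteq> ?O"
    using avg_nonzero[OF mod_shape_carrier[OF sh] module_pow(2)[OF M] x1c x1] by blast
  define x2 where "x2 = avg (q powi (- s)) (action M Gen_b) * x1"
  have x2c: "x2 \<in> carrier_mat (mdim M) (Suc 0)" using x1c sh by (auto simp: x2_def intro: carrier_matI)
  have x2b: "action M Gen_b * x2 = q powi s \<cdot>\<^sub>m x2" unfolding x2_def by (rule avg_weight[OF M x1c])
  have dx2: "action M Gen_d * x2 = ?O" unfolding x2_def by (rule avg_d_kernel[OF M x1c dx1])
  obtain t :: int where t: "avg (q powi (- t)) (action M Gen_c) * x2 \<noteq> ?O"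
    using avg_nonzero[OF mod_shape_carrier[OF sh] module_pow(3)[OF M] x2c s[folded x2_def]] by blast
  define x where "x = avg (q powi (- t)) (action M Gen_c) * x2"
  have xc: "x \<in> carrier_mat (mdim M) (Suc 0)" using x2c sh by (auto simp: x_def intro: carrier_matI)
  have xb: "action M Gen_b * x = q powi s \<cdot>\<^sub>m x" unfolding x_def by (rule avg_comm_weight[OF M x2c x2b])
  have xcc: "action M Gen_c * x = q powi t \<cdot>\<^sub>m x" unfolding x_def by (rule avg_weight[OF M x2c])
  have dx: "action M Gen_d * x = ?O" unfolding x_def by (rule avg_d_kernel[OF M x2c dx2])
  \<comment> \<open>The representative in \<open>1..n\<close> of the class determined by
    \<open>t = 1 - s - l\<close> modulo \<open>n\<close>, so that the eigenvalues fit the label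
    \<open>l\<close>.\<close>
  define l where "l = nat ((- s - t) mod int n) + 1"
  have l: "1 \<le> l" "l \<le> n" using n_gt_2 by (auto simp: l_def Suc_le_eq nat_less_iff)
  have "int l = (- s - t) mod int n + 1" using n_gt_2 by (simp add: l_def)
  hence "t - (1 - s - int l) = - ((- s - t) - (- s - t) mod int n)" by simp
  hence "int n dvd t - (1 - s - int l)" by (metis dvd_minus_iff dvd_minus_mod)
  hence "q powi t = q powi (1 - s - int l)" by (rule q_powi_cong)
  hence "hw_vector M l s x" unfolding hw_vector_def using xc xb xcc dx by simp
  thus ?thesis using that l t x_def by blast
qed

text \<open>Let \<open>x\<close> be a highest weight vector with label \<open>l\<close>. If
  \<open>a^l x = 0\<close>, it generates an image of \<open>V(l, s)\<close>. Otherwise let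
  \<open>m\<close> be least with \<open>a^m x = 0\<close>: applying \<open>d\<close> forces \<alpha>
  to vanish at \<open>m > l\<close>, which leaves only \<open>m = n\<close>, and
  \<open>a^l x\<close> is a highest weight vector generating an image of
  \<open>V(n - l, s + l)\<close>.\<close>

lemma hom_from_simple_exists:
  assumes M: "is_module n q M" and "mdim M > 0"
  obtains m s f where "1 \<le> m" "m \<le> n" "f \<in> module_hom (simple_module q m s) M" "f \<noteq> 0\<^sub>m (mdim M) m"
proof -
  note sh = is_module_shape[OF M]
  let ?O = "0\<^sub>m (mdim M) (Suc 0) :: 'k mat"
  obtain l s x where l: "1 \<le> l" "l \<le> n" and x: "hw_vector M l s x" "x \<noteq> ?O"
    using hw_vector_exists[OF assms] by blast
  have xc: "x \<in> carrier_mat (mdim M) (Suc 0)" using x by (simp add: hw_vector_def)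
  have key: thesis if h: "1 \<le> m" "m \<le> n" "hw_vector M m s' y" "y \<noteq> ?O" "apow M Gen_a m y = ?O" for m s' y
  proof -
    obtain f where f: "f \<in> module_hom (simple_module q m s') M" "\<And>j. j < m \<Longrightarrow> f * ucol m j = apow M Gen_a j y"
      using hom_from_simple[OF M h(3,5)] by blast
    have "f * ucol m 0 = y" using f(2)[of 0] h by simp
    hence "f \<noteq> 0\<^sub>m (mdim M) m" using h(4) by auto
    thus thesis using h(1,2) f(1) \<open>\<And>m f s. 1 \<le> m \<Longrightarrow> m \<le> n \<Longrightarrow> f \<in> module_hom (simple_module q m s) M \<Longrightarrow> f \<noteq> 0\<^sub>m (mdim M) m \<Longrightarrow> thesis\<close> by blast
  qed
  show ?thesis
  proof (cases "apow M Gen_a l x = ?O")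
    case True
    thus ?thesis using key l x by blast
  next
    case False
    define m where "m = (LEAST m. apow M Gen_a m x = ?O)"
    have mn: "apow M Gen_a n x = ?O" by (rule apow_n[OF M xc]) auto
    have m: "apow M Gen_a m x = ?O" unfolding m_def by (rule LeastI, rule mn)
    have mle: "m \<le> n" unfolding m_def by (rule Least_le, rule mn)
    have m0: "m \<noteq> 0" using m x by (cases m) auto
    have m1: "apow M Gen_a (m - 1) x \<noteq> ?O" unfolding m_def
      by (rule not_less_Least) (use m0 in \<open>simp add: m_def\<close>)
    have "alpha q m l \<cdot>\<^sub>m apow M Gen_a (m - 1) x = ?O"
      using hw_vector_apow(3)[OF M x(1), of m] m sh by simp
    hence am: "alpha q m l = 0"
      using m1 apow_carrier[OF sh xc] by (subst (asm) smult_mat_eq_zero_iff) auto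
    have lm: "l < m"
    proof (rule ccontr)
      assume "\<not> l < m"
      hence "m \<le> l" by simp
      moreover have "m \<noteq> l" using m False by auto
      ultimately show False using alpha_nonzero[of m l] am m0 l by auto
    qed
    have "m = n"
    proof (rule ccontr)
      assume "m \<noteq> n"
      hence mn: "m < n" using mle by simp
      have "q powi (int m - int l) = 1" using am q_int_nonzero[of m] m0 mn by (auto simp: alpha_def)
      hence "int n dvd int m - int l" by (simp only: q_powi_eq_1_iff)
      thus False using lm mn zdvd_not_zless[of "int m - int l" "int n"] by auto
    qed
    have y: "hw_vector M (n - l) (s + int l) (apow M Gen_a l x)"
      unfolding hw_vector_def
    proof (intro conjI)
      show "apow M Gen_a l x \<in> carrier_mat (mdim M) (Suc 0)" by (rule apow_carrier[OF sh xc])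
      show "action M Gen_d * apow M Gen_a l x = 0\<^sub>m (mdim M) (Suc 0)"
        using hw_vector_apow(3)[OF M x(1), of l] carrier_matD[OF apow_carrier[OF sh xc]]
        by (auto intro!: eq_matI)
      show "action M Gen_b * apow M Gen_a l x = q powi (s + int l) \<cdot>\<^sub>m apow M Gen_a l x"
        by (rule hw_vector_apow[OF M x(1)])
      have "q powi (1 - (s + int l) - int (n - l)) = q powi (int l + 1 - s - int l)"
        using l by (intro q_powi_cong) (simp add: of_nat_diff)
      thus "action M Gen_c * apow M Gen_a l x = q powi (1 - (s + int l) - int (n - l)) \<cdot>\<^sub>m apow M Gen_a l x"
        using hw_vector_apow(2)[OF M x(1), of l] by simp
    qed
    have "apow M Gen_a (n - l) (apow M Gen_a l x) = ?O"
      using mn l by (simp flip: apow_add)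
    thus ?thesis using key[OF _ _ y False] lm \<open>m = n\<close> by auto
  qed
qed

end

section \<open>A duality that fixes the simple modules\<close>

definition swap_gen :: "gen \<Rightarrow> gen" where
  "swap_gen x = (case x of Gen_a \<Rightarrow> Gen_d | Gen_d \<Rightarrow> Gen_a | Gen_b \<Rightarrow> Gen_b | Gen_c \<Rightarrow> Gen_c)"

text \<open>The dual space, made into a left module by the anti-automorphism exchanging \<open>a\<close> and \<open>d\<close>
  rather than by the antipode.\<close>

definition flip_module :: "'k::field hmod \<Rightarrow> 'k hmod" where
  "flip_module M = \<lparr>mdim = mdim M, action = (\<lambda>x. transpose_mat (action M (swap_gen x)))\<rparr>"

lemma flip_module_simps [simp]:
  "mdim (flip_module M) = mdim M" "action (flip_module M) Gen_a = transpose_mat (action M Gen_d)"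
  "action (flip_module M) Gen_b = transpose_mat (action M Gen_b)"
  "action (flip_module M) Gen_c = transpose_mat (action M Gen_c)"
  "action (flip_module M) Gen_d = transpose_mat (action M Gen_a)"
  by (simp_all add: flip_module_def swap_gen_def)

lemma mod_shape_flip [simp]: "mod_shape M \<Longrightarrow> mod_shape (flip_module M)"
  unfolding mod_shape_def by (simp add: flip_module_def)

lemma flip_flip [simp]: "flip_module (flip_module M) = M"
  by (rule hmod_eqI) simp_all

lemma hom_flip:
  assumes f: "f \<in> module_hom M N" and sh: "mod_shape M" "mod_shape N"
  shows "transpose_mat f \<in> module_hom (flip_module N) (flip_module M)"
proof (rule homI)
  fix x
  let ?y = "swap_gen x"
  have "transpose_mat (f * action M ?y) = transpose_mat (action N ?y * f)" by (simp only: homD(4)[OF f])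
  hence "transpose_mat (action M ?y) * transpose_mat f = transpose_mat f * transpose_mat (action N ?y)"
    using transpose_mult[OF homD(1)[OF f] mod_shape_carrier[OF sh(1)]]
      transpose_mult[OF mod_shape_carrier[OF sh(2)] homD(1)[OF f]] by metis
  thus "transpose_mat f * action (flip_module N) x = action (flip_module M) x * transpose_mat f"
    by (simp add: flip_module_def)
qed (use homD(2,3)[OF f] in auto)

lemma index_mono_mat_mult:
  assumes "i < r" "j < dim_col W" "dim_row W = c"
  shows "(mono_mat r c s f * W) $$ (i, j) = (if 0 \<le> int i - s \<and> int i - s < int c
    then f (nat (int i - s)) * W $$ (nat (int i - s), j) else 0)"
proof -
  have "(mono_mat r c s f * W) $$ (i, j) = (\<Sum>k<c. mono_mat r c s f $$ (i, k) * W $$ (k, j))"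
    using assms by (subst index_mult_mat_sum) auto
  also have "\<dots> = (\<Sum>k<c. if k = nat (int i - s) \<and> 0 \<le> int i - s then f k * W $$ (k, j) else 0)"
    using assms by (intro sum.cong) (auto simp: index_mono_mat)
  finally show ?thesis by (cases "0 \<le> int i - s") (auto simp: nat_less_iff)
qed

lemma mult_mat_zero_vec: "A \<in> carrier_mat r c \<Longrightarrow> A *\<^sub>v 0\<^sub>v c = (0\<^sub>v r :: 'k::field vec)"
  by (intro eq_vecI) auto

lemma mat_kernel_submodule:
  assumes f: "f \<in> module_hom M N" and sh: "mod_shape M" "mod_shape N"
  shows "is_submodule (mat_kernel f) M"
proof -
  have fc: "f \<in> carrier_mat (mdim N) (mdim M)" by (rule homD[OF f])
  have "submodule class_ring (mat_kernel f) (module_vec TYPE('a) (mdim M))"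
    by (unfold submodule_def)
      (auto simp: vec_module module_vec_simps class_ring_simps mat_kernel[OF fc]
        mult_add_distrib_mat_vec[OF fc] mult_mat_vec[OF fc] mult_mat_zero_vec[OF fc])
  moreover have "action M x *\<^sub>v u \<in> mat_kernel f" if "u \<in> mat_kernel f" for x u
  proof (rule mat_kernelI[OF fc])
    have u: "u \<in> carrier_vec (mdim M)" "f *\<^sub>v u = 0\<^sub>v (mdim N)" using mat_kernelD[OF fc that] by auto
    show "action M x *\<^sub>v u \<in> carrier_vec (mdim M)" using sh u by (intro mult_mat_vec_carrier) auto
    have "f *\<^sub>v (action M x *\<^sub>v u) = (f * action M x) *\<^sub>v u"
      using assoc_mult_mat_vec[OF fc mod_shape_carrier[OF sh(1)] u(1)] by simp
    also have "\<dots> = action N x *\<^sub>v (f *\<^sub>v u)"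
      unfolding homD(4)[OF f] using assoc_mult_mat_vec[OF mod_shape_carrier[OF sh(2)] fc u(1)] by simp
    finally show "f *\<^sub>v (action M x *\<^sub>v u) = 0\<^sub>v (mdim N)"
      using u mult_mat_zero_vec[OF mod_shape_carrier[OF sh(2)]] by simp
  qed
  ultimately show ?thesis unfolding is_submodule_def subspace_def by (simp add: vec_vs)
qed

lemma mat_image_submodule:
  assumes f: "f \<in> module_hom M N" and sh: "mod_shape M" "mod_shape N"
  shows "is_submodule ((*\<^sub>v) f ` carrier_vec (mdim M)) N"
proof -
  have fc: "f \<in> carrier_mat (mdim N) (mdim M)" by (rule homD[OF f])
  let ?U = "(*\<^sub>v) f ` carrier_vec (mdim M)"
  have "submodule class_ring ?U (module_vec TYPE('a) (mdim N))"
  proof (unfold submodule_def, intro conjI allI impI)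
    show "Module.module class_ring (module_vec TYPE('a) (mdim N))" by (rule vec_module)
    show "?U \<subseteq> carrier (module_vec TYPE('a) (mdim N))" using fc by (auto simp: module_vec_simps)
    have "f *\<^sub>v 0\<^sub>v (mdim M) = 0\<^sub>v (mdim N)" by (rule mult_mat_zero_vec[OF fc])
    thus "\<zero>\<^bsub>module_vec TYPE('a) (mdim N)\<^esub> \<in> ?U" unfolding module_vec_simps
      by (metis imageI zero_carrier_vec)
    fix v w assume "v \<in> ?U" "w \<in> ?U"
    then obtain x y where "x \<in> carrier_vec (mdim M)" "y \<in> carrier_vec (mdim M)" "v = f *\<^sub>v x" "w = f *\<^sub>v y" by auto
    thus "v \<oplus>\<^bsub>module_vec TYPE('a) (mdim N)\<^esub> w \<in> ?U" unfolding module_vec_simps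
      using mult_add_distrib_mat_vec[OF fc] by (metis add_carrier_vec imageI)
  next
    fix c :: 'a and v assume "v \<in> ?U"
    then obtain x where "x \<in> carrier_vec (mdim M)" "v = f *\<^sub>v x" by auto
    thus "c \<odot>\<^bsub>module_vec TYPE('a) (mdim N)\<^esub> v \<in> ?U" unfolding module_vec_simps
      using mult_mat_vec[OF fc] by (metis imageI smult_carrier_vec)
  qed
  moreover have "action N x *\<^sub>v u \<in> ?U" if u: "u \<in> ?U" for x u
  proof -
    obtain w where w: "w \<in> carrier_vec (mdim M)" "u = f *\<^sub>v w" using u by auto
    have "action N x *\<^sub>v u = f *\<^sub>v (action M x *\<^sub>v w)"
      unfolding w(2) using assoc_mult_mat_vec[OF mod_shape_carrier[OF sh(2)] fc w(1)]
        assoc_mult_mat_vec[OF fc mod_shape_carrier[OF sh(1)] w(1)] homD(4)[OF f] by metis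
    moreover have "action M x *\<^sub>v w \<in> carrier_vec (mdim M)" using sh w by (intro mult_mat_vec_carrier) auto
    ultimately show ?thesis by blast
  qed
  ultimately show ?thesis unfolding is_submodule_def subspace_def by (simp add: vec_vs)
qed

context root_of_unity
begin

text \<open>Reversing products and exchanging \<open>a\<close> with \<open>d\<close> interchanges
  \<open>ba = qab\<close> with \<open>db = qbd\<close> and \<open>ca = qac\<close> with
  \<open>dc = qcd\<close>, and leaves \<open>da - qad = 1 - bc\<close> as it is.\<close>

lemma is_module_flip:
  assumes M: "is_module n q M"
  shows "is_module n q (flip_module M)"
proof -
  note sh = is_module_shape[OF M]
  note R = M[unfolded is_module_def Let_def, THEN conjunct2]
  have t: "transpose_mat (action M x) * transpose_mat (action M y) = transpose_mat (action M y * action M x)" for x y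
    using transpose_mult[OF mod_shape_carrier[OF sh] mod_shape_carrier[OF sh]] by simp
  have p: "transpose_mat (action M x) ^\<^sub>m k = transpose_mat (action M x ^\<^sub>m k)" for x k
  proof (induction k)
    case (Suc k)
    have "transpose_mat (action M x) ^\<^sub>m Suc k = transpose_mat (action M x ^\<^sub>m k) * transpose_mat (action M x)"
      using Suc by simp
    also have "\<dots> = transpose_mat (action M x * action M x ^\<^sub>m k)"
      by (rule transpose_mult[symmetric, OF mod_shape_carrier[OF sh]]) (use sh in \<open>auto intro: pow_carrier_mat\<close>)
    finally show ?case using sh by (simp add: pow_mat_Suc_left[of _ "mdim M"] del: pow_mat.simps(2))
  qed (use sh in auto)
  have s: "k \<cdot>\<^sub>m transpose_mat A = transpose_mat (k \<cdot>\<^sub>m A)" for k :: 'k and A by (intro eq_matI) auto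
  have m: "transpose_mat A - transpose_mat B = transpose_mat (A - B)"
    if "dim_row A = dim_row B" "dim_col A = dim_col B" for A B :: "'k mat"
    using that by (intro eq_matI) auto
  have o: "1\<^sub>m k - transpose_mat B = transpose_mat (1\<^sub>m k - B)" if "dim_row B = k" "dim_col B = k"
    for B :: "'k mat" and k using that by (intro eq_matI) auto
  have bc: "action M Gen_c * action M Gen_b = action M Gen_b * action M Gen_c" using R by simp
  have da: "action M Gen_d * action M Gen_a - q \<cdot>\<^sub>m (action M Gen_a * action M Gen_d) = 1\<^sub>m (mdim M) - action M Gen_b * action M Gen_c"
    using R by blast
  show ?thesis
    unfolding is_module_def Let_def flip_module_simps t p s
    using R sh mod_shape_flip[OF sh]
    by (auto simp: mod_shape_def[of "flip_module M"] m o bc da)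
qed

text \<open>Transposition puts the coefficients \<alpha> on the raising operator and ones on the
  lowering one; rescaling the basis by the partial products of \<alpha>, all nonzero for
  \<open>m \<le> n\<close>, undoes this.\<close>

lemma hom_flip_simple:
  assumes m: "m \<le> n"
  shows "mono_mat m m 0 (\<lambda>j. inverse (\<Prod>i=1..j. alpha q i m)) \<in> module_hom (flip_module (simple_module q m s)) (simple_module q m s)"
    (is "?t \<in> _")
proof (rule homI)
  have T: "transpose_mat (mono_mat r c s f) = mono_mat c r (- s) (\<lambda>j. f (nat (int j - s)))" for r c s and f :: "nat \<Rightarrow> 'k"
    by (intro eq_matI) (auto simp: index_mono_mat intro!: arg_cong[of _ _ f])
  fix x
  show "?t * action (flip_module (simple_module q m s)) x = action (simple_module q m s) x * ?t"
  proof (cases x)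
    case Gen_a
    show ?thesis unfolding Gen_a simple_module_eq flip_module_simps hw_module_simps T mono_mat_mult
    proof (rule mono_mat_eqI)
      fix i j assume ij: "i < m" "j < m" "int i = int j + (0 + - (- 1))"
      hence "nat (int j + - (- 1)) = Suc j" "nat (int j - - 1) = Suc j" by auto
      moreover have "inverse (\<Prod>i=1..Suc j. alpha q i m) * alpha q (Suc j) m = inverse (\<Prod>i=1..j. alpha q i m)"
        using alpha_nonzero[of "Suc j" m] ij m by simp
      ultimately show "(if 0 \<le> int j + - (- 1) \<and> int j + - (- 1) < int m
           then inverse (\<Prod>i = 1..nat (int j + - (- 1)). alpha q i m) * alpha q (nat (int j - - 1)) m else 0) =
          (if 0 \<le> int j + 0 \<and> int j + 0 < int m then 1 * inverse (\<Prod>i = 1..j. alpha q i m) else 0)"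
        using ij by auto
    qed simp
  next
    case Gen_d
    show ?thesis unfolding Gen_d simple_module_eq flip_module_simps hw_module_simps T mono_mat_mult
    proof (rule mono_mat_eqI)
      fix i j assume ij: "i < m" "j < m" "int i = int j + (0 + - 1)"
      then obtain k where k: "j = Suc k" by (cases j) auto
      have e: "alpha q (Suc k) m * inverse (\<Prod>i=1..j. alpha q i m) = inverse (\<Prod>i=1..k. alpha q i m)"
        using alpha_nonzero[of "Suc k" m] ij m k by simp
      have n: "nat (int j + 0) = Suc k" "nat (int j + - 1) = k" using k by auto
      show "(if 0 \<le> int j + - 1 \<and> int j + - 1 < int m
           then inverse (\<Prod>i = 1..nat (int j + - 1). alpha q i m) * 1 else 0) =
          (if 0 \<le> int j + 0 \<and> int j + 0 < int m then alpha q (nat (int j + 0)) m * inverse (\<Prod>i = 1..j. alpha q i m) else 0)"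
        unfolding n e using ij by auto
    qed simp
  qed (auto simp: simple_module_eq T mono_mat_mult intro!: mono_mat_eqI)
qed (simp_all)

text \<open>A map from a simple module into the flipped module transposes to a map onto a flipped
  simple module, which is simple with the same label.\<close>

lemma hom_to_simple_exists:
  assumes M: "is_module n q M" and "mdim M > 0"
  obtains m s f where "1 \<le> m" "m \<le> n" "f \<in> module_hom M (simple_module q m s)" "f \<noteq> 0\<^sub>m m (mdim M)"
proof -
  note sh = is_module_shape[OF M]
  obtain m s f where f: "1 \<le> m" "m \<le> n" "f \<in> module_hom (simple_module q m s) (flip_module M)" "f \<noteq> 0\<^sub>m (mdim M) m"
    using hom_from_simple_exists[OF is_module_flip[OF M]] assms(2) unfolding flip_module_simps by blast
  define t where "t = mono_mat m m 0 (\<lambda>j. inverse (\<Prod>i=1..j. alpha q i m))"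
  define t' where "t' = mono_mat m m 0 (\<lambda>j. \<Prod>i=1..j. alpha q i m)"
  have tt: "t' * t = 1\<^sub>m m"
    unfolding t_def t'_def mono_mat_mult one_eq_mono_mat
    using alpha_prod_nonzero[OF f(2)] by (intro mono_mat_eqI) auto
  have fT: "transpose_mat f \<in> module_hom M (flip_module (simple_module q m s))"
    using hom_flip[OF f(3) mod_shape_simple mod_shape_flip[OF sh]] by simp
  have "t * transpose_mat f \<in> module_hom M (simple_module q m s)"
    unfolding t_def by (rule hom_comp[OF hom_flip_simple[OF f(2)] fT]) (use sh in auto)
  moreover have "t * transpose_mat f \<noteq> 0\<^sub>m m (mdim M)"
  proof
    note d = homD(2,3)[OF f(3)]
    assume "t * transpose_mat f = 0\<^sub>m m (mdim M)"
    hence "t' * (t * transpose_mat f) = 0\<^sub>m m (mdim M)" by (simp add: t'_def)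
    moreover have "t' * (t * transpose_mat f) = transpose_mat f"
      using mult_rewrite[OF tt, of "transpose_mat f"] d by (simp add: t_def t'_def)
    ultimately have "transpose_mat f = 0\<^sub>m m (mdim M)" by simp
    hence "transpose_mat (transpose_mat f) = 0\<^sub>m (mdim M) m" by simp
    thus False using f(4) by simp
  qed
  ultimately show ?thesis using that f by blast
qed

section \<open>Homomorphisms onto and between simple modules\<close>

lemma apow_smult:
  assumes "mod_shape M" "x \<in> carrier_mat (mdim M) (Suc 0)"
  shows "apow M g i (c \<cdot>\<^sub>m x) = c \<cdot>\<^sub>m apow M g i x"
  using assms carrier_matD[OF apow_carrier[OF assms]] by (induction i) (simp_all add: mat_distrib)

text \<open>The last conclusion expresses that the linear section \<open>S\<close> takes values in the submodule
  generated by \<open>u\<close>.\<close>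

lemma simple_section:
  assumes M: "is_module n q M" and m: "m \<le> n" and p: "p \<in> module_hom M (simple_module q m s)"
    and u: "u \<in> carrier_mat (mdim M) (Suc 0)" and pu: "p * u \<noteq> 0\<^sub>m m (Suc 0)"
  obtains S where "S \<in> carrier_mat (mdim M) m" "p * S = 1\<^sub>m m"
    "\<And>N f. f \<in> module_hom M N \<Longrightarrow> mod_shape N \<Longrightarrow> f * u = 0\<^sub>m (mdim N) (Suc 0) \<Longrightarrow> f * S = 0\<^sub>m (mdim N) m"
proof -
  note sh = is_module_shape[OF M]
  let ?V = "simple_module q m s" and ?O = "0\<^sub>m m (Suc 0) :: 'k mat"
  note V = is_module_simple[OF m, of s]
  have pc: "p * u \<in> carrier_mat (mdim ?V) (Suc 0)" using homD[OF p] u by (auto intro: carrier_matI)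
  have kn: "apow ?V Gen_a n (p * u) = ?O" using apow_n[OF V pc, of Gen_a n] by simp
  define k where "k = (LEAST k. apow ?V Gen_a k (p * u) = ?O)"
  have k: "apow ?V Gen_a k (p * u) = ?O" unfolding k_def by (rule LeastI, rule kn)
  have k0: "k \<noteq> 0" using k pu by (cases k) auto
  \<comment> \<open>The last nonzero vector among the \<open>a^i (p u)\<close> is killed by
    \<open>a\<close>, hence is a multiple of the last basis vector of \<open>V(m, s)\<close>; from
    there powers of \<open>d\<close> reach every basis vector.\<close>
  define y where "y = apow ?V Gen_a (k - 1) (p * u)"
  have y0: "y \<noteq> ?O" unfolding y_def k_def by (rule not_less_Least) (use k0 in \<open>simp add: k_def\<close>)
  have yc: "y \<in> carrier_mat m (Suc 0)" using apow_carrier[OF mod_shape_simple pc] by (simp add: y_def)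
  have ay: "action ?V Gen_a * y = ?O" using k k0 by (cases k) (auto simp: y_def)
  have yi: "y $$ (i, 0) = 0" if "Suc i < m" for i
  proof -
    have "(action ?V Gen_a * y) $$ (Suc i, 0) = y $$ (i, 0)"
      unfolding simple_module_eq hw_module_simps using yc that by (subst index_mono_mat_mult) auto
    thus ?thesis using that ay by simp
  qed
  have m0: "0 < m" using y0 yc by (auto simp: mat_eq_iff)
  define c where "c = y $$ (m - 1, 0)"
  have y: "y = c \<cdot>\<^sub>m ucol m (m - 1)"
  proof (rule eq_matI)
    fix i j assume "i < dim_row (c \<cdot>\<^sub>m ucol m (m - 1))" "j < dim_col (c \<cdot>\<^sub>m ucol m (m - 1))"
    hence "i < m" "j = 0" by auto
    thus "y $$ (i, j) = (c \<cdot>\<^sub>m ucol m (m - 1)) $$ (i, j)"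
      using yi[of i] by (cases "i = m - 1") (auto simp: ucol_def index_mono_mat c_def)
  qed (use yc in auto)
  have c0: "c \<noteq> 0" using y y0 by (auto intro!: eq_matI)
  define u1 where "u1 = apow M Gen_a (k - 1) u"
  have u1: "u1 \<in> carrier_mat (mdim M) (Suc 0)" unfolding u1_def by (rule apow_carrier[OF sh u])
  have pu1: "p * u1 = c \<cdot>\<^sub>m ucol m (m - 1)"
    unfolding u1_def using apow_hom[OF p sh mod_shape_simple u] y by (simp add: y_def)
  \<comment> \<open>The scalar with which \<open>d^(m-1-j)\<close> carries the last basis vector to
    the one with index \<open>j\<close>.\<close>
  define K where "K j = (\<Prod>i=m-1-(m-1-j)+1..m-1. alpha q i m)" for j
  have K: "K j \<noteq> 0" for j using alpha_nonzero[of _ m] m m0 by (auto simp: K_def prod_zero_iff)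
  \<comment> \<open>Every column of the section is a scaled power of \<open>d\<close> applied to a
    power of \<open>a\<close> applied to \<open>u\<close>, so a homomorphism that kills
    \<open>u\<close> kills all of \<open>S\<close>.\<close>
  define x where "x j = inverse (c * K j) \<cdot>\<^sub>m apow M Gen_d (m - 1 - j) u1" for j
  have xc: "x j \<in> carrier_mat (mdim M) (Suc 0)" for j using apow_carrier[OF sh u1] by (simp add: x_def)
  obtain S where S: "S \<in> carrier_mat (mdim M) m" "\<And>j. j < m \<Longrightarrow> S * ucol m j = x j"
    using mat_of_columns_exists[of m x "mdim M"] xc by blast
  have "p * S = 1\<^sub>m m"
  proof (rule mat_eq_ucolI)
    fix j assume j: "j < m"
    have um: "ucol m (m - 1) \<in> carrier_mat (mdim ?V) (Suc 0)" by (auto intro: carrier_matI)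
    have "p * S * ucol m j = p * x j" using S j homD[OF p] by (simp add: assoc_mult_mat_dim)
    also have "\<dots> = inverse (c * K j) \<cdot>\<^sub>m apow ?V Gen_d (m - 1 - j) (c \<cdot>\<^sub>m ucol m (m - 1))"
      unfolding x_def using homD[OF p] carrier_matD[OF apow_carrier[OF sh u1]] apow_hom[OF p sh mod_shape_simple u1] pu1
      by (simp add: mat_distrib)
    also have "apow ?V Gen_d (m - 1 - j) (c \<cdot>\<^sub>m ucol m (m - 1)) = c \<cdot>\<^sub>m apow ?V Gen_d (m - 1 - j) (ucol m (m - 1))"
      by (rule apow_smult[OF mod_shape_simple um])
    also have "\<dots> = (c * K j) \<cdot>\<^sub>m ucol m j"
      using j m0 by (subst apow_d_ucol) (auto simp: K_def smult_smult_mat)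
    also have "inverse (c * K j) \<cdot>\<^sub>m \<dots> = (inverse (c * K j) * (c * K j)) \<cdot>\<^sub>m ucol m j"
      by (simp only: smult_smult_mat)
    also have "inverse (c * K j) * (c * K j) = 1" using c0 K[of j] by (intro left_inverse) simp
    finally show "p * S * ucol m j = 1\<^sub>m m * ucol m j" by simp
  qed (use homD[OF p] S in auto)
  moreover have "f * S = 0\<^sub>m (mdim N) m"
    if f: "f \<in> module_hom M N" "mod_shape N" "f * u = 0\<^sub>m (mdim N) (Suc 0)" for N f
  proof (rule mat_eq_ucolI)
    fix j assume j: "j < m"
    have z: "apow N g i (0\<^sub>m (mdim N) (Suc 0)) = 0\<^sub>m (mdim N) (Suc 0)" for g i
      using f(2) by (induction i) auto
    have "f * u1 = 0\<^sub>m (mdim N) (Suc 0)" unfolding u1_def apow_hom[OF f(1) sh f(2) u] f(3) by (rule z)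
    hence "f * apow M Gen_d (m - 1 - j) u1 = 0\<^sub>m (mdim N) (Suc 0)" by (simp only: apow_hom[OF f(1) sh f(2) u1] z)
    hence "f * x j = 0\<^sub>m (mdim N) (Suc 0)"
      unfolding x_def using homD[OF f(1)] carrier_matD[OF apow_carrier[OF sh u1]] by (simp add: mat_distrib)
    thus "f * S * ucol m j = 0\<^sub>m (mdim N) m * ucol m j"
      using S j homD[OF f(1)] by (simp add: assoc_mult_mat_dim)
  qed (use homD[OF f(1)] S in auto)
  ultimately show ?thesis using that S(1) by blast
qed

lemma hom_nonzero_vector:
  assumes f: "f \<in> module_hom M N" "f \<noteq> 0\<^sub>m (mdim N) (mdim M)"
  obtains j where "(ucol (mdim M) j :: 'k mat) \<in> carrier_mat (mdim M) (Suc 0)" "f * ucol (mdim M) j \<noteq> 0\<^sub>m (mdim N) (Suc 0)"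
proof (rule ccontr)
  assume a: "\<not> thesis"
  have "f = 0\<^sub>m (mdim N) (mdim M)"
  proof (rule mat_eq_ucolI)
    fix j
    have u: "(ucol (mdim M) j :: 'k mat) \<in> carrier_mat (mdim M) (Suc 0)" by (rule carrier_matI) simp_all
    have "f * ucol (mdim M) j = 0\<^sub>m (mdim N) (Suc 0)"
      by (rule ccontr) (rule notE[OF a that[OF u]])
    thus "f * ucol (mdim M) j = 0\<^sub>m (mdim N) (mdim M) * ucol (mdim M) j" by simp
  qed (use homD(2,3)[OF f(1)] in simp_all)
  thus False using f(2) by simp
qed

lemma hom_to_simple_surj:
  assumes M: "is_module n q M" and m: "m \<le> n" and p: "p \<in> module_hom M (simple_module q m s)" "p \<noteq> 0\<^sub>m m (mdim M)"
  obtains R where "R \<in> carrier_mat (mdim M) m" "p * R = 1\<^sub>m m"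
proof -
  have "p \<noteq> 0\<^sub>m (mdim (simple_module q m s)) (mdim M)" using p(2) by simp
  then obtain j where j: "(ucol (mdim M) j :: 'k mat) \<in> carrier_mat (mdim M) (Suc 0)"
    "p * ucol (mdim M) j \<noteq> 0\<^sub>m m (Suc 0)"
    using hom_nonzero_vector[OF p(1)] unfolding mdim_simple by blast
  show ?thesis by (rule simple_section[OF M m p(1) j]) (rule that)
qed

text \<open>The first basis vector goes to a vector killed by \<open>d\<close>, which is a multiple
  of the first basis vector of the target because \<alpha> is nonzero inside the range. Comparing
  eigenvalues of \<open>b\<close> gives the second label modulo \<open>n\<close>, those of
  \<open>c\<close> then give the dimension.\<close>

lemma schur:
  assumes m: "0 < m" "m \<le> n" "0 < m'" "m' \<le> n"
    and f: "f \<in> module_hom (simple_module q m s) (simple_module q m' s')" "f \<noteq> 0\<^sub>m m' m"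
  obtains c where "m' = m" "int n dvd s' - s" "c \<noteq> 0" "f = c \<cdot>\<^sub>m 1\<^sub>m m"
proof -
  let ?V = "simple_module q m s" and ?W = "simple_module q m' s'"
  note d = homD(2,3)[OF f(1), simplified]
  have uc: "ucol m j \<in> carrier_mat (mdim ?V) (Suc 0)" for j by (auto intro: carrier_matI)
  have act: "action ?W y * (f * ucol m j) = f * (action ?V y * ucol m j)" for y j
    using apow_hom[OF f(1) mod_shape_simple mod_shape_simple uc, of y 1] by simp
  define v where "v = f * ucol m 0"
  have vc: "v \<in> carrier_mat m' (Suc 0)" using d by (auto simp: v_def intro: carrier_matI)
  have dv: "action ?W Gen_d * v = 0\<^sub>m m' (Suc 0)"
    unfolding v_def act using m d by (auto simp: simple_ucol mat_distrib intro!: eq_matI)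
  have v0: "v \<noteq> 0\<^sub>m m' (Suc 0)"
  proof
    assume "v = 0\<^sub>m m' (Suc 0)"
    hence "f = 0\<^sub>m m' m"
      using hom_from_simple_eqI[OF f(1) hom_zero[OF mod_shape_simple mod_shape_simple] mod_shape_simple]
      by (simp add: v_def)
    thus False using f(2) by simp
  qed
  have vi: "v $$ (Suc i, 0) = 0" if "Suc i < m'" for i
  proof -
    have "(action ?W Gen_d * v) $$ (i, 0) = alpha q (Suc i) m' * v $$ (Suc i, 0)"
      unfolding simple_module_eq hw_module_simps using vc that
      by (subst index_mono_mat_mult) (auto simp: nat_add_distrib)
    thus ?thesis using that dv alpha_nonzero[of "Suc i" m'] m by auto
  qed
  define c where "c = v $$ (0, 0)"
  have v: "v = c \<cdot>\<^sub>m ucol m' 0"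
  proof (rule eq_matI)
    fix i j assume "i < dim_row (c \<cdot>\<^sub>m ucol m' 0)" "j < dim_col (c \<cdot>\<^sub>m ucol m' 0)"
    hence "i < m'" "j = 0" by auto
    thus "v $$ (i, j) = (c \<cdot>\<^sub>m ucol m' 0) $$ (i, j)"
      using vi[of "i - 1"] by (cases i) (auto simp: ucol_def index_mono_mat c_def)
  qed (use vc in auto)
  have c0: "c \<noteq> 0" using v v0 by (auto intro!: eq_matI)
  have "v $$ (0, 0) \<noteq> 0" using c0 by (simp add: c_def)
  have scal: "k = l" if "k \<cdot>\<^sub>m v = l \<cdot>\<^sub>m v" for k l
  proof -
    have "(k \<cdot>\<^sub>m v) $$ (0, 0) = (l \<cdot>\<^sub>m v) $$ (0, 0)" using that by simp
    thus ?thesis using vc m \<open>v $$ (0, 0) \<noteq> 0\<close> by simp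
  qed
  have "q powi s \<cdot>\<^sub>m v = action ?W Gen_b * v" unfolding v_def act using m d by (simp add: simple_ucol mat_distrib)
  also have "\<dots> = q powi s' \<cdot>\<^sub>m v" unfolding v using m by (simp add: simple_ucol mat_distrib simple_dim smult_smult_mat mult.commute)
  finally have "q powi s = q powi s'" by (rule scal)
  from this[symmetric] have s: "int n dvd s' - s" by (simp only: q_powi_eq_iff)
  have "q powi (1 - s - int m) \<cdot>\<^sub>m v = action ?W Gen_c * v" unfolding v_def act using m d by (simp add: simple_ucol mat_distrib)
  also have "\<dots> = q powi (1 - s' - int m') \<cdot>\<^sub>m v" unfolding v using m by (simp add: simple_ucol mat_distrib simple_dim smult_smult_mat mult.commute)
  finally have "q powi (1 - s - int m) = q powi (1 - s' - int m')" by (rule scal)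
  hence "int n dvd (1 - s - int m) - (1 - s' - int m')" by (simp only: q_powi_eq_iff)
  hence "int n dvd ((1 - s - int m) - (1 - s' - int m')) - (s' - s)" using s by (rule dvd_diff)
  hence "int n dvd int m' - int m" by simp
  hence mm: "m' = m" using m dvd_imp_le_int[of "int m' - int m" "int n"] by (cases "m' = m") auto
  have Wc: "c \<cdot>\<^sub>m 1\<^sub>m m \<in> module_hom ?V ?W"
  proof -
    have "?V = ?W" unfolding simple_module_eq mm using s by (intro hw_module_cong) (auto simp: dvd_diff_commute)
    moreover have "c \<cdot>\<^sub>m 1\<^sub>m (mdim ?V) \<in> module_hom ?V ?V" by (intro hom_smult hom_id mod_shape_simple)
    ultimately show ?thesis by (simp add: mm)
  qed
  have "f = c \<cdot>\<^sub>m 1\<^sub>m m"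
    by (rule hom_from_simple_eqI[OF f(1) Wc mod_shape_simple]) (use v in \<open>simp add: v_def mm mat_distrib\<close>)
  thus ?thesis using that mm s c0 by blast
qed

end

section \<open>Projective covers\<close>

context root_of_unity
begin

lemma vec_add_diff: "x \<in> carrier_vec k \<Longrightarrow> z \<in> carrier_vec k \<Longrightarrow> x = z + (x - z :: 'k vec)"
  by (intro eq_vecI) auto

lemma superfluousD:
  fixes P :: "'k hmod"
  assumes "superfluous K P" "is_submodule U P" "\<And>x. x \<in> carrier_vec (mdim P) \<Longrightarrow> \<exists>u\<in>U. \<exists>v\<in>K. x = u + v"
    "K \<subseteq> carrier_vec (mdim P)"
  shows "U = carrier_vec (mdim P)"
proof -
  have "U \<subseteq> carrier_vec (mdim P)"
    using assms(2) by (auto simp: is_submodule_def subspace_def submodule_def module_vec_simps)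
  have "{u + v |u v. u \<in> U \<and> v \<in> K} = carrier_vec (mdim P)"
  proof (intro equalityI subsetI)
    fix x assume "x \<in> {u + v |u v. u \<in> U \<and> v \<in> K}"
    then obtain u v where "u \<in> U" "v \<in> K" "x = u + v" by blast
    thus "x \<in> carrier_vec (mdim P)"
      using \<open>U \<subseteq> carrier_vec (mdim P)\<close> assms(4) by (metis add_carrier_vec subsetD)
  next
    fix x :: "'k vec" assume "x \<in> carrier_vec (mdim P)"
    thus "x \<in> {u + v |u v. u \<in> U \<and> v \<in> K}" using assms(3) by blast
  qed
  thus ?thesis using assms(1,2) unfolding superfluous_def by blast
qed

lemma vec_hom_kernel_zero:
  fixes f :: "'k mat"
  assumes f: "f \<in> carrier_mat r c" and all: "mat_kernel f = carrier_vec c"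
  shows "f = 0\<^sub>m r c"
proof (rule eq_matI)
  fix i j assume ij: "i < dim_row (0\<^sub>m r c)" "j < dim_col (0\<^sub>m r c)"
  have "unit_vec c j \<in> mat_kernel f" unfolding all by simp
  hence "f *\<^sub>v unit_vec c j = 0\<^sub>v r" using mat_kernelD[OF f] by blast
  hence "(f *\<^sub>v unit_vec c j) $ i = 0" using ij by simp
  thus "f $$ (i, j) = 0\<^sub>m r c $$ (i, j)" using ij f by auto
qed (use f in auto)

lemma cover_kernel:
  assumes P: "is_module n q P" and m: "m \<le> n"
    and p: "p \<in> module_hom P (simple_module q m s)" and sup: "superfluous (mat_kernel p) P"
    and f: "f \<in> module_hom P N" "mod_shape N" "f \<noteq> 0\<^sub>m (mdim N) (mdim P)"
    and u: "u \<in> carrier_mat (mdim P) (Suc 0)" "f * u = 0\<^sub>m (mdim N) (Suc 0)"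
  shows "p * u = 0\<^sub>m m (Suc 0)"
proof (rule ccontr)
  assume pu: "p * u \<noteq> 0\<^sub>m m (Suc 0)"
  note sh = is_module_shape[OF P]
  obtain S where S: "S \<in> carrier_mat (mdim P) m" "p * S = 1\<^sub>m m" "f * S = 0\<^sub>m (mdim N) m"
  proof (rule simple_section[OF P m p u(1) pu])
    fix S assume a: "S \<in> carrier_mat (mdim P) m" "p * S = 1\<^sub>m m"
      "\<And>N f. f \<in> module_hom P N \<Longrightarrow> mod_shape N \<Longrightarrow> f * u = 0\<^sub>m (mdim N) (Suc 0) \<Longrightarrow> f * S = 0\<^sub>m (mdim N) m"
    show thesis by (rule that[OF a(1,2) a(3)[OF f(1,2) u(2)]])
  qed
  have pc: "p \<in> carrier_mat m (mdim P)" and fc: "f \<in> carrier_mat (mdim N) (mdim P)"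
    using homD(1)[OF p] homD(1)[OF f(1)] by simp_all
  have "mat_kernel f = carrier_vec (mdim P)"
  proof (rule superfluousD[OF sup mat_kernel_submodule[OF f(1) sh f(2)]])
    show "mat_kernel p \<subseteq> carrier_vec (mdim P)" using mat_kernel_carrier[OF pc] .
    fix x :: "'k vec" assume x: "x \<in> carrier_vec (mdim P)"
    define y where "y = p *\<^sub>v x"
    define v where "v = S *\<^sub>v y"
    have y: "y \<in> carrier_vec m" using pc by (simp add: y_def mult_mat_vec_carrier x)
    have v: "v \<in> carrier_vec (mdim P)" using S(1) y by (simp add: v_def mult_mat_vec_carrier)
    have "p *\<^sub>v v = y" unfolding v_def using assoc_mult_mat_vec[OF pc S(1) y] S(2) y by simp
    hence "p *\<^sub>v (x - v) = 0\<^sub>v m"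
      using mult_minus_distrib_mat_vec[OF pc x v] y by (simp add: y_def[symmetric])
    hence "x - v \<in> mat_kernel p" using mat_kernelI[OF pc _ ] x v by simp
    moreover have "0\<^sub>m (mdim N) m *\<^sub>v y = 0\<^sub>v (mdim N)" using y by (intro eq_vecI) auto
    hence "f *\<^sub>v v = 0\<^sub>v (mdim N)"
      unfolding v_def using assoc_mult_mat_vec[OF fc S(1) y] S(3) by simp
    hence "v \<in> mat_kernel f" using mat_kernelI[OF fc v] by simp
    moreover have "x = v + (x - v)" by (rule vec_add_diff[OF x v])
    ultimately show "\<exists>u\<in>mat_kernel f. \<exists>v\<in>mat_kernel p. x = u + v" by blast
  qed
  thus False using vec_hom_kernel_zero[OF fc] f(3) by simp
qed

text \<open>The linear right inverse \<open>R\<close> of \<open>p * h\<close> shows that the image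
  of \<open>h\<close> together with the kernel of \<open>p\<close> spans \<open>P\<close>.\<close>

lemma cover_lift_surj:
  fixes P Q :: "'k hmod"
  assumes sh: "mod_shape Q" "mod_shape P" and p: "p \<in> carrier_mat m (mdim P)" and sup: "superfluous (mat_kernel p) P"
    and h: "h \<in> module_hom Q P" and R: "R \<in> carrier_mat (mdim Q) m" "p * h * R = 1\<^sub>m m"
  shows "surjective_hom Q P h"
proof -
  have hc: "h \<in> carrier_mat (mdim P) (mdim Q)" by (rule homD[OF h])
  have "(*\<^sub>v) h ` carrier_vec (mdim Q) = carrier_vec (mdim P)"
  proof (rule superfluousD[OF sup mat_image_submodule[OF h sh]])
    show "mat_kernel p \<subseteq> carrier_vec (mdim P)" using mat_kernel_carrier[OF p] .
    fix x :: "'k vec" assume x: "x \<in> carrier_vec (mdim P)"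
    define y where "y = p *\<^sub>v x"
    define w where "w = R *\<^sub>v y"
    have y: "y \<in> carrier_vec m" using p by (simp add: y_def mult_mat_vec_carrier x)
    have w: "w \<in> carrier_vec (mdim Q)" using R(1) y by (simp add: w_def mult_mat_vec_carrier)
    have hw: "h *\<^sub>v w \<in> carrier_vec (mdim P)" using hc w by (simp add: mult_mat_vec_carrier)
    have "p *\<^sub>v (h *\<^sub>v w) = (p * h * R) *\<^sub>v y"
      unfolding w_def using assoc_mult_mat_vec[OF p hc] assoc_mult_mat_vec[OF mult_carrier_mat[OF p hc] R(1) y] w
      by (simp add: w_def)
    hence "p *\<^sub>v (h *\<^sub>v w) = y" using R(2) y by simp
    hence "p *\<^sub>v (x - h *\<^sub>v w) = 0\<^sub>v m"
      using mult_minus_distrib_mat_vec[OF p x hw] y by (simp add: y_def[symmetric])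
    hence "x - h *\<^sub>v w \<in> mat_kernel p" using mat_kernelI[OF p] x hw by simp
    moreover have "h *\<^sub>v w \<in> (*\<^sub>v) h ` carrier_vec (mdim Q)" using w by blast
    moreover have "x = h *\<^sub>v w + (x - h *\<^sub>v w)" by (rule vec_add_diff[OF x hw])
    ultimately show "\<exists>u\<in>(*\<^sub>v) h ` carrier_vec (mdim Q). \<exists>v\<in>mat_kernel p. x = u + v" by blast
  qed
  thus ?thesis using h by (simp add: surjective_hom_def)
qed

lemma projective_coverE:
  assumes "projective_cover n q P (simple_module q m s)"
  obtains p R where "projective n q P" "p \<in> module_hom P (simple_module q m s)" "R \<in> carrier_mat (mdim P) m"
    "p * R = 1\<^sub>m m" "superfluous (mat_kernel p) P"
proof -
  obtain p where p: "projective n q P" "surjective_hom P (simple_module q m s) p" "superfluous (mat_kernel p) P"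
    using assms unfolding projective_cover_def by blast
  from p(2) show ?thesis by (rule surjective_homE) (rule that[OF p(1) _ _ _ p(3)]; simp)
qed

text \<open>A nonzero \<open>f\<close> is onto, and its kernel lies in that of \<open>p\<close> by
  \<open>cover_kernel\<close>. Thus \<open>p\<close> factors through \<open>f\<close> by a nonzero
  map of simple modules, which is a scalar by \<open>schur\<close>: every \<open>f\<close> is a
  multiple of \<open>p\<close>.\<close>

lemma cover_hom_dim:
  assumes P: "projective_cover n q P (simple_module q m s)" and m: "0 < m" "m \<le> n" "0 < m'" "m' \<le> n"
  shows "hom_dim P (simple_module q m' s') = (if m' = m \<and> int n dvd s' - s then 1 else 0)"
proof -
  obtain p R where pr: "projective n q P" and p: "p \<in> module_hom P (simple_module q m s)"
    and R: "R \<in> carrier_mat (mdim P) m" "p * R = 1\<^sub>m m" and sup: "superfluous (mat_kernel p) P"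
    using P by (rule projective_coverE)
  note PM = projective_module[OF pr]
  note sh = is_module_shape[OF PM]
  have dp: "dim_row p = m" "dim_col p = mdim P" using homD(2,3)[OF p] by simp_all
  have p0: "p \<noteq> 0\<^sub>m m (mdim P)"
  proof
    assume "p = 0\<^sub>m m (mdim P)"
    hence "1\<^sub>m m = (0\<^sub>m m m :: 'k mat)" using R(2) carrier_matD[OF R(1)] by simp
    from arg_cong[OF this, of "\<lambda>A. A $$ (0, 0)"] show False using m(1) by simp
  qed
  let ?W = "simple_module q m' s'"
  have key: "m' = m \<and> int n dvd s' - s \<and> (\<exists>c. f = c \<cdot>\<^sub>m p)"
    if f: "f \<in> module_hom P ?W" "f \<noteq> 0\<^sub>m m' (mdim P)" for f
  proof -
    have df: "dim_row f = m'" "dim_col f = mdim P" using homD(2,3)[OF f(1)] by simp_all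
    have f0: "f \<noteq> 0\<^sub>m (mdim ?W) (mdim P)" using f(2) by simp
    obtain T where T: "T \<in> carrier_mat (mdim P) m'" "f * T = 1\<^sub>m m'"
      by (rule hom_to_simple_surj[OF PM m(4) f])
    note dT = carrier_matD[OF T(1)]
    define \<theta> where "\<theta> = p * T"
    have \<theta>f: "\<theta> * f = p"
    proof -
      \<comment> \<open>The linear projection onto the kernel of \<open>f\<close> along the image of
        its section \<open>T\<close>; \<open>p\<close> vanishes on its range, whence
        \<open>p = p T f\<close>.\<close>
      let ?E = "1\<^sub>m (mdim P) - T * f"
      have "p * ?E = 0\<^sub>m m (mdim P)"
      proof (rule mat_eq_ucolI)
        fix j
        have "f * (?E * ucol (mdim P) j) = 0\<^sub>m (mdim ?W) (Suc 0)"
          using df dT by (simp add: mat_distrib assoc_mult_mat_dim mult_rewrite[OF T(2)])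
        moreover have "?E * ucol (mdim P) j \<in> carrier_mat (mdim P) (Suc 0)"
          by (rule carrier_matI) (use df dT in simp_all)
        ultimately have "p * (?E * ucol (mdim P) j) = 0\<^sub>m m (Suc 0)"
          by (intro cover_kernel[OF PM m(2) p sup f(1) mod_shape_simple f0])
        thus "p * ?E * ucol (mdim P) j = 0\<^sub>m m (mdim P) * ucol (mdim P) j"
          using df dT dp by (simp add: assoc_mult_mat_dim)
      qed (use dp df dT in auto)
      moreover have "p * ?E = p - \<theta> * f" using dp df dT by (simp add: mat_distrib \<theta>_def assoc_mult_mat_dim)
      ultimately have z: "p - \<theta> * f = 0\<^sub>m m (mdim P)" by simp
      show ?thesis
      proof (rule eq_matI)
        fix i j assume "i < dim_row p" "j < dim_col p"
        thus "(\<theta> * f) $$ (i, j) = p $$ (i, j)"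
          using arg_cong[OF z, of "\<lambda>A. A $$ (i, j)"] dp df dT by (auto simp: \<theta>_def simp del: index_mult_mat(1))
      qed (use dp df dT in \<open>auto simp: \<theta>_def\<close>)
    qed
    have \<theta>: "\<theta> \<in> module_hom ?W (simple_module q m s)"
      by (rule hom_cancel_epi[OF f(1) _ _ _ _ mod_shape_simple sh mod_shape_simple, where R = T])
        (use \<theta>f p T dp dT in \<open>auto simp: \<theta>_def\<close>)
    have \<theta>0: "\<theta> \<noteq> 0\<^sub>m m m'"
    proof
      assume "\<theta> = 0\<^sub>m m m'"
      hence "\<theta> * f = 0\<^sub>m m (mdim P)" using df by simp
      thus False using \<theta>f p0 by simp
    qed
    obtain c where c: "m = m'" "int n dvd s - s'" "c \<noteq> 0" "\<theta> = c \<cdot>\<^sub>m 1\<^sub>m m'"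
      by (rule schur[OF m(3,4,1,2) \<theta> \<theta>0])
    have "p = c \<cdot>\<^sub>m f" using \<theta>f c df by (simp add: mat_distrib)
    hence "inverse c \<cdot>\<^sub>m p = f" using c by (simp add: smult_smult_mat)
    hence "\<exists>c. f = c \<cdot>\<^sub>m p" by (intro exI[of _ "inverse c"]) simp
    thus ?thesis using c(1,2) dvd_diff_commute[of "int n" s s'] by simp
  qed
  show ?thesis
  proof (cases "m' = m \<and> int n dvd s' - s")
    case True
    hence W: "?W = simple_module q m s"
      unfolding simple_module_eq using hw_module_cong[of m m s' s m] by simp
    have "module_hom P ?W = range (\<lambda>k. k \<cdot>\<^sub>m p)"
    proof (intro equalityI subsetI)
      fix f assume f: "f \<in> module_hom P ?W"
      show "f \<in> range (\<lambda>k. k \<cdot>\<^sub>m p)"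
      proof (cases "f = 0\<^sub>m m' (mdim P)")
        case z: True
        have "f = 0 \<cdot>\<^sub>m p" unfolding z using dp True by (intro eq_matI) auto
        thus ?thesis by (rule range_eqI)
      next
        case False
        then obtain c where "f = c \<cdot>\<^sub>m p" using key[OF f] by blast
        thus ?thesis by (rule range_eqI)
      qed
    next
      fix f assume "f \<in> range (\<lambda>k. k \<cdot>\<^sub>m p)"
      then obtain k where "f = k \<cdot>\<^sub>m p" by blast
      thus "f \<in> module_hom P ?W" unfolding W using hom_smult[OF p sh mod_shape_simple] by simp
    qed
    moreover have "mat_dim m (mdim P) (range (\<lambda>k. k \<cdot>\<^sub>m p)) = 1"
      by (rule mat_dim_span_singleton[OF _ p0]) (rule carrier_matI[OF dp])
    ultimately show ?thesis using True unfolding hom_dim_def by simp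
  next
    case False
    have "module_hom P ?W = {0\<^sub>m m' (mdim P)}"
    proof (intro equalityI subsetI)
      fix f assume f: "f \<in> module_hom P ?W"
      have "f = 0\<^sub>m m' (mdim P)" by (rule ccontr) (use key[OF f] False in blast)
      thus "f \<in> {0\<^sub>m m' (mdim P)}" by simp
    next
      fix f :: "'k mat" assume "f \<in> {0\<^sub>m m' (mdim P)}"
      thus "f \<in> module_hom P ?W" using hom_zero[OF sh mod_shape_simple, of m' s'] by simp
    qed
    hence "hom_dim P ?W = 0" unfolding hom_dim_def by simp
    thus ?thesis using False by (simp only: if_False)
  qed
qed

lemma simple_n_cover: "projective_cover n q (simple_module q n s) (simple_module q n s)"
  unfolding projective_cover_def
proof (intro conjI exI)
  let ?V = "simple_module q n s"
  show "projective n q ?V" by (rule projective_simple_n)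
  show "surjective_hom ?V ?V (1\<^sub>m n)"
    using surjective_homI[OF hom_id[OF mod_shape_simple], of "1\<^sub>m n" n s] by simp
  have k: "mat_kernel (1\<^sub>m n :: 'k mat) = {0\<^sub>v n}"
    by (auto simp: mat_kernel[of _ n n] )
  have "{u + v |u v. u \<in> U \<and> v \<in> mat_kernel (1\<^sub>m n :: 'k mat)} = U" if "is_submodule U ?V" for U
  proof -
    have "U \<subseteq> carrier_vec n"
      using that by (auto simp: is_submodule_def subspace_def submodule_def module_vec_simps)
    thus ?thesis unfolding k by force
  qed
  thus "superfluous (mat_kernel (1\<^sub>m n)) ?V" by (auto simp: superfluous_def)
qed

section \<open>Decomposition of projective modules into covers\<close>

lemma split_off_cover:
  assumes Q: "projective n q Q" and P: "projective_cover n q P (simple_module q m s)" and m: "m \<le> n"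
    and f: "f \<in> module_hom Q (simple_module q m s)" "f \<noteq> 0\<^sub>m m (mdim Q)"
  obtains Q1 where "is_biprod P Q1 Q"
proof -
  obtain p R where pr: "projective n q P" and p: "p \<in> module_hom P (simple_module q m s)"
    and R: "R \<in> carrier_mat (mdim P) m" "p * R = 1\<^sub>m m" and sup: "superfluous (mat_kernel p) P"
    using P by (rule projective_coverE)
  note PM = projective_module[OF pr] and QM = projective_module[OF Q]
  note sh = is_module_shape[OF PM] is_module_shape[OF QM]
  obtain T where T: "T \<in> carrier_mat (mdim Q) m" "f * T = 1\<^sub>m m"
    by (rule hom_to_simple_surj[OF QM m f])
  have R': "R \<in> carrier_mat (mdim P) (mdim (simple_module q m s))" "p * R = 1\<^sub>m (mdim (simple_module q m s))"
    using R by simp_all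
  obtain h where h: "h \<in> module_hom Q P" "p * h = f"
    by (rule projective_lift[OF Q PM is_module_simple[OF m] p R' f(1)])
  have pc: "p \<in> carrier_mat m (mdim P)" using homD(1)[OF p] by simp
  have "surjective_hom Q P h"
    by (rule cover_lift_surj[OF sh(2,1) pc sup h(1) T(1)]) (use h T in simp)
  then obtain S where S: "S \<in> carrier_mat (mdim Q) (mdim P)" "h * S = 1\<^sub>m (mdim P)"
    by (rule surjective_homE)
  obtain \<sigma> where \<sigma>: "\<sigma> \<in> module_hom P Q" "h * \<sigma> = 1\<^sub>m (mdim P)"
    by (rule projective_lift[OF pr QM PM h(1) S hom_id[OF sh(1)]])
  obtain d i L where i: "i \<in> carrier_mat (mdim Q) d" and L: "L \<in> carrier_mat d (mdim Q)" and
    e: "h * i = 0\<^sub>m (mdim P) d" "L * i = 1\<^sub>m d" "L * \<sigma> = 0\<^sub>m d (mdim P)" "\<sigma> * h + i * L = 1\<^sub>m (mdim Q)"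
    by (rule split_kernel[OF homD(1)[OF h(1)] homD(1)[OF \<sigma>(1)] \<sigma>(2)])
  \<comment> \<open>The kernel of \<open>h\<close> in coordinates: \<open>i\<close> includes it and
    \<open>L\<close> projects onto it along the image of the section. Both turn out to be module
    maps.\<close>
  define Q1 where "Q1 = \<lparr>mdim = d, action = (\<lambda>x. L * (action Q x * i))\<rparr>"
  have Q1: "mdim Q1 = d" "action Q1 x = L * (action Q x * i)" for x by (simp_all add: Q1_def)
  note dim = carrier_matD[OF i] carrier_matD[OF L] homD(2,3)[OF h(1)] homD(2,3)[OF \<sigma>(1)]
  have sh1: "mod_shape Q1" using dim by (auto simp: mod_shape_def Q1 intro!: carrier_matI)
  have iL: "i * (L * Z) = Z - \<sigma> * (h * Z)" if "dim_row Z = mdim Q" for Z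
  proof -
    have "Z = (\<sigma> * h + i * L) * Z" using e(4) that by simp
    also have "\<dots> = \<sigma> * (h * Z) + i * (L * Z)" using dim that by (simp add: mat_distrib assoc_mult_mat_dim)
    finally have "Z = \<sigma> * (h * Z) + i * (L * Z)" .
    hence "Z - \<sigma> * (h * Z) = \<sigma> * (h * Z) + i * (L * Z) - \<sigma> * (h * Z)" by simp
    also have "\<dots> = i * (L * Z)" using dim that by (intro eq_matI) (auto simp del: index_mult_mat(1))
    finally show ?thesis by simp
  qed
  have hx: "h * (action Q x * Z) = action P x * (h * Z)" if "dim_row Z = mdim Q" for x Z
    using mult_rewrite[OF homD(4)[OF h(1), of x], of Z] that dim sh by (simp add: assoc_mult_mat_dim)
  have ih: "i \<in> module_hom Q1 Q"
  proof (rule homI)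
    fix x
    show "i * action Q1 x = action Q x * i"
      unfolding Q1 using dim sh e by (simp add: iL hx)
  qed (use dim Q1 in auto)
  have Lh: "L \<in> module_hom Q Q1"
  proof (rule homI)
    fix x
    have "action Q1 x * L = L * (action Q x * (i * L))"
      unfolding Q1 using dim sh by (simp add: assoc_mult_mat_dim)
    also have "i * L = 1\<^sub>m (mdim Q) - \<sigma> * h" using iL[of "1\<^sub>m (mdim Q)"] dim by simp
    also have "L * (action Q x * (1\<^sub>m (mdim Q) - \<sigma> * h)) = L * action Q x - L * (action Q x * \<sigma> * h)"
      using dim sh by (simp add: mat_distrib assoc_mult_mat_dim)
    also have "L * (action Q x * \<sigma> * h) = 0\<^sub>m d (mdim Q)"
      unfolding homD(4)[OF \<sigma>(1), symmetric] using dim sh by (simp add: assoc_mult_mat_dim mult_rewrite[OF e(3)])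
    finally show "L * action Q x = action Q1 x * L" using dim sh by simp
  qed (use dim Q1 in auto)
  have "is_biprod P Q1 Q"
    by (rule is_biprodI[OF sh(1) sh1 sh(2) \<sigma>(1) ih h(1) Lh \<sigma>(2)]) (use e Q1 in auto)
  thus ?thesis by (rule that)
qed

lemma hom_dim_zero_iff:
  assumes "mod_shape M" "mod_shape N"
  shows "hom_dim M N = 0 \<longleftrightarrow> module_hom M N = {0\<^sub>m (mdim N) (mdim M)}"
  using mat_dim_eq_0[OF mat_subspace_hom[OF assms]] by (auto simp: hom_dim_def)

lemma simple_mod_n: "simple_module q m s = simple_module q m (int (nat (s mod int n)))"
  unfolding simple_module_eq using n_gt_2 by (intro hw_module_cong) auto

lemma module_iso_zero:
  assumes "mod_shape M" "mod_shape N" "mdim M = 0" "mdim N = 0"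
  shows "M \<cong>\<^sub>H N"
  unfolding module_iso_def
  by (intro bexI[of _ "0\<^sub>m (mdim N) (mdim M)"] bexI[of _ "0\<^sub>m (mdim M) (mdim N)"] conjI hom_zero assms)
    (use assms in auto)

text \<open>Induction on the number of homomorphisms from \<open>Q\<close> to simple modules,
  counted once per residue class of the second label. Unless both modules are zero, some
  \<open>V(m, s)\<close> receives nonzero maps from both; then both split off the same
  \<open>P(m, s)\<close>, and the complements again have equal counts.\<close>

lemma projective_determined:
  fixes P :: "nat \<Rightarrow> int \<Rightarrow> 'k hmod"
  assumes P: "\<And>m s. 1 \<le> m \<Longrightarrow> m \<le> n \<Longrightarrow> projective_cover n q (P m s) (simple_module q m s)"
    and Q: "projective n q Q" "projective n q Q'"
    and eq: "\<And>m s. 1 \<le> m \<Longrightarrow> m \<le> n \<Longrightarrow> hom_dim Q (simple_module q m s) = hom_dim Q' (simple_module q m s)"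
  shows "Q \<cong>\<^sub>H Q'"
  using Q eq
proof (induction "\<Sum>m=1..n. \<Sum>s<n. hom_dim Q (simple_module q m (int s))" arbitrary: Q Q' rule: less_induct)
  case less
  note QM = less.prems(1,2)[THEN projective_module]
  note sh = QM[THEN is_module_shape]
  show ?case
  proof (cases "mdim Q = 0 \<and> mdim Q' = 0")
    case True
    thus ?thesis using sh by (intro module_iso_zero) auto
  next
    case False
    have "\<exists>m s. 1 \<le> m \<and> m \<le> n \<and> hom_dim Q (simple_module q m s) \<noteq> 0"
    proof (cases "mdim Q = 0")
      case True
      hence "mdim Q' > 0" using False by simp
      from hom_to_simple_exists[OF QM(2) this] obtain m s f
        where f: "1 \<le> m" "m \<le> n" "f \<in> module_hom Q' (simple_module q m s)" "f \<noteq> 0\<^sub>m m (mdim Q')" .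
      hence "hom_dim Q' (simple_module q m s) \<noteq> 0"
        unfolding hom_dim_zero_iff[OF sh(2) mod_shape_simple] mdim_simple by blast
      thus ?thesis using less.prems(3)[OF f(1,2), of s] f(1,2) by (intro exI[of _ m] exI[of _ s]) simp
    next
      case False
      hence "mdim Q > 0" by simp
      from hom_to_simple_exists[OF QM(1) this] obtain m s f
        where f: "1 \<le> m" "m \<le> n" "f \<in> module_hom Q (simple_module q m s)" "f \<noteq> 0\<^sub>m m (mdim Q)" .
      hence "hom_dim Q (simple_module q m s) \<noteq> 0"
        unfolding hom_dim_zero_iff[OF sh(1) mod_shape_simple] mdim_simple by blast
      thus ?thesis using f(1,2) by (intro exI[of _ m] exI[of _ s]) simp
    qed
    then obtain m s where m: "1 \<le> m" "m \<le> n" and nz: "hom_dim Q (simple_module q m s) \<noteq> 0" by blast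
    have nz': "hom_dim Q' (simple_module q m s) \<noteq> 0" using nz less.prems(3)[OF m] by simp
    have ex: "\<exists>f. f \<in> module_hom M N \<and> f \<noteq> 0\<^sub>m (mdim N) (mdim M)"
      if "hom_dim M N \<noteq> 0" "mod_shape M" "mod_shape N" for M N :: "'k hmod"
      using that hom_zero[OF that(2,3)] hom_dim_zero_iff[OF that(2,3)] by auto
    obtain f where f: "f \<in> module_hom Q (simple_module q m s)" "f \<noteq> 0\<^sub>m m (mdim Q)"
      using ex[OF nz sh(1) mod_shape_simple] unfolding mdim_simple by blast
    obtain Q1 where Q1: "is_biprod (P m s) Q1 Q"
      by (rule split_off_cover[OF less.prems(1) P[OF m] m(2) f])
    obtain f' where f': "f' \<in> module_hom Q' (simple_module q m s)" "f' \<noteq> 0\<^sub>m m (mdim Q')"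
      using ex[OF nz' sh(2) mod_shape_simple] unfolding mdim_simple by blast
    obtain Q1' where Q1': "is_biprod (P m s) Q1' Q'"
      by (rule split_off_cover[OF less.prems(2) P[OF m] m(2) f'])
    have pr: "projective n q Q1" "projective n q Q1'"
      using projective_summand[OF is_biprod_comm] Q1 Q1' less.prems by blast+
    note add = hom_dim_biprod[OF Q1 mod_shape_simple] hom_dim_biprod[OF Q1' mod_shape_simple]
    have "Q1 \<cong>\<^sub>H Q1'"
    proof (rule less.hyps[OF _ pr])
      show "hom_dim Q1 (simple_module q m' s') = hom_dim Q1' (simple_module q m' s')"
        if "1 \<le> m'" "m' \<le> n" for m' s'
        using less.prems(3)[OF that, of s'] by (simp add: add)
      \<comment> \<open>The measure runs over \<open>s < n\<close>, so the integer label is replaced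
        by its residue; there the split-off cover accounts for a strict decrease.\<close>
      define s0 where "s0 = nat (s mod int n)"
      have s0: "s0 < n" using n_gt_2 by (simp add: s0_def nat_less_iff)
      have "hom_dim (P m s) (simple_module q m (int s0)) = 1"
        using cover_hom_dim[OF P[OF m], of m s] m simple_mod_n[of m s]
        by (simp add: s0_def mod_eq_dvd_iff[symmetric])
      hence "hom_dim Q1 (simple_module q m (int s0)) < hom_dim Q (simple_module q m (int s0))" by (simp add: add)
      moreover have le: "hom_dim Q1 (simple_module q m' s') \<le> hom_dim Q (simple_module q m' s')" for m' s'
        by (simp add: add)
      ultimately have lt: "(\<Sum>s<n. hom_dim Q1 (simple_module q m (int s))) < (\<Sum>s<n. hom_dim Q (simple_module q m (int s)))"
        using s0 by (intro sum_strict_mono_ex1) auto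
      show "(\<Sum>m=1..n. \<Sum>s<n. hom_dim Q1 (simple_module q m (int s))) < (\<Sum>m=1..n. \<Sum>s<n. hom_dim Q (simple_module q m (int s)))"
      proof (rule sum_strict_mono_ex1)
        show "\<exists>k\<in>{1..n}. (\<Sum>s<n. hom_dim Q1 (simple_module q k (int s))) < (\<Sum>s<n. hom_dim Q (simple_module q k (int s)))"
          using lt m by (intro bexI[of _ m]) auto
      qed (auto intro: sum_mono le)
    qed
    moreover have "P m s \<cong>\<^sub>H P m s" by (rule module_iso_refl) (use Q1 in \<open>simp add: is_biprod_def\<close>)
    ultimately show ?thesis using is_biprod_unique[OF Q1 Q1'] by blast
  qed
qed

end

section \<open>Direct sums\<close>

lemma index_mult_mono_mat:
  assumes "i < dim_row W" "j < r" "dim_col W = c"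
  shows "(W * mono_mat c r s f) $$ (i, j) = (if 0 \<le> int j + s \<and> int j + s < int c
    then W $$ (i, nat (int j + s)) * f j else 0)"
proof -
  have "(W * mono_mat c r s f) $$ (i, j) = (\<Sum>k<c. W $$ (i, k) * mono_mat c r s f $$ (k, j))"
    using assms by (subst index_mult_mat_sum) auto
  also have "\<dots> = (\<Sum>k<c. if k = nat (int j + s) \<and> 0 \<le> int j + s then W $$ (i, k) * f j else 0)"
    using assms by (intro sum.cong) (auto simp: index_mono_mat)
  finally show ?thesis by (cases "0 \<le> int j + s") (auto simp: nat_less_iff)
qed

lemma direct_sum_Cons:
  "mdim (direct_sum (M # Ms)) = mdim M + mdim (direct_sum Ms)"
  "action (direct_sum (M # Ms)) x = four_block_mat (action M x)
     (0\<^sub>m (dim_row (action M x)) (dim_col (action (direct_sum Ms) x)))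
     (0\<^sub>m (dim_row (action (direct_sum Ms) x)) (dim_col (action M x))) (action (direct_sum Ms) x)"
  by (simp_all add: direct_sum_def Let_def)

lemma mod_shape_direct_sum: "(\<And>M. M \<in> set Ms \<Longrightarrow> mod_shape M) \<Longrightarrow> mod_shape (direct_sum Ms)"
proof (induction Ms)
  case Nil
  show ?case by (auto simp: direct_sum_def mod_shape_def intro!: carrier_matI)
next
  case (Cons M Ms)
  hence "mod_shape M" "mod_shape (direct_sum Ms)" by auto
  thus ?case unfolding mod_shape_def[of "direct_sum (M # Ms)"] direct_sum_Cons
    by (auto intro!: four_block_carrier_mat)
qed

lemma is_biprod_direct_sum_Cons:
  assumes "mod_shape M" "mod_shape (direct_sum Ms)"
  shows "is_biprod M (direct_sum Ms) (direct_sum (M # Ms :: 'k::field hmod list))"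
proof -
  let ?S = "direct_sum Ms" and ?X = "direct_sum (M # Ms)"
  define m k where "m = mdim M" "k = mdim ?S"
  have dX: "mdim ?X = m + k" by (simp add: direct_sum_Cons m_k_def)
  have shX: "mod_shape ?X"
    using assms unfolding mod_shape_def[of ?X] direct_sum_Cons by (auto intro!: four_block_carrier_mat)
  have dim: "dim_row (action M x) = m" "dim_col (action M x) = m" "dim_row (action ?S x) = k" "dim_col (action ?S x) = k" for x
    using assms by (simp_all add: m_k_def)
  define i where "i = mono_mat (m + k) m 0 (\<lambda>_. 1 :: 'k)"
  define j where "j = mono_mat (m + k) k (int m) (\<lambda>_. 1 :: 'k)"
  define p where "p = mono_mat m (m + k) 0 (\<lambda>_. 1 :: 'k)"
  define r where "r = mono_mat k (m + k) (- int m) (\<lambda>_. 1 :: 'k)"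
  note defs = i_def j_def p_def r_def
  have dd: "dim_row i = m + k" "dim_col i = m" "dim_row j = m + k" "dim_col j = k"
    "dim_row p = m" "dim_col p = m + k" "dim_row r = k" "dim_col r = m + k" by (simp_all add: defs)
  have act: "action ?X x = four_block_mat (action M x) (0\<^sub>m m k) (0\<^sub>m k m) (action ?S x)" for x
    by (simp add: direct_sum_Cons dim)
  show ?thesis
  proof (rule is_biprodI[OF assms shX, of i j p r])
    show "i \<in> module_hom M ?X"
      by (rule homI; (intro eq_matI)?)
        (auto simp: dX dd act dim m_k_def[symmetric] index_mono_mat_mult index_mult_mono_mat i_def simp del: index_mult_mat(1))
    show "j \<in> module_hom ?S ?X"
      by (rule homI; (intro eq_matI)?)
        (auto simp: dX dd act dim m_k_def[symmetric] index_mono_mat_mult index_mult_mono_mat j_def nat_add_distrib nat_diff_distrib simp del: index_mult_mat(1))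
    show "p \<in> module_hom ?X M"
      by (rule homI; (intro eq_matI)?)
        (auto simp: dX dd act dim m_k_def[symmetric] index_mono_mat_mult index_mult_mono_mat p_def simp del: index_mult_mat(1))
    show "r \<in> module_hom ?X ?S"
      by (rule homI; (intro eq_matI)?)
        (auto simp: dX dd act dim m_k_def[symmetric] index_mono_mat_mult index_mult_mono_mat r_def nat_add_distrib nat_diff_distrib simp del: index_mult_mat(1))
    show "p * i = 1\<^sub>m (mdim M)"
      unfolding m_k_def(1)[symmetric] defs mono_mat_mult one_eq_mono_mat by (rule mono_mat_eqI) auto
    show "r * j = 1\<^sub>m (mdim ?S)"
      unfolding m_k_def(2)[symmetric] defs mono_mat_mult one_eq_mono_mat by (rule mono_mat_eqI) auto
    show "p * j = 0\<^sub>m (mdim M) (mdim ?S)"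
      unfolding m_k_def[symmetric] defs mono_mat_mult by (rule mono_mat_zeroI) auto
    show "r * i = 0\<^sub>m (mdim ?S) (mdim M)"
      unfolding m_k_def[symmetric] defs mono_mat_mult by (rule mono_mat_zeroI) auto
    have "i * p = mono_mat (m + k) (m + k) 0 (\<lambda>x. if x < m then 1 else 0)"
      unfolding defs mono_mat_mult by (rule mono_mat_eqI) auto
    moreover have "j * r = mono_mat (m + k) (m + k) 0 (\<lambda>x. if x < m then 0 else 1)"
      unfolding defs mono_mat_mult by (rule mono_mat_eqI) auto
    ultimately show "i * p + j * r = 1\<^sub>m (mdim ?X)"
      unfolding dX one_eq_mono_mat by (simp add: mono_mat_add) (rule mono_mat_eqI; simp)
  qed
qed

text \<open>Zero modules occur as empty direct sums and as the bottom \<open>V(0, r)\<close> of the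
  recursion.\<close>

lemma projective_zero:
  assumes "mod_shape M" "mdim M = 0"
  shows "projective n q (M :: 'k::field hmod)"
proof (rule projectiveI)
  have eq: "A = B" if "dim_row A = 0" "dim_row B = 0" "dim_col A = dim_col B" for A B :: "'k mat"
    using that by (intro eq_matI) auto
  show "is_module n q M" unfolding is_module_def Let_def
    using assms by (intro conjI allI; (rule eq)?) (auto simp: pow_mat_dim)
  fix X C p R f
  assume h: "is_module n q X" "is_module n q C" "p \<in> module_hom X C" "f \<in> module_hom M C"
  have "p * 0\<^sub>m (mdim X) 0 = f"
    using homD(2,3)[OF h(3)] homD(2,3)[OF h(4)] assms by (intro eq_matI) auto
  moreover have "0\<^sub>m (mdim X) 0 \<in> module_hom M X"
    using hom_zero[OF assms(1) is_module_shape[OF h(1)]] assms(2) by simp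
  ultimately show "\<exists>h\<in>module_hom M X. p * h = f" by blast
qed

lemma hom_dim_zero_left:
  assumes "mod_shape M" "mod_shape N" "mdim M = 0 \<or> mdim N = 0"
  shows "hom_dim M (N :: 'k::field hmod) = 0"
proof -
  have "f = 0\<^sub>m (mdim N) (mdim M)" if "f \<in> module_hom M N" for f
    using homD(2,3)[OF that] assms(3) by (intro eq_matI) auto
  hence "module_hom M N = {0\<^sub>m (mdim N) (mdim M)}" using hom_zero[OF assms(1,2)] by blast
  thus ?thesis by (simp add: hom_dim_def)
qed

lemma projective_direct_sum:
  "(\<And>M. M \<in> set Ms \<Longrightarrow> projective n q M) \<Longrightarrow> projective n q (direct_sum (Ms :: 'k::field hmod list))"
proof (induction Ms)
  case Nil
  show ?case by (rule projective_zero) (auto simp: direct_sum_def mod_shape_def intro!: carrier_matI)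
next
  case (Cons M Ms)
  hence "projective n q M" "projective n q (direct_sum Ms)" by auto
  thus ?case using projective_biprod[OF is_biprod_direct_sum_Cons] projective_shape by blast
qed

lemma hom_dim_direct_sum:
  assumes "\<And>M. M \<in> set Ms \<Longrightarrow> mod_shape M" "mod_shape Y"
  shows "hom_dim (direct_sum (Ms :: 'k::field hmod list)) Y = sum_list (map (\<lambda>M. hom_dim M Y) Ms)"
  using assms(1)
proof (induction Ms)
  case Nil
  show ?case using assms(2)
    by (simp, intro hom_dim_zero_left) (auto simp: direct_sum_def mod_shape_def intro!: carrier_matI)
next
  case (Cons M Ms)
  thus ?case
    using hom_dim_biprod[OF is_biprod_direct_sum_Cons assms(2), of M Ms] mod_shape_direct_sum[of Ms] by simp
qed

lemma is_biprod_iso: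
  assumes "is_biprod A B X" "X \<cong>\<^sub>H Y" "mod_shape Y"
  shows "is_biprod A B Y"
proof -
  obtain f g where fg: "f \<in> module_hom X Y" "g \<in> module_hom Y X" "g * f = 1\<^sub>m (mdim X)" "f * g = 1\<^sub>m (mdim Y)"
    using assms(2) by (rule module_isoE)
  obtain i j p r where X: "i \<in> module_hom A X" "j \<in> module_hom B X"
    "p \<in> module_hom X A" "r \<in> module_hom X B" "p * i = 1\<^sub>m (mdim A)" "r * j = 1\<^sub>m (mdim B)"
    "p * j = 0\<^sub>m (mdim A) (mdim B)" "r * i = 0\<^sub>m (mdim B) (mdim A)"
    "i * p + j * r = 1\<^sub>m (mdim X)" and sh: "mod_shape A" "mod_shape B" "mod_shape X"
    using assms(1) by (rule is_biprodE)
  note d = X(1-4)[THEN homD(2)] X(1-4)[THEN homD(3)] fg(1,2)[THEN homD(2)] fg(1,2)[THEN homD(3)]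
  have "f * i * (p * g) + f * j * (r * g) = f * (i * p + j * r) * g"
    using d by (simp add: mat_distrib assoc_mult_mat_dim)
  also have "\<dots> = 1\<^sub>m (mdim Y)" using d fg(4) X(9) by simp
  finally have s: "f * i * (p * g) + f * j * (r * g) = 1\<^sub>m (mdim Y)" .
  show ?thesis
    by (rule is_biprodI[OF sh(1,2) assms(3), of "f * i" "f * j" "p * g" "r * g"])
      (use s in \<open>auto intro!: hom_comp[OF fg(1) X(1)] hom_comp[OF fg(1) X(2)] hom_comp[OF X(3) fg(2)]
        hom_comp[OF X(4) fg(2)] sh assms(3) simp: d assoc_mult_mat_dim mult_rewrite[OF fg(3)] X\<close>)
qed

section \<open>Multiplicities\<close>

context root_of_unity
begin

text \<open>For projective \<open>Q\<close> this is the multiplicity of \<open>P(m, s)\<close> in \<open>Q\<close>.\<close>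

definition mult :: "'k hmod \<Rightarrow> int \<Rightarrow> int \<Rightarrow> int" where
  "mult Q m s = (if 1 \<le> m \<and> m \<le> int n then int (hom_dim Q (simple_module q (nat m) s)) else 0)"

text \<open>By adjunction the value at \<open>(m, s)\<close> collects the simple factors of
  \<open>V(2, -1) \<otimes> V(m, s)\<close>: \<open>V(m + 1, s - 1)\<close> and
  \<open>V(m - 1, s)\<close> below \<open>n\<close>, and at \<open>n\<close> each of
  \<open>V(n - 1, s)\<close> and \<open>V(1, s - 1)\<close> twice.\<close>

definition V2_shift :: "(int \<Rightarrow> int \<Rightarrow> int) \<Rightarrow> int \<Rightarrow> int \<Rightarrow> int" where
  "V2_shift f m s = (if 1 \<le> m \<and> m < int n then f (m + 1) (s - 1) + f (m - 1) s
     else if m = int n then 2 * f (int n - 1) s + 2 * f 1 (s - 1) else 0)"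

definition unit_fun :: "int \<Rightarrow> int \<Rightarrow> int \<Rightarrow> int \<Rightarrow> int" where
  "unit_fun j r m s = (if m = j \<and> int n dvd s - r then 1 else 0)"

lemma mult_zero [simp]: "mult Q 0 s = 0"
  by (simp add: mult_def)

lemma mult_nat: "1 \<le> m \<Longrightarrow> m \<le> n \<Longrightarrow> mult Q (int m) s = int (hom_dim Q (simple_module q m s))"
  by (simp add: mult_def)

lemma mult_biprod: "is_biprod A B X \<Longrightarrow> mult X m s = mult A m s + mult B m s"
  by (simp add: mult_def hom_dim_biprod)

lemma mult_iso: "M \<cong>\<^sub>H N \<Longrightarrow> mod_shape M \<Longrightarrow> mod_shape N \<Longrightarrow> mult M m s = mult N m s"
  by (simp add: mult_def hom_dim_iso)

lemma mult_V2_tensor: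
  assumes Q: "projective n q Q"
  shows "mult (V2 0 \<otimes>\<^sub>H Q) = V2_shift (mult Q)"
proof (intro ext)
  fix m s
  note sQ = projective_shape[OF Q]
  have adj: "hom_dim (V2 0 \<otimes>\<^sub>H Q) (hw_module l l s) = hom_dim Q (V2 (-1) \<otimes>\<^sub>H hw_module l l s)" for l
    by (rule dual_pair.hom_dim_tensor[OF dual_pair_V2]) (use sQ in auto)
  have modV: "is_module n q (hw_module l l s)" if "l \<le> n" for l s using that by (intro is_module_hw) auto
  show "mult (V2 0 \<otimes>\<^sub>H Q) m s = V2_shift (mult Q) m s"
  proof (cases "1 \<le> m \<and> m < int n")
    case True
    define l where "l = nat m"
    have l: "0 < l" "l < n" "m = int l" using True by (auto simp: l_def)
    have "split_exact (hw_module (l + 1) (l + 1) (s - 1)) (V2 (-1) \<otimes>\<^sub>H hw_module l l s) (hw_module (l - 1) (l - 1) s)"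
      using split_exact_V2_tensor[of l "l + 1" "l - 1" s "-1"] l by simp
    from hom_dim_exact[OF this Q is_module_V2_tensor[OF modV] modV]
    have "hom_dim Q (V2 (-1) \<otimes>\<^sub>H hw_module l l s) =
        hom_dim Q (hw_module (l + 1) (l + 1) (s - 1)) + hom_dim Q (hw_module (l - 1) (l - 1) s)"
      using l by simp
    moreover have "mult Q (m + 1) (s - 1) = int (hom_dim Q (hw_module (l + 1) (l + 1) (s - 1)))"
      using l mult_nat[of "l + 1" Q "s - 1"] by (simp add: simple_module_eq add.commute)
    moreover have "mult Q (m - 1) s = int (hom_dim Q (hw_module (l - 1) (l - 1) s))"
    proof (cases "l = 1")
      case True
      thus ?thesis using l sQ by (simp add: hom_dim_zero_left)
    next
      case False
      thus ?thesis using l mult_nat[of "l - 1" Q s] by (simp add: simple_module_eq of_nat_diff)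
    qed
    ultimately show ?thesis
      using l True mult_nat[of l "V2 0 \<otimes>\<^sub>H Q" s] by (simp add: V2_shift_def simple_module_eq adj)
  next
    case False
    show ?thesis
    proof (cases "m = int n")
      case True
      \<comment> \<open>The two Verma modules at the ends have labels \<open>n + 1\<close>, hence 1,
        and \<open>n - 1\<close>. Each is built from the same two simple modules, which explains the
        coefficients 2 in \<open>V2_shift\<close>.\<close>
      have V1: "hw_module n (n + 1) (s - 1) = hw_module n 1 (s - 1)"
        by (rule hw_module_cong) auto
      have modW: "is_module n q (hw_module n l s)" for l s by (rule is_module_hw) auto
      have "split_exact (hw_module n (n + 1) (s - 1)) (V2 (-1) \<otimes>\<^sub>H hw_module n n s) (hw_module n (n - 1) s)"
        using split_exact_V2_tensor[of n n n s "-1"] n_gt_2 by simp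
      from hom_dim_exact[OF this Q is_module_V2_tensor[OF modV] modW]
      have 1: "hom_dim Q (V2 (-1) \<otimes>\<^sub>H hw_module n n s) = hom_dim Q (hw_module n 1 (s - 1)) + hom_dim Q (hw_module n (n - 1) s)"
        by (simp add: V1[simplified])
      have verma: "hom_dim Q (hw_module n l s) = hom_dim Q (hw_module (n - l) (n - l) (s + int l)) + hom_dim Q (hw_module l l s)"
        if "0 < l" "l < n" for l s
        using hom_dim_exact[OF split_exact_verma[OF that] Q modW modV] that by simp
      have 2: "hom_dim Q (hw_module n 1 (s - 1)) = hom_dim Q (hw_module (n - 1) (n - 1) s) + hom_dim Q (hw_module 1 1 (s - 1))"
        using verma[of 1 "s - 1"] n_gt_2 by simp
      have "hw_module 1 1 (s + int (n - 1)) = hw_module 1 1 (s - 1)"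
        using n_gt_2 by (intro hw_module_cong) (auto simp: of_nat_diff)
      hence 3: "hom_dim Q (hw_module n (n - 1) s) = hom_dim Q (hw_module 1 1 (s - 1)) + hom_dim Q (hw_module (n - 1) (n - 1) s)"
        using verma[of "n - 1" s] n_gt_2 by simp
      have 4: "mult Q 1 (s - 1) = int (hom_dim Q (hw_module 1 1 (s - 1)))"
        "mult Q (int n - 1) s = int (hom_dim Q (hw_module (n - 1) (n - 1) s))"
        using mult_nat[of 1 Q "s - 1"] mult_nat[of "n - 1" Q s] n_gt_2 by (simp_all add: simple_module_eq of_nat_diff)
      show ?thesis
        using True n_gt_2 mult_nat[of n "V2 0 \<otimes>\<^sub>H Q" s] 1 2 3 4
        by (simp add: V2_shift_def simple_module_eq adj)
    qed (use False in \<open>auto simp: V2_shift_def mult_def\<close>)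
  qed
qed

lemma V2_shift_add: "V2_shift (\<lambda>m s. f m s + g m s) m s = V2_shift f m s + V2_shift g m s"
  by (simp add: V2_shift_def)

lemma V2_shift_scale: "V2_shift (\<lambda>m s. k * f m s) m s = k * V2_shift f m s"
  by (simp add: V2_shift_def algebra_simps)

lemma V2_shift_sum: "V2_shift (\<lambda>m s. \<Sum>i\<in>I. f i m s) m s = (\<Sum>i\<in>I. V2_shift (f i) m s)"
proof -
  consider "1 \<le> m \<and> m < int n" | "\<not> (1 \<le> m \<and> m < int n)" "m = int n" | "\<not> (1 \<le> m \<and> m < int n)" "m \<noteq> int n"
    by blast
  thus ?thesis
    by cases (simp_all only: V2_shift_def if_P if_not_P if_False simp_thms sum.distrib sum_distrib_left sum.neutral_const)
qed

section \<open>Tensoring a projective module with simple modules\<close>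

text \<open>The induction uses two earlier values: the sequence for
  \<open>V(2, 0) \<otimes> V(j, r) \<otimes> Q\<close> splits because its quotient
  \<open>V(j - 1, r + 1) \<otimes> Q\<close> is projective, and then
  \<open>V(j + 1, r) \<otimes> Q\<close> is a summand of a projective module. The relations on it
  are obtained in the same stroke.\<close>

lemma simple_tensor:
  assumes Q: "projective n q Q"
  shows "j \<le> n \<Longrightarrow> projective n q (hw_module j j r \<otimes>\<^sub>H Q)"
    and "0 < j \<Longrightarrow> j < n \<Longrightarrow>
      is_biprod (hw_module (j + 1) (j + 1) r \<otimes>\<^sub>H Q) (hw_module (j - 1) (j - 1) (r + 1) \<otimes>\<^sub>H Q) (V2 0 \<otimes>\<^sub>H (hw_module j j r \<otimes>\<^sub>H Q))"
proof -
  note sQ = projective_shape[OF Q]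
  have bp: "is_biprod (hw_module (j + 1) (j + 1) r \<otimes>\<^sub>H Q) (hw_module (j - 1) (j - 1) (r + 1) \<otimes>\<^sub>H Q) (V2 0 \<otimes>\<^sub>H (hw_module j j r \<otimes>\<^sub>H Q))"
    if "0 < j" "j < n" "\<And>r. projective n q (hw_module j j r \<otimes>\<^sub>H Q)" "\<And>r. projective n q (hw_module (j - 1) (j - 1) r \<otimes>\<^sub>H Q)" for j r
  proof (rule split_exact_projective)
    show "split_exact (hw_module (j + 1) (j + 1) r \<otimes>\<^sub>H Q) (V2 0 \<otimes>\<^sub>H (hw_module j j r \<otimes>\<^sub>H Q)) (hw_module (j - 1) (j - 1) (r + 1) \<otimes>\<^sub>H Q)"
      using split_exact_tensor_right[OF split_exact_V2_tensor[of j "j + 1" "j - 1" r 0] sQ] that(1,2) sQ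
      by (simp add: tensor_assoc)
    show "projective n q (hw_module (j - 1) (j - 1) (r + 1) \<otimes>\<^sub>H Q)" by (rule that)
    show "is_module n q (V2 0 \<otimes>\<^sub>H (hw_module j j r \<otimes>\<^sub>H Q))"
      by (rule is_module_V2_tensor[OF projective_module[OF that(3)]])
  qed
  have pr: "\<forall>r. projective n q (hw_module j j r \<otimes>\<^sub>H Q)" if "j \<le> n" for j
    using that
  proof (induction j rule: less_induct)
    case (less j)
    consider "j = 0" | "j = 1" | i where "j = Suc i" "0 < i" by (cases j; cases "j - 1") auto
    thus ?case
    proof cases
      case 1
      thus ?thesis using sQ by (auto intro!: projective_zero)
    next
      case 2
      thus ?thesis using dual_pair.projective_tensor[OF dual_pair_one_dim Q] by simp
    next
      case (3 i)
      have "projective n q (hw_module i i r \<otimes>\<^sub>H Q)" "projective n q (hw_module (i - 1) (i - 1) r \<otimes>\<^sub>H Q)" for r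
        using less.IH[of i] less.IH[of "i - 1"] less.prems 3 by auto
      from projective_summand[OF bp[OF _ _ this] dual_pair.projective_tensor[OF dual_pair_V2 this(1)]]
      show ?thesis using 3 less.prems by auto
    qed
  qed
  show "j \<le> n \<Longrightarrow> projective n q (hw_module j j r \<otimes>\<^sub>H Q)" using pr by blast
  show "0 < j \<Longrightarrow> j < n \<Longrightarrow>
      is_biprod (hw_module (j + 1) (j + 1) r \<otimes>\<^sub>H Q) (hw_module (j - 1) (j - 1) (r + 1) \<otimes>\<^sub>H Q) (V2 0 \<otimes>\<^sub>H (hw_module j j r \<otimes>\<^sub>H Q))"
    by (rule bp) (use pr in auto)
qed

definition simple_mult :: "'k hmod \<Rightarrow> nat \<Rightarrow> int \<Rightarrow> int \<Rightarrow> int \<Rightarrow> int" where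
  "simple_mult Q j r = mult (hw_module j j r \<otimes>\<^sub>H Q)"

lemma simple_mult_0:
  assumes "mod_shape Q"
  shows "simple_mult Q 0 r m s = 0"
  using assms by (simp add: simple_mult_def mult_def hom_dim_zero_left)

lemma simple_mult_1:
  assumes "mod_shape Q"
  shows "simple_mult Q 1 r m s = mult Q m (s - r)"
  using dual_pair.hom_dim_tensor[OF dual_pair_one_dim, of Q _ r] assms
  by (simp add: simple_mult_def mult_def simple_module_eq one_dim_tensor)

lemma simple_mult_rec:
  assumes Q: "projective n q Q" and j: "0 < j" "j < n"
  shows "V2_shift (simple_mult Q j r) m s = simple_mult Q (j + 1) r m s + simple_mult Q (j - 1) (r + 1) m s"
  unfolding simple_mult_def mult_V2_tensor[OF simple_tensor(1)[OF Q less_imp_le[OF j(2)]], symmetric]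
  by (rule mult_biprod[OF simple_tensor(2)[OF Q j]])

end

section \<open>Tensoring a projective module with projective covers\<close>

locale projective_covers = root_of_unity n q for n and q :: "'k::field" +
  fixes P :: "nat \<Rightarrow> int \<Rightarrow> 'k hmod"
  assumes cover: "1 \<le> m \<Longrightarrow> m < n \<Longrightarrow> projective_cover n q (P m s) (simple_module q m s)"
    and P_n: "P n s = simple_module q n s"
begin

lemma cover': "1 \<le> m \<Longrightarrow> m \<le> n \<Longrightarrow> projective_cover n q (P m s) (simple_module q m s)"
  using cover[of m s] simple_n_cover[of s] P_n[of s] by (cases "m = n") auto

lemma projective_P: "1 \<le> m \<Longrightarrow> m \<le> n \<Longrightarrow> projective n q (P m s)"
  using cover'[of m s] by (simp add: projective_cover_def)

lemma mult_P:
  assumes "1 \<le> j" "j \<le> n"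
  shows "mult (P j r) = unit_fun (int j) r"
proof (intro ext)
  fix m s
  show "mult (P j r) m s = unit_fun (int j) r m s"
    using cover_hom_dim[OF cover'[OF assms, of r], of "nat m" s] assms
    by (auto simp: mult_def unit_fun_def)
qed

lemma iso_of_mult_eq:
  assumes "projective n q Q" "projective n q Q'" "\<And>m s. mult Q m s = mult Q' m s"
  shows "Q \<cong>\<^sub>H Q'"
proof (rule projective_determined[OF cover' assms(1,2)])
  fix m s assume "1 \<le> m" "m \<le> n"
  thus "hom_dim Q (simple_module q m s) = hom_dim Q' (simple_module q m s)"
    using assms(3)[of "int m" s] by (simp add: mult_nat)
qed

text \<open>Multiplicities determine projective modules, so an additive identity between them is
  already a decomposition. This is how \<open>V(2, 0) \<otimes> P(j, r)\<close> is split without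
  knowing the covers explicitly.\<close>

lemma biprod_of_mult_add:
  assumes "projective n q A" "projective n q B" "projective n q X"
    and "\<And>m s. mult X m s = mult A m s + mult B m s"
  shows "is_biprod A B X"
proof -
  note sh = assms(1-3)[THEN projective_shape]
  let ?Y = "direct_sum [A, B]"
  have B: "direct_sum [B] \<cong>\<^sub>H B"
  proof (rule iso_of_mult_eq)
    show "projective n q (direct_sum [B])" using assms(2) by (intro projective_direct_sum) auto
    show "mult (direct_sum [B]) m s = mult B m s" for m s
      using hom_dim_direct_sum[of "[B]"] sh by (simp add: mult_def)
  qed (rule assms(2))
  have s1: "mod_shape (direct_sum [B])" using sh by (intro mod_shape_direct_sum) auto
  have Y: "is_biprod A (direct_sum [B]) ?Y" by (rule is_biprod_direct_sum_Cons[OF sh(1) s1])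
  have "is_biprod A (direct_sum [B]) X"
  proof (rule is_biprod_iso[OF Y _ sh(3)], rule iso_of_mult_eq)
    show "projective n q ?Y" using assms(1,2) by (intro projective_direct_sum) auto
    show "mult ?Y m s = mult X m s" for m s
      using assms(4)[of m s] mult_biprod[OF Y, of m s] mult_iso[OF B s1 sh(2), of m s] by simp
  qed (rule assms(3))
  then obtain i j p r where h: "i \<in> module_hom A X" "j \<in> module_hom (direct_sum [B]) X"
    "p \<in> module_hom X A" "r \<in> module_hom X (direct_sum [B])" "p * i = 1\<^sub>m (mdim A)"
    "r * j = 1\<^sub>m (mdim (direct_sum [B]))"
    "p * j = 0\<^sub>m (mdim A) (mdim (direct_sum [B]))" "r * i = 0\<^sub>m (mdim (direct_sum [B])) (mdim A)"
    "i * p + j * r = 1\<^sub>m (mdim X)" by (rule is_biprodE)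
  obtain f g where fg: "f \<in> module_hom (direct_sum [B]) B" "g \<in> module_hom B (direct_sum [B])"
    "g * f = 1\<^sub>m (mdim (direct_sum [B]))" "f * g = 1\<^sub>m (mdim B)" using B by (rule module_isoE)
  note d = h(1-4)[THEN homD(2)] h(1-4)[THEN homD(3)] fg(1,2)[THEN homD(2)] fg(1,2)[THEN homD(3)]
  show ?thesis
  proof (rule is_biprodI[OF sh h(1) _ h(3), of "j * g" "f * r"])
    show "j * g \<in> module_hom B X" "f * r \<in> module_hom X B"
      by (rule hom_comp[OF h(2) fg(2) sh(2) s1 sh(3)] hom_comp[OF fg(1) h(4) sh(3) s1 sh(2)])+
  qed (use h(5-9) d fg(4) in \<open>simp_all add: assoc_mult_mat_dim mult_rewrite[OF h(6)] mult_rewrite[OF h(7)] mult_rewrite[OF fg(3)]\<close>)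
qed

text \<open>The decomposition of \<open>V(2, 0) \<otimes> P(j, r)\<close>. The doubled values at
  \<open>n\<close> make both \<open>P(1, r)\<close> and \<open>P(n - 1, r)\<close> produce two
  copies of a \<open>P(n, -)\<close>, while \<open>P(n, r)\<close> gives a single neighbour
  \<open>P(n - 1, r + 1)\<close>.\<close>

lemma V2_shift_unit_fun:
  "1 < j \<Longrightarrow> j < int n - 1 \<Longrightarrow> V2_shift (unit_fun j r) m s = unit_fun (j + 1) r m s + unit_fun (j - 1) (r + 1) m s"
  "V2_shift (unit_fun 1 r) m s = unit_fun 2 r m s + 2 * unit_fun (int n) (r + 1) m s"
  "V2_shift (unit_fun (int n - 1) r) m s = 2 * unit_fun (int n) r m s + unit_fun (int n - 2) (r + 1) m s"
  "V2_shift (unit_fun (int n) r) m s = unit_fun (int n - 1) (r + 1) m s"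
  using n_gt_2 unfolding V2_shift_def unit_fun_def by (auto simp: algebra_simps)

definition cover_mult :: "'k hmod \<Rightarrow> nat \<Rightarrow> int \<Rightarrow> int \<Rightarrow> int \<Rightarrow> int" where
  "cover_mult Q j r = mult (P j r \<otimes>\<^sub>H Q)"

text \<open>\<open>A\<close> is what \<open>V(2, 0) \<otimes> P(j, r)\<close> contains besides
  \<open>P(j - 1, r + 1)\<close>: nothing for \<open>j = n\<close>, two copies of
  \<open>P(n, r)\<close> for \<open>j = n - 1\<close>, and \<open>P(j + 1, r)\<close> below.
  Integer-valued multiplicities allow the subtraction.\<close>

lemma cover_tensor_step:
  assumes Q: "projective n q Q" and j: "2 \<le> j" "j \<le> n" and A: "projective n q A"
    and eq: "\<And>m s. V2_shift (unit_fun (int j) r) m s = unit_fun (int j - 1) (r + 1) m s + mult A m s"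
    and PQ: "projective n q (P j r \<otimes>\<^sub>H Q)"
  shows "projective n q (P (j - 1) (r + 1) \<otimes>\<^sub>H Q)"
    and "cover_mult Q (j - 1) (r + 1) m s = V2_shift (cover_mult Q j r) m s - mult (A \<otimes>\<^sub>H Q) m s"
proof -
  note sQ = projective_shape[OF Q]
  have prV2: "projective n q (V2 0 \<otimes>\<^sub>H Y)" if "projective n q Y" for Y
    by (rule dual_pair.projective_tensor[OF dual_pair_V2 that])
  have prP: "projective n q (P j r)" "projective n q (P (j - 1) (r + 1))"
    using j by (auto intro: projective_P)
  have "is_biprod (P (j - 1) (r + 1)) A (V2 0 \<otimes>\<^sub>H P j r)"
  proof (rule biprod_of_mult_add[OF prP(2) A prV2[OF prP(1)]])
    fix m s show "mult (V2 0 \<otimes>\<^sub>H P j r) m s = mult (P (j - 1) (r + 1)) m s + mult A m s"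
      using j eq[of m s] mult_V2_tensor[OF prP(1)] by (simp add: mult_P of_nat_diff)
  qed
  hence bp: "is_biprod (P (j - 1) (r + 1) \<otimes>\<^sub>H Q) (A \<otimes>\<^sub>H Q) (V2 0 \<otimes>\<^sub>H (P j r \<otimes>\<^sub>H Q))"
    using is_biprod_tensor_right[of _ _ _ Q] sQ projective_shape[OF prP(1)] by (fastforce simp: tensor_assoc)
  show "projective n q (P (j - 1) (r + 1) \<otimes>\<^sub>H Q)" by (rule projective_summand[OF bp prV2[OF PQ]])
  show "cover_mult Q (j - 1) (r + 1) m s = V2_shift (cover_mult Q j r) m s - mult (A \<otimes>\<^sub>H Q) m s"
    using mult_biprod[OF bp, of m s] mult_V2_tensor[OF PQ] by (simp add: cover_mult_def)
qed

text \<open>The composition factors of \<open>P(j, r)\<close> are \<open>V(j, r)\<close> and \<open>V(n - j, r + j)\<close>, each twice.  Rather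
  than computing them, the class of \<open>P(j, r) \<otimes> Q\<close> is obtained by descending from \<open>P(n, r) = V(n, r)\<close>.\<close>

lemma cover_tensor:
  assumes Q: "projective n q Q"
    and top: "\<And>r m s. V2_shift (simple_mult Q n r) m s = 2 * simple_mult Q (n - 1) (r + 1) m s + 2 * simple_mult Q 1 (r + int n) m s"
    and j: "1 \<le> j" "j < n"
  shows "projective n q (P j r \<otimes>\<^sub>H Q) \<and>
    (\<forall>m s. cover_mult Q j r m s = 2 * simple_mult Q j r m s + 2 * simple_mult Q (n - j) (r + int j) m s)"
proof -
  note sQ = projective_shape[OF Q]
  define G where "G j r m s = 2 * simple_mult Q j r m s + 2 * simple_mult Q (n - j) (r + int j) m s" for j r m s
  have Pn: "projective n q (P n r \<otimes>\<^sub>H Q)" "cover_mult Q n r = simple_mult Q n r" for r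
    using simple_tensor(1)[OF Q, of n r] by (simp_all add: P_n simple_module_eq cover_mult_def simple_mult_def)
  have prV2: "projective n q (V2 0 \<otimes>\<^sub>H Y)" if "projective n q Y" for Y
    by (rule dual_pair.projective_tensor[OF dual_pair_V2 that])
  \<comment> \<open>The upward neighbour of the term at \<open>i\<close> and the downward neighbour
    of the term at \<open>n - i\<close> together form \<open>G\<close> at \<open>i + 1\<close>, the
    other two form \<open>G\<close> at \<open>i - 1\<close>; so \<open>G\<close> obeys the interior
    recursion of the covers.\<close>
  have GT: "V2_shift (G i r) m s = G (i + 1) r m s + G (i - 1) (r + 1) m s" if "1 \<le> i" "i < n" for i r m s
  proof -
    have e: "n - i + 1 = n - (i - 1)" "r + int i = (r + 1) + int (i - 1)" "n - i - 1 = n - (i + 1)"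
      "r + int i + 1 = r + int (i + 1)" using that by auto
    have "V2_shift (G i r) m s = 2 * V2_shift (simple_mult Q i r) m s + 2 * V2_shift (simple_mult Q (n - i) (r + int i)) m s"
    proof -
      have "G i r = (\<lambda>m s. 2 * simple_mult Q i r m s + 2 * simple_mult Q (n - i) (r + int i) m s)"
        by (intro ext) (simp add: G_def)
      thus ?thesis by (simp only: V2_shift_add V2_shift_scale)
    qed
    also have "V2_shift (simple_mult Q (n - i) (r + int i)) m s =
        simple_mult Q (n - (i - 1)) ((r + 1) + int (i - 1)) m s + simple_mult Q (n - (i + 1)) (r + int (i + 1)) m s"
      using simple_mult_rec[OF Q, of "n - i" "r + int i" m s] that unfolding e(1,3,4) e(2)[symmetric] by simp
    also have "V2_shift (simple_mult Q i r) m s = simple_mult Q (i + 1) r m s + simple_mult Q (i - 1) (r + 1) m s"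
      using that by (intro simple_mult_rec[OF Q]) auto
    finally show ?thesis unfolding G_def distrib_left by (simp only: add_ac)
  qed
  have main: "\<forall>r. projective n q (P (n - k) r \<otimes>\<^sub>H Q) \<and> (\<forall>m s. cover_mult Q (n - k) r m s = G (n - k) r m s)"
    if "1 \<le> k" "k < n" for k
    using that
  proof (induction k rule: less_induct)
    case (less k)
    show ?case
    proof
      fix r :: int
      define j where "j = n - k + 1"
      have j: "2 \<le> j" "j \<le> n" and nk: "n - k = j - 1" using less.prems by (auto simp: j_def)
      consider "k = 1" | "k = 2" | "k > 2" using less.prems by linarith
      thus "projective n q (P (n - k) r \<otimes>\<^sub>H Q) \<and> (\<forall>m s. cover_mult Q (n - k) r m s = G (n - k) r m s)"
      proof cases
        \<comment> \<open>\<open>V(2, 0) \<otimes> P(n, r - 1)\<close> is \<open>P(n - 1, r)\<close>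
          itself, so nothing is subtracted, and \<open>top\<close> is exactly the value of
          \<open>G\<close> at \<open>n - 1\<close>.\<close>
        case 1
        hence jn: "j = n" using n_gt_2 by (simp add: j_def)
        let ?Z = "direct_sum [] :: 'k hmod"
        have Z: "projective n q ?Z" by (rule projective_direct_sum) simp
        have mZ: "mdim ?Z = 0" by (simp add: direct_sum_def)
        have "mult ?Z m s = 0" "mult (?Z \<otimes>\<^sub>H Q) m s = 0" for m s
          using mZ projective_shape[OF Z] sQ by (simp_all add: mult_def hom_dim_zero_left)
        note z = this
        note st = cover_tensor_step[OF Q j Z, of "r - 1"]
        have "V2_shift (unit_fun (int j) (r - 1)) m s = unit_fun (int j - 1) (r - 1 + 1) m s + mult ?Z m s" for m s
          unfolding jn using V2_shift_unit_fun(4)[of "r - 1" m s] by (simp add: z)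
        note st = st[OF this]
        have PQ: "projective n q (P j (r - 1) \<otimes>\<^sub>H Q)" unfolding jn by (rule Pn)
        have "cover_mult Q (n - k) r m s = G (n - k) r m s" for m s
          using st(2)[OF PQ, of m s] top[of "r - 1" m s] 1 n_gt_2
          by (simp add: z jn Pn G_def of_nat_diff algebra_simps)
        thus ?thesis using st(1)[OF PQ] nk by simp
      next
        case 2
        hence jn: "j = n - 1" "int j = int n - 1" using n_gt_2 by (auto simp: j_def of_nat_diff)
        let ?A = "direct_sum [P n (r - 1), P n (r - 1)]"
        have pn: "projective n q (P n (r - 1))" using n_gt_2 by (intro projective_P) auto
        have A: "projective n q ?A" using pn by (intro projective_direct_sum) auto
        have mA: "mult ?A m s = 2 * unit_fun (int n) (r - 1) m s" for m s
          using hom_dim_direct_sum[of "[P n (r - 1), P n (r - 1)]"] projective_shape[OF pn] mult_P[of n "r - 1", symmetric] n_gt_2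
          by (simp add: mult_def)
        have "is_biprod (P n (r - 1)) (P n (r - 1)) ?A"
          by (rule biprod_of_mult_add[OF pn pn A]) (use n_gt_2 in \<open>simp add: mA mult_P\<close>)
        from mult_biprod[OF is_biprod_tensor_right[OF this sQ]]
        have mAQ: "mult (?A \<otimes>\<^sub>H Q) m s = 2 * cover_mult Q n (r - 1) m s" for m s by (simp add: cover_mult_def)
        have "V2_shift (unit_fun (int j) (r - 1)) m s = unit_fun (int j - 1) (r - 1 + 1) m s + mult ?A m s" for m s
          unfolding jn(2) mA using V2_shift_unit_fun(3)[of "r - 1" m s] by simp
        note st = cover_tensor_step[OF Q j A this]
        have IH: "projective n q (P j (r - 1) \<otimes>\<^sub>H Q)" "cover_mult Q j (r - 1) = G j (r - 1)"
          using less.IH[of 1] less.prems 2 by (auto simp: jn intro!: ext)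
        have "cover_mult Q (n - k) r m s = G (n - k) r m s" for m s
        proof -
          have "V2_shift (G j (r - 1)) m s = G n (r - 1) m s + G (j - 1) r m s"
            using GT[of j "r - 1" m s] j jn n_gt_2 by simp
          \<comment> \<open>At \<open>n\<close> the second half of \<open>G\<close> belongs to
            \<open>V(0, -)\<close> and vanishes; what remains is the contribution of the two copies
            of \<open>P(n, r - 1)\<close> to be subtracted.\<close>
          moreover have "G n (r - 1) m s = 2 * simple_mult Q n (r - 1) m s"
            by (simp add: G_def simple_mult_0[OF sQ])
          ultimately show ?thesis
            using st(2)[OF IH(1), of m s] by (simp add: IH nk mAQ Pn)
        qed
        thus ?thesis using st(1)[OF IH(1)] nk by simp
      next
        case 3
        hence jn: "1 < int j" "int j < int n - 1" "j < n" using less.prems by (auto simp: j_def)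
        have pj: "projective n q (P (j + 1) (r - 1))" using jn by (intro projective_P) auto
        have "V2_shift (unit_fun (int j) (r - 1)) m s = unit_fun (int j - 1) (r - 1 + 1) m s + mult (P (j + 1) (r - 1)) m s" for m s
          using V2_shift_unit_fun(1)[OF jn(1,2)] jn mult_P[of "j + 1" "r - 1"] by (simp add: add.commute)
        note st = cover_tensor_step[OF Q j pj this]
        have ks: "n - (k - 1) = j" "n - (k - 2) = j + 1" using less.prems 3 by (auto simp: j_def)
        have IH: "projective n q (P j (r - 1) \<otimes>\<^sub>H Q)" "cover_mult Q j (r - 1) = G j (r - 1)"
          "cover_mult Q (j + 1) (r - 1) = G (j + 1) (r - 1)"
          using less.IH[of "k - 1"] less.IH[of "k - 2"] less.prems 3 unfolding ks by (auto intro!: ext)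
        have "cover_mult Q (n - k) r m s = G (n - k) r m s" for m s
        proof -
          have "V2_shift (G j (r - 1)) m s = G (j + 1) (r - 1) m s + G (j - 1) r m s"
            using GT[of j "r - 1" m s] j jn by simp
          moreover have "mult (P (j + 1) (r - 1) \<otimes>\<^sub>H Q) m s = G (j + 1) (r - 1) m s"
            using IH(3) unfolding cover_mult_def by simp
          ultimately show ?thesis using st(2)[OF IH(1), of m s] by (simp add: IH(2) nk)
        qed
        thus ?thesis using st(1)[OF IH(1)] nk by simp
      qed
    qed
  qed
  have "n - (n - j) = j" "1 \<le> n - j" "n - j < n" using j by auto
  with main[of "n - j"] show ?thesis by (simp add: G_def)
qed

text \<open>The continuation of \<open>unit_fun\<close> to \<open>-n < j < 2 n\<close> for which \<open>V2_shift\<close> acts by the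
  same formula for all \<open>j\<close>.\<close>

definition refl_fun :: "int \<Rightarrow> int \<Rightarrow> int \<Rightarrow> int \<Rightarrow> int" where
  "refl_fun j r m s =
     (if j < 0 then 2 * unit_fun (int n + j) r m s - unit_fun (- j) (r + j) m s
      else if j = 0 \<or> j = int n then 2 * unit_fun (int n) r m s
      else if j < int n then unit_fun j r m s
      else unit_fun (2 * int n - j) (r + j - int n) m s)"

text \<open>Starting from the values on \<open>1..n - 1\<close>, the identity determines the
  continuation: read upwards it gives the doubled value at \<open>n\<close> and the reflection
  beyond, read downwards the doubled value at 0 and a difference of classes below it. The cases are
  the places where the branches of \<open>refl_fun\<close> or the special values of
  \<open>V2_shift\<close> meet.\<close>

lemma V2_shift_refl_fun:
  assumes "1 - int n < j" "j < 2 * int n - 1"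
  shows "V2_shift (refl_fun j r) m s = refl_fun (j + 1) r m s + refl_fun (j - 1) (r + 1) m s"
proof -
  have n: "2 < int n" using n_gt_2 by simp
  have V: "V2_shift (unit_fun i r) m s = unit_fun (i + 1) r m s + unit_fun (i - 1) (r + 1) m s"
    if "1 < i" "i < int n - 1" for i r using V2_shift_unit_fun(1)[OF that] .
  have lin: "V2_shift (\<lambda>m s. 2 * f m s - g m s) m s = 2 * V2_shift f m s - V2_shift g m s" for f g
    by (simp add: V2_shift_def)
  have lin2: "V2_shift (\<lambda>m s. 2 * f m s) m s = 2 * V2_shift f m s" for f by (rule V2_shift_scale)
  consider "j < -1" | "j = -1" | "j = 0" | "j = 1" | "1 < j" "j < int n - 1" | "j = int n - 1"
    | "j = int n" | "j = int n + 1" | "int n + 1 < j" by linarith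
  thus ?thesis
  proof cases
    case 1
    hence f: "refl_fun j r = (\<lambda>m s. 2 * unit_fun (int n + j) r m s - unit_fun (- j) (r + j) m s)"
      by (intro ext) (simp add: refl_fun_def)
    have "- j - 1 = - 1 - j" by simp
    note V' = V[of "- j" "r + j", unfolded this]
    show ?thesis unfolding f lin using 1 assms n V[of "int n + j" r] V'
      by (simp add: refl_fun_def algebra_simps)
  next
    case 2
    hence f: "refl_fun j r = (\<lambda>m s. 2 * unit_fun (int n - 1) r m s - unit_fun 1 (r - 1) m s)"
      by (intro ext) (simp add: refl_fun_def)
    show ?thesis unfolding f lin using 2 assms n
      by (simp add: refl_fun_def V2_shift_unit_fun)
  next
    case 3
    hence f: "refl_fun j r = (\<lambda>m s. 2 * unit_fun (int n) r m s)"
      by (intro ext) (simp add: refl_fun_def)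
    show ?thesis unfolding f lin2 using 3 assms n by (simp add: refl_fun_def V2_shift_unit_fun)
  next
    case 4
    hence f: "refl_fun j r = unit_fun 1 r" using n by (intro ext) (simp add: refl_fun_def)
    show ?thesis unfolding f using 4 assms n by (simp add: refl_fun_def V2_shift_unit_fun)
  next
    case 5
    hence f: "refl_fun j r = unit_fun j r" using n by (intro ext) (simp add: refl_fun_def)
    show ?thesis unfolding f V[OF 5] using 5 assms n by (simp add: refl_fun_def)
  next
    case 6
    hence f: "refl_fun j r = unit_fun (int n - 1) r" using n by (intro ext) (simp add: refl_fun_def)
    show ?thesis unfolding f using 6 assms n by (simp add: refl_fun_def V2_shift_unit_fun)
  next
    case 7
    hence f: "refl_fun j r = (\<lambda>m s. 2 * unit_fun (int n) r m s)" using n by (intro ext) (simp add: refl_fun_def)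
    show ?thesis unfolding f lin2 using 7 assms n by (simp add: refl_fun_def V2_shift_unit_fun)
  next
    case 8
    hence f: "refl_fun j r = unit_fun (int n - 1) (r + 1)" using n by (intro ext) (simp add: refl_fun_def)
    show ?thesis unfolding f using 8 assms n by (simp add: refl_fun_def V2_shift_unit_fun algebra_simps)
  next
    case 9
    hence f: "refl_fun j r = unit_fun (2 * int n - j) (r + j - int n)" using n by (intro ext) (simp add: refl_fun_def)
    show ?thesis unfolding f using 9 assms n V[of "2 * int n - j" "r + j - int n"]
      by (simp add: refl_fun_def algebra_simps)
  qed
qed

section \<open>Clebsch-Gordan sums and their reflection at the wall\<close>

text \<open>The upward neighbours together with the last downward one form the string of length
  \<open>j + 1\<close>; the remaining downward neighbours form the string of length
  \<open>j - 1\<close>, starting at \<open>r + 1\<close>.\<close>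

lemma V2_shift_refl_sum:
  assumes "1 - int n < k + 1 - int j" "k + int j - 1 < 2 * int n - 1" "0 < j"
  shows "V2_shift (\<lambda>m s. \<Sum>i<j. refl_fun (k + int j - 1 - 2 * int i) (r + int i) m s) m s =
    (\<Sum>i<j + 1. refl_fun (k + int (j + 1) - 1 - 2 * int i) (r + int i) m s) +
    (\<Sum>i<j - 1. refl_fun (k + int (j - 1) - 1 - 2 * int i) (r + 1 + int i) m s)"
proof -
  obtain j' where j': "j = Suc j'" using assms(3) by (cases j) auto
  have "V2_shift (\<lambda>m s. \<Sum>i<j. refl_fun (k + int j - 1 - 2 * int i) (r + int i) m s) m s =
    (\<Sum>i<j. refl_fun (k + int j - 2 * int i) (r + int i) m s + refl_fun (k + int j - 2 - 2 * int i) (r + int i + 1) m s)"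
    unfolding V2_shift_sum
  proof (intro sum.cong refl)
    fix i assume "i \<in> {..<j}"
    hence "1 - int n < k + int j - 1 - 2 * int i" "k + int j - 1 - 2 * int i < 2 * int n - 1"
      using assms by auto
    from V2_shift_refl_fun[OF this, of "r + int i" m s]
    show "V2_shift (refl_fun (k + int j - 1 - 2 * int i) (r + int i)) m s =
      refl_fun (k + int j - 2 * int i) (r + int i) m s + refl_fun (k + int j - 2 - 2 * int i) (r + int i + 1) m s"
      by (simp add: algebra_simps)
  qed
  also have "\<dots> = (\<Sum>i<j. refl_fun (k + int j - 2 * int i) (r + int i) m s)
      + (\<Sum>i<j. refl_fun (k + int j - 2 - 2 * int i) (r + int i + 1) m s)"
    by (rule sum.distrib)
  finally show ?thesis unfolding j' by (simp add: algebra_simps)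
qed

text \<open>Both sides satisfy the same two-term recursion in \<open>j\<close> and agree for
  \<open>j = 0\<close> and \<open>j = 1\<close>; for \<open>j \<le> n\<close> all indices stay in
  the range where the continuation obeys the recursion.\<close>

lemma simple_mult_P:
  assumes l: "1 \<le> l" "l < n" and j: "j \<le> n"
  shows "simple_mult (P l r') j r m s = (\<Sum>i<j. refl_fun (int l + int j - 1 - 2 * int i) (r + r' + int i) m s)"
  using j
proof (induction j arbitrary: r m s rule: less_induct)
  case (less j)
  have Q: "projective n q (P l r')" using l by (intro projective_P) auto
  note sQ = projective_shape[OF Q]
  consider "j = 0" | "j = 1" | i where "j = Suc i" "0 < i" by (cases j; cases "j - 1") auto
  thus ?case
  proof cases
    case 1
    thus ?thesis by (simp add: simple_mult_0[OF sQ])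
  next
    case 2
    thus ?thesis using l simple_mult_1[OF sQ, of r m s] mult_P[of l r']
      by (simp add: refl_fun_def unit_fun_def algebra_simps)
  next
    case (3 i)
    have f: "simple_mult (P l r') i r = (\<lambda>m s. \<Sum>k<i. refl_fun (int l + int i - 1 - 2 * int k) (r + r' + int k) m s)"
      using less.IH[of i] less.prems 3 by (intro ext) simp
    have "V2_shift (simple_mult (P l r') i r) m s = simple_mult (P l r') (i + 1) r m s + simple_mult (P l r') (i - 1) (r + 1) m s"
      using simple_mult_rec[OF Q, of i r m s] less.prems 3 by simp
    moreover have "simple_mult (P l r') (i - 1) (r + 1) m s =
       (\<Sum>k<i - 1. refl_fun (int l + int (i - 1) - 1 - 2 * int k) (r + r' + 1 + int k) m s)"
      using less.IH[of "i - 1" "r + 1" m s] less.prems 3 by (simp add: algebra_simps)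
    ultimately show ?thesis
      using V2_shift_refl_sum[of "int l" i "r + r'" m s] l less.prems 3 unfolding f by simp
  qed
qed

text \<open>Applied at length \<open>n\<close>, the recursion yields a formal string of length
  \<open>n + 1\<close> besides the string of length \<open>n - 1\<close>. The interior of the former
  is a second copy of the latter. Its ends have indices \<open>l + n\<close> and
  \<open>l - n\<close>: the first reflects to \<open>n - l\<close>, the second is twice the class at
  \<open>l\<close> minus that same class, so together they give twice the class at
  \<open>l\<close>.\<close>

lemma top_identity:
  assumes l: "1 \<le> l" "l < n"
  shows "V2_shift (simple_mult (P l r') n r) m s =
    2 * simple_mult (P l r') (n - 1) (r + 1) m s + 2 * simple_mult (P l r') 1 (r + int n) m s"
proof -
  let ?x = "\<lambda>i :: nat. refl_fun (int l + int n - 2 * int i) (r + r' + int i) m s"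
  obtain n' where n': "n = Suc n'" using n_gt_2 by (cases n) auto
  have f: "simple_mult (P l r') n r = (\<lambda>m s. \<Sum>k<n. refl_fun (int l + int n - 1 - 2 * int k) (r + r' + int k) m s)"
    using simple_mult_P[OF l, of n] by (intro ext) simp
  have g: "simple_mult (P l r') (n - 1) (r + 1) m s =
       (\<Sum>k<n - 1. refl_fun (int l + int (n - 1) - 1 - 2 * int k) (r + r' + 1 + int k) m s)"
    using simple_mult_P[OF l, of "n - 1" r' "r + 1"] by (simp add: algebra_simps)
  have h: "simple_mult (P l r') 1 (r + int n) m s = refl_fun (int l) (r + int n + r') m s"
    using simple_mult_P[OF l, of 1 r' "r + int n"] l by simp
  have "V2_shift (simple_mult (P l r') n r) m s =
     (\<Sum>i<n + 1. refl_fun (int l + int (n + 1) - 1 - 2 * int i) (r + r' + int i) m s) + simple_mult (P l r') (n - 1) (r + 1) m s"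
    unfolding f g using l by (intro V2_shift_refl_sum) auto
  also have "(\<Sum>i<n + 1. refl_fun (int l + int (n + 1) - 1 - 2 * int i) (r + r' + int i) m s) = (\<Sum>i<n + 1. ?x i)"
    by simp
  also have "\<dots> = ?x 0 + (\<Sum>i<n - 1. ?x (Suc i)) + ?x n"
    unfolding n' by (simp add: sum.lessThan_Suc_shift[of _ "Suc n'"] del: sum.lessThan_Suc) (simp add: sum.lessThan_Suc)
  also have "(\<Sum>i<n - 1. ?x (Suc i)) = simple_mult (P l r') (n - 1) (r + 1) m s"
    unfolding g using n_gt_2 by (intro sum.cong refl) (simp add: of_nat_diff algebra_simps)
  also have "?x 0 + simple_mult (P l r') (n - 1) (r + 1) m s + ?x n = simple_mult (P l r') (n - 1) (r + 1) m s + (?x 0 + ?x n)"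
    by simp
  also have "?x 0 + ?x n = 2 * simple_mult (P l r') 1 (r + int n) m s"
  proof -
    have 1: "?x 0 = unit_fun (int n - int l) (r + r' + int l) m s"
      using l by (simp add: refl_fun_def algebra_simps)
    have 2: "?x n = 2 * unit_fun (int l) (r + r' + int n) m s - unit_fun (int n - int l) (r + r' + int l) m s"
      using l by (simp add: refl_fun_def algebra_simps)
    show ?thesis unfolding 1 2 h using l by (simp add: refl_fun_def algebra_simps)
  qed
  finally show ?thesis by simp
qed

lemma ceil_half_le_iff: "ceil_half t \<le> i \<longleftrightarrow> t \<le> 2 * i"
proof -
  have "ceil_half t = (t + 1) div 2"
    unfolding ceil_half_def using floor_divide_of_int_eq[of "t + 1" 2] by simp
  thus ?thesis by auto
qed

text \<open>Folding at \<open>n\<close>: the summands at \<open>i\<close> and \<open>w - i\<close> coincide.\<close>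

lemma refl_sum_fold:
  assumes w: "a + b = w" and n: "b - a < int n"
  shows "(\<Sum>i\<in>{a..b}. refl_fun (int n + w - 2 * i) (r + i) m s) =
    2 * (\<Sum>i\<in>{ceil_half w..b}. unit_fun (int n + w - 2 * i) (r + i) m s)"
proof -
  let ?x = "\<lambda>i. refl_fun (int n + w - 2 * i) (r + i) m s" and ?e = "\<lambda>i. unit_fun (int n + w - 2 * i) (r + i) m s"
  have np: "0 < int n" using n_gt_2 by simp
  \<comment> \<open>\<open>b - a < n\<close> keeps every index \<open>n + w - 2 i\<close> strictly
    between 0 and \<open>2 n\<close>, so the branches for indices at or below 0 never enter.\<close>
  have ge: "?x i = ?e i" if "i \<in> {a..b}" "w < 2 * i" for i
    using that n w np by (auto simp: refl_fun_def)
  \<comment> \<open>The midpoint has index \<open>n\<close> and no partner, but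
    \<open>refl_fun\<close> is already doubled there; hence the folded sum has the factor 2 without
    exception.\<close>
  have eq: "?x i = 2 * ?e i" if "w = 2 * i" for i
    using that by (simp add: refl_fun_def)
  have lt: "?x i = ?e (w - i)" if "i \<in> {a..b}" "2 * i < w" for i
    using that n w np by (auto simp: refl_fun_def algebra_simps)
  have fin: "finite {i \<in> {a..b}. T i}" for T by (rule finite_subset[of _ "{a..b}"]) auto
  have "{a..b} = {i\<in>{a..b}. 2 * i < w} \<union> ({i\<in>{a..b}. 2 * i = w} \<union> {i\<in>{a..b}. w < 2 * i})" by auto
  hence "(\<Sum>i\<in>{a..b}. ?x i) = (\<Sum>i\<in>{i\<in>{a..b}. 2 * i < w} \<union> ({i\<in>{a..b}. 2 * i = w} \<union> {i\<in>{a..b}. w < 2 * i}). ?x i)"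
    by (rule arg_cong)
  also have "\<dots> = (\<Sum>i\<in>{i\<in>{a..b}. 2 * i < w}. ?x i) + (\<Sum>i\<in>{i\<in>{a..b}. 2 * i = w} \<union> {i\<in>{a..b}. w < 2 * i}. ?x i)"
    by (rule sum.union_disjoint[OF fin finite_UnI[OF fin fin]]) auto
  also have "(\<Sum>i\<in>{i\<in>{a..b}. 2 * i = w} \<union> {i\<in>{a..b}. w < 2 * i}. ?x i) =
      (\<Sum>i\<in>{i\<in>{a..b}. 2 * i = w}. ?x i) + (\<Sum>i\<in>{i\<in>{a..b}. w < 2 * i}. ?x i)"
    by (rule sum.union_disjoint[OF fin fin]) auto
  finally have S: "(\<Sum>i\<in>{a..b}. ?x i) = (\<Sum>i\<in>{i\<in>{a..b}. 2 * i < w}. ?x i) +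
      ((\<Sum>i\<in>{i\<in>{a..b}. 2 * i = w}. ?x i) + (\<Sum>i\<in>{i\<in>{a..b}. w < 2 * i}. ?x i))" .
  have L: "(\<Sum>i\<in>{i\<in>{a..b}. 2 * i < w}. ?x i) = (\<Sum>i\<in>{i\<in>{a..b}. w < 2 * i}. ?e i)"
  proof -
    have "(\<Sum>i\<in>{i\<in>{a..b}. 2 * i < w}. ?x i) = (\<Sum>i\<in>{i\<in>{a..b}. 2 * i < w}. ?e (w - i))"
      using lt by (intro sum.cong) auto
    also have "\<dots> = (\<Sum>i\<in>{i\<in>{a..b}. w < 2 * i}. ?e i)"
      by (rule sum.reindex_bij_witness[of _ "\<lambda>i. w - i" "\<lambda>i. w - i"]) (use w in auto)
    finally show ?thesis .
  qed
  have M: "(\<Sum>i\<in>{i\<in>{a..b}. 2 * i = w}. ?x i) = 2 * (\<Sum>i\<in>{i\<in>{a..b}. 2 * i = w}. ?e i)"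
    unfolding sum_distrib_left using eq by (intro sum.cong) auto
  have R: "(\<Sum>i\<in>{i\<in>{a..b}. w < 2 * i}. ?x i) = (\<Sum>i\<in>{i\<in>{a..b}. w < 2 * i}. ?e i)"
    using ge by (intro sum.cong) auto
  have "{ceil_half w..b} = {i\<in>{a..b}. 2 * i = w} \<union> {i\<in>{a..b}. w < 2 * i}"
    using w by (auto simp: ceil_half_le_iff)
  hence "(\<Sum>i\<in>{ceil_half w..b}. ?e i) = (\<Sum>i\<in>{i\<in>{a..b}. 2 * i = w}. ?e i) + (\<Sum>i\<in>{i\<in>{a..b}. w < 2 * i}. ?e i)"
    by (simp only:) (rule sum.union_disjoint[OF fin fin]; auto)
  thus ?thesis unfolding S L M R by simp
qed

lemma sum_int_nat: "(\<Sum>i<k. f (int i)) = (\<Sum>i\<in>{0..int k - 1}. f i :: int)"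
  by (rule sum.reindex_bij_witness[of _ nat int]) auto

text \<open>Only reflections at \<open>n\<close> occur here, as \<open>l \<le> l'\<close>.\<close>

lemma cover_mult_P:
  assumes l: "1 \<le> l" "l \<le> l'" "l' < n" and t: "t = int l + int l' - (int n + 1)" "t \<ge> 0"
  shows "cover_mult (P l' r') l r m s =
    4 * (\<Sum>i\<in>{ceil_half t..t}. unit_fun (int l + int l' - 1 - 2 * i) (r + r' + i) m s)
    + 2 * (\<Sum>i\<in>{t + 1..int l - 1}. unit_fun (int l + int l' - 1 - 2 * i) (r + r' + i) m s)
    + 2 * (\<Sum>i\<in>{int l'..int n - 1}. unit_fun (int n + int l + int l' - 1 - 2 * i) (r + r' + i) m s)
    + 4 * (\<Sum>i\<in>{ceil_half (int l' + int l - 1)..int l' - 1}. unit_fun (int n + int l + int l' - 1 - 2 * i) (r + r' + i) m s)"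
proof -
  have l': "1 \<le> l'" using l by simp
  have Q: "projective n q (P l' r')" using l by (intro projective_P) auto
  have ln: "1 \<le> l" "l < n" using l by auto
  have "cover_mult (P l' r') l r m s =
     2 * simple_mult (P l' r') l r m s + 2 * simple_mult (P l' r') (n - l) (r + int l) m s"
    using cover_tensor[OF Q top_identity[OF l' l(3)] ln, of r] by blast
  moreover have "simple_mult (P l' r') l r m s =
     2 * (\<Sum>i\<in>{ceil_half t..t}. unit_fun (int l + int l' - 1 - 2 * i) (r + r' + i) m s)
     + (\<Sum>i\<in>{t + 1..int l - 1}. unit_fun (int l + int l' - 1 - 2 * i) (r + r' + i) m s)"
  proof -
    have "simple_mult (P l' r') l r m s = (\<Sum>i<l. refl_fun (int n + t - 2 * int i) (r + r' + int i) m s)"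
      unfolding simple_mult_P[OF l' l(3) less_imp_le[OF ln(2)]]
      by (intro sum.cong refl) (simp add: t(1) algebra_simps)
    also have "\<dots> = (\<Sum>i\<in>{0..int l - 1}. refl_fun (int n + t - 2 * i) (r + r' + i) m s)"
      by (rule sum_int_nat)
    \<comment> \<open>As \<open>l + l' - 1 = n + t\<close>, the indices for \<open>i\<close> in
      \<open>0..t\<close> are symmetric about \<open>n\<close> and fold; for larger \<open>i\<close>
      they lie between 1 and \<open>n - 1\<close>, the lower bound being
      \<open>l \<le> l'\<close>.\<close>
    also have "{0..int l - 1} = {0..t} \<union> {t + 1..int l - 1}" using t l by auto
    also have "(\<Sum>i\<in>\<dots>. refl_fun (int n + t - 2 * i) (r + r' + i) m s) =
        (\<Sum>i\<in>{0..t}. refl_fun (int n + t - 2 * i) (r + r' + i) m s)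
        + (\<Sum>i\<in>{t + 1..int l - 1}. refl_fun (int n + t - 2 * i) (r + r' + i) m s)"
      by (rule sum.union_disjoint) auto
    also have "(\<Sum>i\<in>{0..t}. refl_fun (int n + t - 2 * i) (r + r' + i) m s) =
        2 * (\<Sum>i\<in>{ceil_half t..t}. unit_fun (int n + t - 2 * i) (r + r' + i) m s)"
      by (rule refl_sum_fold) (use t l in auto)
    also have "(\<Sum>i\<in>{t + 1..int l - 1}. refl_fun (int n + t - 2 * i) (r + r' + i) m s) =
        (\<Sum>i\<in>{t + 1..int l - 1}. unit_fun (int n + t - 2 * i) (r + r' + i) m s)"
      using t l by (intro sum.cong refl) (auto simp: refl_fun_def)
    also have "int n + t = int l + int l' - 1" using t by simp
    finally show ?thesis .
  qed
  moreover have "simple_mult (P l' r') (n - l) (r + int l) m s =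
     (\<Sum>i\<in>{int l'..int n - 1}. unit_fun (int n + int l + int l' - 1 - 2 * i) (r + r' + i) m s)
     + 2 * (\<Sum>i\<in>{ceil_half (int l' + int l - 1)..int l' - 1}. unit_fun (int n + int l + int l' - 1 - 2 * i) (r + r' + i) m s)"
  proof -
    let ?w = "int l' + int l - 1"
    let ?x = "\<lambda>i. refl_fun (int n + ?w - 2 * i) (r + r' + i) m s" and ?e = "\<lambda>i. unit_fun (int n + ?w - 2 * i) (r + r' + i) m s"
    \<comment> \<open>Shifting the summation index by \<open>l\<close> absorbs the offset
      \<open>r + l\<close>, so that both strings carry the second label
      \<open>r + r' + i\<close>.\<close>
    have "simple_mult (P l' r') (n - l) (r + int l) m s = (\<Sum>i<n - l. ?x (int l + int i))"
      unfolding simple_mult_P[OF l' l(3) diff_le_self] using ln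
      by (intro sum.cong refl) (simp add: of_nat_diff algebra_simps)
    also have "\<dots> = (\<Sum>i\<in>{int l..int n - 1}. ?x i)"
      by (rule sum.reindex_bij_witness[of _ "\<lambda>i. nat (i - int l)" "\<lambda>i. int l + int i"]) (use ln in auto)
    \<comment> \<open>Here the symmetric part is \<open>l..l' - 1\<close>, whose end points add up
      to \<open>l + l' - 1\<close>; it is empty for \<open>l = l'\<close>. On the rest the indices
      are below \<open>n\<close>, and at least \<open>t + 2\<close>.\<close>
    also have "{int l..int n - 1} = {int l..int l' - 1} \<union> {int l'..int n - 1}" using l by auto
    also have "(\<Sum>i\<in>\<dots>. ?x i) = (\<Sum>i\<in>{int l..int l' - 1}. ?x i) + (\<Sum>i\<in>{int l'..int n - 1}. ?x i)"
      by (rule sum.union_disjoint) auto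
    also have "(\<Sum>i\<in>{int l..int l' - 1}. ?x i) = 2 * (\<Sum>i\<in>{ceil_half ?w..int l' - 1}. ?e i)"
      by (rule refl_sum_fold) (use l in auto)
    also have "(\<Sum>i\<in>{int l'..int n - 1}. ?x i) = (\<Sum>i\<in>{int l'..int n - 1}. ?e i)"
      using t l by (intro sum.cong refl) (auto simp: refl_fun_def)
    finally show ?thesis by (simp add: algebra_simps)
  qed
  ultimately show ?thesis by simp
qed

section \<open>Assembling the direct sums of copies\<close>

lemma copies_P:
  assumes "1 \<le> j" "j \<le> n"
  shows "projective n q (copies k (P j r))" "mult (copies k (P j r)) m s = int k * unit_fun (int j) r m s"
proof -
  have pr: "projective n q (P j r)" by (rule projective_P[OF assms])
  show "projective n q (copies k (P j r))" unfolding copies_def using pr by (intro projective_direct_sum) auto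
  show "mult (copies k (P j r)) m s = int k * unit_fun (int j) r m s"
    unfolding copies_def using hom_dim_direct_sum[of "replicate k (P j r)"] projective_shape[OF pr]
    by (simp add: mult_P[OF assms, symmetric] mult_def sum_list_replicate)
qed

lemma int_sum_list: "int (sum_list (map f xs)) = sum_list (map (\<lambda>x. int (f x)) xs)"
  by (induction xs) auto

lemma sum_of_copies:
  assumes "\<And>i. i \<in> {a..b} \<Longrightarrow> 1 \<le> J i \<and> J i \<le> int n"
  shows "projective n q (direct_sum (map (\<lambda>i. copies k (P (nat (J i)) (R i))) [a..b]))"
    "mult (direct_sum (map (\<lambda>i. copies k (P (nat (J i)) (R i))) [a..b])) m s = int k * (\<Sum>i\<in>{a..b}. unit_fun (J i) (R i) m s)"
proof -
  let ?C = "\<lambda>i. copies k (P (nat (J i)) (R i))"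
  let ?D = "direct_sum (map ?C [a..b])"
  have c: "projective n q (?C i)" "mult (?C i) m s = int k * unit_fun (J i) (R i) m s" if "i \<in> {a..b}" for i m s
    using copies_P[of "nat (J i)" k "R i"] assms[OF that] by (auto simp: nat_le_iff)
  show "projective n q ?D" using c by (intro projective_direct_sum) auto
  have "mult ?D m s = sum_list (map (\<lambda>i. mult (?C i) m s) [a..b])"
  proof (cases "1 \<le> m \<and> m \<le> int n")
    case True
    have "hom_dim ?D (simple_module q (nat m) s) = sum_list (map (\<lambda>M. hom_dim M (simple_module q (nat m) s)) (map ?C [a..b]))"
      using c(1)[THEN projective_shape] by (intro hom_dim_direct_sum) auto
    hence "mult ?D m s = int (sum_list (map (\<lambda>i. hom_dim (?C i) (simple_module q (nat m) s)) [a..b]))"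
      using True by (simp add: mult_def o_def)
    also have "\<dots> = sum_list (map (\<lambda>i. int (hom_dim (?C i) (simple_module q (nat m) s))) [a..b])"
      by (rule int_sum_list)
    also have "\<dots> = sum_list (map (\<lambda>i. mult (?C i) m s) [a..b])" using True by (simp add: mult_def)
    finally show ?thesis .
  qed (auto simp: mult_def sum_list_0)
  also have "\<dots> = (\<Sum>i\<in>{a..b}. mult (?C i) m s)"
    by (simp add: interv_sum_list_conv_sum_set_int)
  also have "\<dots> = int k * (\<Sum>i\<in>{a..b}. unit_fun (J i) (R i) m s)"
    unfolding sum_distrib_left using c(2) by (intro sum.cong) auto
  finally show "mult ?D m s = int k * (\<Sum>i\<in>{a..b}. unit_fun (J i) (R i) m s)" .
qed

lemma direct_sum2_mult:
  assumes "projective n q A" "projective n q B"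
  shows "projective n q (A \<oplus>\<^sub>H B)" "mult (A \<oplus>\<^sub>H B) m s = mult A m s + mult B m s"
proof -
  have "hom_dim (direct_sum [A, B]) (simple_module q (nat m) s) =
      hom_dim A (simple_module q (nat m) s) + hom_dim B (simple_module q (nat m) s)"
    using hom_dim_direct_sum[of "[A, B]" "simple_module q (nat m) s"] assms[THEN projective_shape] by auto
  thus "mult (A \<oplus>\<^sub>H B) m s = mult A m s + mult B m s" by (simp add: direct_sum2_def mult_def)
  show "projective n q (A \<oplus>\<^sub>H B)"
    unfolding direct_sum2_def using assms by (intro projective_direct_sum) auto
qed

end

theorem corollary4p6:
  fixes q :: "'k::alg_closed_field"
    and n l l' :: nat
    and r r' t :: int
    and P :: "nat \<Rightarrow> int \<Rightarrow> 'k hmod"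
  assumes "n > 2"
    and "primitive_root_of_unity n q"
    and "\<And>m s. 1 \<le> m \<Longrightarrow> m < n \<Longrightarrow> projective_cover n q (P m s) (simple_module q m s)"
    and "\<And>s. P n s = simple_module q n s"
    and "2 \<le> l" and "l \<le> l'" and "l' < n"
    and "t = int l + int l' - (int n + 1)" and "t \<ge> 0"
  shows "P l r \<otimes>\<^sub>H P l' r' \<cong>\<^sub>H
      direct_sum (map (\<lambda>i. copies 4 (P (nat (int l + int l' - 1 - 2 * i)) (r + r' + i)))
        [ceil_half t..t])
   \<oplus>\<^sub>H direct_sum (map (\<lambda>i. copies 2 (P (nat (int l + int l' - 1 - 2 * i)) (r + r' + i)))
        [t + 1..int l - 1])
   \<oplus>\<^sub>H direct_sum (map (\<lambda>i. copies 2 (P (nat (int n + int l + int l' - 1 - 2 * i)) (r + r' + i)))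
        [int l'..int n - 1])
   \<oplus>\<^sub>H direct_sum (map (\<lambda>i. copies 4 (P (nat (int n + int l + int l' - 1 - 2 * i)) (r + r' + i)))
        [ceil_half (int l' + int l - 1)..int l' - 1])"
proof -
  interpret projective_covers n q P by unfold_locales (rule assms(1,2,4) | (rule assms(3); assumption))+
  have l: "1 \<le> l" "l < n" "1 \<le> l'" using assms by auto
  have Q: "projective n q (P l' r')" using assms by (intro projective_P) auto
  let ?J = "\<lambda>i. int l + int l' - 1 - 2 * i" and ?K = "\<lambda>i. int n + int l + int l' - 1 - 2 * i"
  let ?D = "\<lambda>k J xs. direct_sum (map (\<lambda>i. copies k (P (nat (J i)) (r + r' + i))) xs)"
  \<comment> \<open>Starting at \<open>ceil_half t\<close> means \<open>t \<le> 2 i\<close>, that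
    is, an index \<open>n + t - 2 i\<close> of at most \<open>n\<close>: of each reflected pair only
    the member in range is kept.\<close>
  have 1: "1 \<le> ?J i \<and> ?J i \<le> int n" if "i \<in> {ceil_half t..t}" for i
    using that assms by (auto simp: ceil_half_le_iff)
  have 2: "1 \<le> ?J i \<and> ?J i \<le> int n" if "i \<in> {t + 1..int l - 1}" for i using that assms by auto
  have 3: "1 \<le> ?K i \<and> ?K i \<le> int n" if "i \<in> {int l'..int n - 1}" for i using that assms by auto
  have 4: "1 \<le> ?K i \<and> ?K i \<le> int n" if "i \<in> {ceil_half (int l' + int l - 1)..int l' - 1}" for i
    using that assms by (auto simp: ceil_half_le_iff)
  note D = sum_of_copies(1)[where R = "\<lambda>i. r + r' + i"] and M = sum_of_copies(2)[where R = "\<lambda>i. r + r' + i"]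
  have D1: "projective n q (?D 4 ?J [ceil_half t..t])" by (rule D[OF 1])
  have D2: "projective n q (?D 2 ?J [t + 1..int l - 1])" by (rule D[OF 2])
  have D3: "projective n q (?D 2 ?K [int l'..int n - 1])" by (rule D[OF 3])
  have D4: "projective n q (?D 4 ?K [ceil_half (int l' + int l - 1)..int l' - 1])" by (rule D[OF 4])
  note D34 = direct_sum2_mult[OF D3 D4]
  note D234 = direct_sum2_mult[OF D2 D34(1)]
  note D1234 = direct_sum2_mult[OF D1 D234(1)]
  show ?thesis
  proof (rule iso_of_mult_eq[OF _ D1234(1)])
    show "projective n q (P l r \<otimes>\<^sub>H P l' r')"
      using cover_tensor[OF Q top_identity[OF l(3) assms(7)] l(1,2)] by blast
    fix m s
    have "mult (?D 4 ?J [ceil_half t..t]) m s = int 4 * (\<Sum>i\<in>{ceil_half t..t}. unit_fun (?J i) (r + r' + i) m s)"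
      by (rule M[OF 1])
    moreover have "mult (?D 2 ?J [t + 1..int l - 1]) m s = int 2 * (\<Sum>i\<in>{t + 1..int l - 1}. unit_fun (?J i) (r + r' + i) m s)"
      by (rule M[OF 2])
    moreover have "mult (?D 2 ?K [int l'..int n - 1]) m s = int 2 * (\<Sum>i\<in>{int l'..int n - 1}. unit_fun (?K i) (r + r' + i) m s)"
      by (rule M[OF 3])
    moreover have "mult (?D 4 ?K [ceil_half (int l' + int l - 1)..int l' - 1]) m s =
        int 4 * (\<Sum>i\<in>{ceil_half (int l' + int l - 1)..int l' - 1}. unit_fun (?K i) (r + r' + i) m s)"
      by (rule M[OF 4])
    ultimately show "mult (P l r \<otimes>\<^sub>H P l' r') m s = mult (?D 4 ?J [ceil_half t..t] \<oplus>\<^sub>H ?D 2 ?J [t + 1..int l - 1]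
       \<oplus>\<^sub>H ?D 2 ?K [int l'..int n - 1] \<oplus>\<^sub>H ?D 4 ?K [ceil_half (int l' + int l - 1)..int l' - 1]) m s"
      unfolding D1234(2) D234(2) D34(2)
      using cover_mult_P[OF l(1) assms(6-9), of r' r m s] by (simp add: cover_mult_def)
  qed
qed

end
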